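(* Let $\psi$ be a QCBF instance and let $n\ge 1$. There exists a tree-like clause judgement proof $P$ (viewed as a tree) of an empty clause with exactly $n$ non-flow judgements if and only if there exists a trace $T$ of $\psi$ whose root has label $(\emptyset,e)$ and which has exactly $n$ nodes. Moreover, both translations (from such a proof to such a trace, and from such a trace to such a proof) are computable in polynomial time.
   Context: A literal is a propositional variable $v$ or its negation $\overline{v}$; $v,\overline{v}$ are complementary. A clause is a disjunction of literals with at most one literal on each variable (also a set of literals); it is empty if it has no literals; $\mathrm{vars}(\alpha)$ is its set of variables. $\gamma$ is a resolvent of $\alpha,\beta$ if there is $L\in\alpha$ with complement $M\in\beta$ and $\gamma=(\alpha\setminus\{L\})\cup(\beta\setminus\{M\})$ is a clause. A clause $\gamma$ is falsified by an assignment $a$ if $a$ is defined on $\mathrm{vars}(\gamma)$ and every literal of $\gamma$ is false under $a$. A QCBF instance is a propositional formula without free variables built from clauses, conjunction and $\forall/\exists$ quantification; $I_\psi$ has one index per subformula occurrence (a clause has no proper subformulas), $\psi(i)$ is the subformula at $i$, parent/child refer to the syntax tree. Clause judgements and proofs: a clause judgement is $(i,\alpha)$ with $\mathrm{vars}(\alpha)\subseteq\mathrm{free}(\psi(i))$; empty if $\alpha$ is empty. A clause judgement proof is a finite sequence of clause judgements each of one of the types: (clause) $(i,\alpha)$ with $\psi(i)$ the clause $\alpha$; (resolve) $(i,\gamma)$ from previous $(i,\alpha),(i,\beta)$ with $\gamma$ a resolvent of $\alpha,\beta$; (upward flow) $(i,\alpha)$ from previous $(j,\alpha)$, $i$ the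 parent of $j$; ($\forall$-removal) $(i,\alpha\setminus\{y,\overline{y}\})$ from previous $(j,\alpha)$ with $\psi(i)=\forall y\,\psi(j)$, $i$ the parent of $j$; (downward flow) $(j,\alpha)$ from previous $(i,\alpha)$, $i$ the parent of $j$. Non-flow judgements are those not derived by (upward flow) or (downward flow). A judgement derived using a previous judgement $J$ is a successor of $J$, and $J$ a predecessor of it. A proof is tree-like if each judgement has at most one successor; then each judgement induces a tree whose root is labelled with it and whose root's children are the trees of its predecessors; a tree-like proof of an empty clause is the tree induced by an empty clause judgement. Located variables: $i\le_\psi j$ means $i$ lies on the path from $j$ to the root; $i<_\psi j$ means $i\le_\psi j$ and $i\ne j$. A located variable is a pair $(i,u)$ with $u$ quantified at location $i$; it is $\forall$-located if $u$ is universally quantified there. An index $j$ follows $(i,u)$ if $i<_\psi j$ and $u\in\mathrm{free}(\psi(k))$ for every $k$ with $i<_\psi k\le_\psi j$; a located variable $(j,v)$ follows $(i,u)$ if $j$ does; an index or located variable follows a set $S$ of located variables if it follows each element of $S$. $S$ is coherent if of any two distinct elements one follows the other. $\mathrm{vars}(S)$ is the set of variables in $S$. $e$ is the unique assignment $\emptyset\to\{0,1\}$. For an assignment $a$, $a\upharpoonright X$ is restriction and $a[u\to b]$ the extension mapping $u$ to $b$. A trace of $\psi$ is a rooted tree in which each node has a label $(S,a)$ with $S$ a coherent set of located variables and $a:\mathrm{vars}(S)\to\{0,1\}$, and each node has $0$, $1$ or $2$ children, such that: if a node labelled $(S,a)$ has $2$ children, their labels are $(S_0\cup\{(i,u)\},(a\upharpoonright\mathrm{vars}(S_0))[u\to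 0])$ and $(S_1\cup\{(i,u)\},(a\upharpoonright\mathrm{vars}(S_1))[u\to 1])$ for some located variable $(i,u)\notin S$ with $S\cup\{(i,u)\}$ coherent and some $S_0,S_1\subseteq S$ with $S_0\cup S_1=S$; if it has $1$ child, its label is $(S\cup\{(i,y)\},a[y\to b])$ for some $\forall$-located variable $(i,y)$ following $S$ and some $b\in\{0,1\}$; if it has $0$ children, there is an index $i$ following $S$ such that $\psi(i)$ is a clause falsified by $a$ with $\mathrm{vars}(\psi(i))=\mathrm{vars}(S)$. *)

theory Defs
  imports "HOL-Library.Sublist"
begin

section \<open>Clauses and QCBF instances\<close>

datatype lit = Pos nat | Neg nat

fun var_of :: "lit \<Rightarrow> nat" where
  "var_of (Pos v) = v"
| "var_of (Neg v) = v"

fun compl :: "lit \<Rightarrow> lit" where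
  "compl (Pos v) = Neg v"
| "compl (Neg v) = Pos v"

definition is_clause :: "lit set \<Rightarrow> bool" where
  "is_clause \<alpha> \<longleftrightarrow> finite \<alpha> \<and> inj_on var_of \<alpha>"

definition cvars :: "lit set \<Rightarrow> nat set" where
  "cvars \<alpha> = var_of ` \<alpha>"

definition resolvent :: "lit set \<Rightarrow> lit set \<Rightarrow> lit set \<Rightarrow> bool" where
  "resolvent \<alpha> \<beta> \<gamma> \<longleftrightarrow>
     (\<exists>L\<in>\<alpha>. compl L \<in> \<beta> \<and> \<gamma> = (\<alpha> - {L}) \<union> (\<beta> - {compl L}) \<and> is_clause \<gamma>)"

type_synonym assignment = "nat \<rightharpoonup> bool"

fun lit_false :: "assignment \<Rightarrow> lit \<Rightarrow> bool" where
  "lit_false a (Pos v) \<longleftrightarrow> a v = Some False"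
| "lit_false a (Neg v) \<longleftrightarrow> a v = Some True"

definition falsified :: "lit set \<Rightarrow> assignment \<Rightarrow> bool" where
  "falsified \<gamma> a \<longleftrightarrow> cvars \<gamma> \<subseteq> dom a \<and> (\<forall>L\<in>\<gamma>. lit_false a L)"

datatype qcbf =
    Clause "lit set"
  | Conj qcbf qcbf
  | All nat qcbf
  | Exi nat qcbf

fun wf_qcbf :: "qcbf \<Rightarrow> bool" where
  "wf_qcbf (Clause \<alpha>) \<longleftrightarrow> is_clause \<alpha>"
| "wf_qcbf (Conj \<phi> \<chi>) \<longleftrightarrow> wf_qcbf \<phi> \<and> wf_qcbf \<chi>"
| "wf_qcbf (All v \<phi>) \<longleftrightarrow> wf_qcbf \<phi>"
| "wf_qcbf (Exi v \<phi>) \<longleftrightarrow> wf_qcbf \<phi>"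

fun free :: "qcbf \<Rightarrow> nat set" where
  "free (Clause \<alpha>) = cvars \<alpha>"
| "free (Conj \<phi> \<chi>) = free \<phi> \<union> free \<chi>"
| "free (All v \<phi>) = free \<phi> - {v}"
| "free (Exi v \<phi>) = free \<phi> - {v}"

definition qcbf_instance :: "qcbf \<Rightarrow> bool" where
  "qcbf_instance \<psi> \<longleftrightarrow> wf_qcbf \<psi> \<and> free \<psi> = {}"

text \<open>Indices are root-to-node paths in the syntax tree, given by child numbers; the
  ancestors of a node are then exactly the prefixes of its path.\<close>

type_synonym index = "nat list"

fun children :: "qcbf \<Rightarrow> qcbf list" where
  "children (Clause \<alpha>) = []"
| "children (Conj \<phi> \<chi>) = [\<phi>, \<chi>]"
| "children (All v \<phi>) = [\<phi>]"
| "children (Exi v \<phi>) = [\<phi>]"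

fun sub_at :: "qcbf \<Rightarrow> index \<Rightarrow> qcbf option" where
  "sub_at \<psi> [] = Some \<psi>"
| "sub_at \<psi> (k # i) =
     (if k < length (children \<psi>) then sub_at (children \<psi> ! k) i else None)"

definition indices :: "qcbf \<Rightarrow> index set" where
  "indices \<psi> = dom (sub_at \<psi>)"

definition free_at :: "qcbf \<Rightarrow> index \<Rightarrow> nat set" where
  "free_at \<psi> i = free (the (sub_at \<psi> i))"

definition is_parent :: "qcbf \<Rightarrow> index \<Rightarrow> index \<Rightarrow> bool" where
  "is_parent \<psi> i j \<longleftrightarrow> j \<in> indices \<psi> \<and> (\<exists>k. j = i @ [k])"

section \<open>Clause judgement proofs\<close>

datatype 'a tree = Node (root: 'a) (subtrees: "'a tree list")

type_synonym judgement = "index \<times> lit set"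

definition is_judgement :: "qcbf \<Rightarrow> judgement \<Rightarrow> bool" where
  "is_judgement \<psi> J \<longleftrightarrow> (case J of (i, \<alpha>) \<Rightarrow>
     i \<in> indices \<psi> \<and> is_clause \<alpha> \<and> cvars \<alpha> \<subseteq> free_at \<psi> i)"

text \<open>Each rule relates a judgement to the list of its predecessors.\<close>

definition clause_rule :: "qcbf \<Rightarrow> judgement \<Rightarrow> judgement list \<Rightarrow> bool" where
  "clause_rule \<psi> J Js \<longleftrightarrow> (\<exists>i \<alpha>. J = (i, \<alpha>) \<and> Js = [] \<and> sub_at \<psi> i = Some (Clause \<alpha>))"

definition resolve_rule :: "qcbf \<Rightarrow> judgement \<Rightarrow> judgement list \<Rightarrow> bool" where
  "resolve_rule \<psi> J Js \<longleftrightarrow>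
     (\<exists>i \<alpha> \<beta> \<gamma>. J = (i, \<gamma>) \<and> Js = [(i, \<alpha>), (i, \<beta>)] \<and> resolvent \<alpha> \<beta> \<gamma>)"

definition upward_flow :: "qcbf \<Rightarrow> judgement \<Rightarrow> judgement list \<Rightarrow> bool" where
  "upward_flow \<psi> J Js \<longleftrightarrow> (\<exists>i j \<alpha>. J = (i, \<alpha>) \<and> Js = [(j, \<alpha>)] \<and> is_parent \<psi> i j)"

definition forall_removal :: "qcbf \<Rightarrow> judgement \<Rightarrow> judgement list \<Rightarrow> bool" where
  "forall_removal \<psi> J Js \<longleftrightarrow>
     (\<exists>i j y \<alpha> \<phi>. J = (i, \<alpha> - {Pos y, Neg y}) \<and> Js = [(j, \<alpha>)] \<and> is_parent \<psi> i j
        \<and> sub_at \<psi> i = Some (All y \<phi>))"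

definition downward_flow :: "qcbf \<Rightarrow> judgement \<Rightarrow> judgement list \<Rightarrow> bool" where
  "downward_flow \<psi> J Js \<longleftrightarrow> (\<exists>i j \<alpha>. J = (j, \<alpha>) \<and> Js = [(i, \<alpha>)] \<and> is_parent \<psi> i j)"

definition derived :: "qcbf \<Rightarrow> judgement \<Rightarrow> judgement list \<Rightarrow> bool" where
  "derived \<psi> J Js \<longleftrightarrow>
     clause_rule \<psi> J Js \<or> resolve_rule \<psi> J Js \<or> upward_flow \<psi> J Js
     \<or> forall_removal \<psi> J Js \<or> downward_flow \<psi> J Js"

text \<open>A proof is a sequence of judgements, each with the list of positions of the
  predecessors it is derived from.\<close>

type_synonym judgement_seq = "(judgement \<times> nat list) list"

definition is_proof :: "qcbf \<Rightarrow> judgement_seq \<Rightarrow> bool" where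
  "is_proof \<psi> \<pi> \<longleftrightarrow> (\<forall>k<length \<pi>. case \<pi> ! k of (J, ps) \<Rightarrow>
     is_judgement \<psi> J \<and> (\<forall>p\<in>set ps. p < k) \<and> derived \<psi> J (map (\<lambda>p. fst (\<pi> ! p)) ps))"

definition tree_like :: "judgement_seq \<Rightarrow> bool" where
  "tree_like \<pi> \<longleftrightarrow>
     (\<forall>p<length \<pi>. card {k. k < length \<pi> \<and> p \<in> set (snd (\<pi> ! k))} \<le> 1)"

inductive induced_tree :: "judgement_seq \<Rightarrow> nat \<Rightarrow> judgement tree \<Rightarrow> bool" for \<pi> where
  "\<lbrakk> k < length \<pi>; \<pi> ! k = (J, ps); list_all2 (induced_tree \<pi>) ps ts \<rbrakk>
     \<Longrightarrow> induced_tree \<pi> k (Node J ts)"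

definition tree_like_empty_clause_proof :: "qcbf \<Rightarrow> judgement tree \<Rightarrow> bool" where
  "tree_like_empty_clause_proof \<psi> P \<longleftrightarrow>
     (\<exists>\<pi> k i ps. is_proof \<psi> \<pi> \<and> tree_like \<pi> \<and> k < length \<pi> \<and> \<pi> ! k = ((i, {}), ps)
        \<and> induced_tree \<pi> k P)"

text \<open>Being derived by a flow rule depends only on the judgement and its predecessors. In
  particular, a judgement \<open>(i, \<alpha>)\<close> obtained from \<open>(j, \<alpha>)\<close> by removing a universal variable
  that does not occur in \<open>\<alpha>\<close> is an instance of upward flow, and does not count as non-flow.
  (If it did, \<open>\<forall>y \<bottom>\<close> would have a proof with two non-flow judgements, but no trace
  with two nodes.)\<close>

fun num_nonflow :: "qcbf \<Rightarrow> judgement tree \<Rightarrow> nat" where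
  "num_nonflow \<psi> (Node J ts) =
     (if upward_flow \<psi> J (map root ts) \<or> downward_flow \<psi> J (map root ts) then 0 else 1)
     + sum_list (map (num_nonflow \<psi>) ts)"

section \<open>Traces\<close>

type_synonym located = "index \<times> nat"

definition forall_located :: "qcbf \<Rightarrow> located \<Rightarrow> bool" where
  "forall_located \<psi> l \<longleftrightarrow> (\<exists>\<phi>. sub_at \<psi> (fst l) = Some (All (snd l) \<phi>))"

definition located_var :: "qcbf \<Rightarrow> located \<Rightarrow> bool" where
  "located_var \<psi> l \<longleftrightarrow>
     forall_located \<psi> l \<or> (\<exists>\<phi>. sub_at \<psi> (fst l) = Some (Exi (snd l) \<phi>))"

definition follows :: "qcbf \<Rightarrow> index \<Rightarrow> located \<Rightarrow> bool" where
  "follows \<psi> j l \<longleftrightarrow> (case l of (i, u) \<Rightarrow>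
     j \<in> indices \<psi> \<and> strict_prefix i j
     \<and> (\<forall>k. strict_prefix i k \<and> prefix k j \<longrightarrow> u \<in> free_at \<psi> k))"

definition follows_set :: "qcbf \<Rightarrow> index \<Rightarrow> located set \<Rightarrow> bool" where
  "follows_set \<psi> j S \<longleftrightarrow> j \<in> indices \<psi> \<and> (\<forall>l\<in>S. follows \<psi> j l)"

definition coherent :: "qcbf \<Rightarrow> located set \<Rightarrow> bool" where
  "coherent \<psi> S \<longleftrightarrow>
     (\<forall>l\<in>S. \<forall>m\<in>S. l \<noteq> m \<longrightarrow> follows \<psi> (fst l) m \<or> follows \<psi> (fst m) l)"

definition lvars :: "located set \<Rightarrow> nat set" where
  "lvars S = snd ` S"

type_synonym label = "located set \<times> assignment"

definition trace_label :: "qcbf \<Rightarrow> label \<Rightarrow> bool" where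
  "trace_label \<psi> L \<longleftrightarrow> (case L of (S, a) \<Rightarrow>
     (\<forall>l\<in>S. located_var \<psi> l) \<and> coherent \<psi> S \<and> dom a = lvars S)"

definition binary_node :: "qcbf \<Rightarrow> label \<Rightarrow> label \<Rightarrow> label \<Rightarrow> bool" where
  "binary_node \<psi> L L0 L1 \<longleftrightarrow> (case L of (S, a) \<Rightarrow>
     \<exists>i u S0 S1. located_var \<psi> (i, u) \<and> (i, u) \<notin> S \<and> coherent \<psi> (S \<union> {(i, u)})
       \<and> S0 \<subseteq> S \<and> S1 \<subseteq> S \<and> S0 \<union> S1 = S
       \<and> L0 = (S0 \<union> {(i, u)}, (a |` lvars S0)(u \<mapsto> False))
       \<and> L1 = (S1 \<union> {(i, u)}, (a |` lvars S1)(u \<mapsto> True)))"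

definition unary_node :: "qcbf \<Rightarrow> label \<Rightarrow> label \<Rightarrow> bool" where
  "unary_node \<psi> L L' \<longleftrightarrow> (case L of (S, a) \<Rightarrow>
     \<exists>i y b. forall_located \<psi> (i, y) \<and> follows_set \<psi> i S
       \<and> L' = (S \<union> {(i, y)}, a(y \<mapsto> b)))"

definition leaf_node :: "qcbf \<Rightarrow> label \<Rightarrow> bool" where
  "leaf_node \<psi> L \<longleftrightarrow> (case L of (S, a) \<Rightarrow>
     \<exists>i \<alpha>. follows_set \<psi> i S \<and> sub_at \<psi> i = Some (Clause \<alpha>) \<and> falsified \<alpha> a
       \<and> cvars \<alpha> = lvars S)"

fun trace_node :: "qcbf \<Rightarrow> label \<Rightarrow> label list \<Rightarrow> bool" where
  "trace_node \<psi> L [] \<longleftrightarrow> leaf_node \<psi> L"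
| "trace_node \<psi> L [L'] \<longleftrightarrow> unary_node \<psi> L L'"
| "trace_node \<psi> L [L0, L1] \<longleftrightarrow> binary_node \<psi> L L0 L1"
| "trace_node \<psi> L _ \<longleftrightarrow> False"

fun is_trace :: "qcbf \<Rightarrow> label tree \<Rightarrow> bool" where
  "is_trace \<psi> (Node L ts) \<longleftrightarrow>
     trace_label \<psi> L \<and> trace_node \<psi> L (map root ts) \<and> (\<forall>t\<in>set ts. is_trace \<psi> t)"

fun num_nodes :: "'a tree \<Rightarrow> nat" where
  "num_nodes (Node L ts) = 1 + sum_list (map num_nodes ts)"

section \<open>Polynomial-time computability\<close>

text \<open>The machine model is a first-order functional language over binary trees (pure Lisp):
  a program is a list of function bodies that may call each other recursively. Every
  evaluation step is charged one unit plus the size of the value it yields. Hence within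
  cost \<open>t\<close> there are at most \<open>t\<close> steps, and only values of size at most \<open>t\<close> occur, even when
  written out without sharing; so a Turing machine simulates such a run in time polynomial in
  \<open>t\<close> and the size of the input. Conversely, a Turing machine configuration is a pair of lists
  and a state, and one machine step has cost linear in its size. So polynomial time in this
  model coincides with polynomial time on Turing machines.\<close>

datatype val = Atom | Cell val val

fun vsize :: "val \<Rightarrow> nat" where
  "vsize Atom = 1"
| "vsize (Cell v w) = 1 + vsize v + vsize w"

fun vfst :: "val \<Rightarrow> val" where
  "vfst Atom = Atom"
| "vfst (Cell v w) = v"

fun vsnd :: "val \<Rightarrow> val" where
  "vsnd Atom = Atom"
| "vsnd (Cell v w) = w"

definition vbool :: "bool \<Rightarrow> val" where
  "vbool b = (if b then Cell Atom Atom else Atom)"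

datatype expr =
    Arg nat
  | EAtom
  | ECell expr expr
  | EFst expr
  | ESnd expr
  | EEq expr expr
  | EIf expr expr expr
  | Call nat "expr list"

type_synonym prog = "expr list"

text \<open>\<open>run \<Pi> \<rho> e v t\<close>: under the argument list \<open>\<rho>\<close>, expression \<open>e\<close> evaluates to \<open>v\<close> at cost \<open>t\<close>.\<close>

inductive run :: "prog \<Rightarrow> val list \<Rightarrow> expr \<Rightarrow> val \<Rightarrow> nat \<Rightarrow> bool"
  and runs :: "prog \<Rightarrow> val list \<Rightarrow> expr list \<Rightarrow> val list \<Rightarrow> nat \<Rightarrow> bool"
  for \<Pi> where
  run_Arg: "n < length \<rho> \<Longrightarrow> run \<Pi> \<rho> (Arg n) (\<rho> ! n) (1 + vsize (\<rho> ! n))"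
| run_Atom: "run \<Pi> \<rho> EAtom Atom (1 + vsize Atom)"
| run_Cell: "\<lbrakk> run \<Pi> \<rho> e1 v1 t1; run \<Pi> \<rho> e2 v2 t2 \<rbrakk>
    \<Longrightarrow> run \<Pi> \<rho> (ECell e1 e2) (Cell v1 v2) (t1 + t2 + 1 + vsize (Cell v1 v2))"
| run_Fst: "run \<Pi> \<rho> e v t \<Longrightarrow> run \<Pi> \<rho> (EFst e) (vfst v) (t + 1 + vsize (vfst v))"
| run_Snd: "run \<Pi> \<rho> e v t \<Longrightarrow> run \<Pi> \<rho> (ESnd e) (vsnd v) (t + 1 + vsize (vsnd v))"
| run_Eq: "\<lbrakk> run \<Pi> \<rho> e1 v1 t1; run \<Pi> \<rho> e2 v2 t2 \<rbrakk>
    \<Longrightarrow> run \<Pi> \<rho> (EEq e1 e2) (vbool (v1 = v2)) (t1 + t2 + 1 + vsize (vbool (v1 = v2)))"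
| run_If_true: "\<lbrakk> run \<Pi> \<rho> e0 v0 t0; v0 \<noteq> Atom; run \<Pi> \<rho> e1 v t \<rbrakk>
    \<Longrightarrow> run \<Pi> \<rho> (EIf e0 e1 e2) v (t0 + t + 1 + vsize v)"
| run_If_false: "\<lbrakk> run \<Pi> \<rho> e0 Atom t0; run \<Pi> \<rho> e2 v t \<rbrakk>
    \<Longrightarrow> run \<Pi> \<rho> (EIf e0 e1 e2) v (t0 + t + 1 + vsize v)"
| run_Call: "\<lbrakk> f < length \<Pi>; runs \<Pi> \<rho> es vs t0; run \<Pi> vs (\<Pi> ! f) v t \<rbrakk>
    \<Longrightarrow> run \<Pi> \<rho> (Call f es) v (t0 + t + 1 + vsize v)"
| runs_Nil: "runs \<Pi> \<rho> [] [] 0"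
| runs_Cons: "\<lbrakk> run \<Pi> \<rho> e v t0; runs \<Pi> \<rho> es vs t \<rbrakk>
    \<Longrightarrow> runs \<Pi> \<rho> (e # es) (v # vs) (t0 + t)"

inductive_cases run_ArgE: "run \<Pi> \<rho> (Arg n) v t"
inductive_cases run_AtomE: "run \<Pi> \<rho> EAtom v t"
inductive_cases run_CellE: "run \<Pi> \<rho> (ECell e1 e2) v t"
inductive_cases run_FstE: "run \<Pi> \<rho> (EFst e) v t"
inductive_cases run_SndE: "run \<Pi> \<rho> (ESnd e) v t"
inductive_cases run_EqE: "run \<Pi> \<rho> (EEq e1 e2) v t"
inductive_cases run_IfE: "run \<Pi> \<rho> (EIf e0 e1 e2) v t"
inductive_cases run_CallE: "run \<Pi> \<rho> (Call f es) v t"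
inductive_cases runs_NilE: "runs \<Pi> \<rho> [] vs t"
inductive_cases runs_ConsE: "runs \<Pi> \<rho> (e # es) vs t"

lemma run_deterministic:
  "run \<Pi> \<rho> e v t \<Longrightarrow> run \<Pi> \<rho> e v' t' \<Longrightarrow> v' = v \<and> t' = t"
  "runs \<Pi> \<rho> es vs t \<Longrightarrow> runs \<Pi> \<rho> es vs' t' \<Longrightarrow> vs' = vs \<and> t' = t"
proof (induction arbitrary: v' t' and vs' t' rule: run_runs.inducts)
  case run_Arg then show ?case by (auto elim: run_ArgE)
next
  case run_Atom then show ?case by (auto elim: run_AtomE)
next
  case run_Cell show ?case
    by (rule run_CellE[OF run_Cell.prems]) (auto dest!: run_Cell.IH(2) run_Cell.IH(4))
next
  case run_Fst show ?case by (rule run_FstE[OF run_Fst.prems]) (auto dest!: run_Fst.IH(2))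
next
  case run_Snd show ?case by (rule run_SndE[OF run_Snd.prems]) (auto dest!: run_Snd.IH(2))
next
  case run_Eq show ?case
    by (rule run_EqE[OF run_Eq.prems]) (auto dest!: run_Eq.IH(2) run_Eq.IH(4))
next
  case run_If_true show ?case
    by (rule run_IfE[OF run_If_true.prems])
      (use run_If_true.hyps in \<open>auto dest!: run_If_true.IH(2) run_If_true.IH(4)\<close>)
next
  case run_If_false show ?case
    by (rule run_IfE[OF run_If_false.prems]) (auto dest!: run_If_false.IH(2) run_If_false.IH(4))
next
  case run_Call show ?case
    by (rule run_CallE[OF run_Call.prems]) (auto dest!: run_Call.IH(3) run_Call.IH(5))
next
  case runs_Nil then show ?case by (auto elim: runs_NilE)
next
  case runs_Cons show ?case
    by (rule runs_ConsE[OF runs_Cons.prems]) (auto dest!: runs_Cons.IH(2) runs_Cons.IH(4))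
qed

definition poly_time_on :: "val set \<Rightarrow> (val \<Rightarrow> val) \<Rightarrow> bool" where
  "poly_time_on D f \<longleftrightarrow> (\<exists>\<Pi> f0 c d. \<forall>x\<in>D. \<exists>t. run \<Pi> [x] (Call f0 [Arg 0]) (f x) t
     \<and> t \<le> c * vsize x ^ d)"

section \<open>Encodings as binary trees\<close>

text \<open>Numbers are in binary, least significant digit first. A finite set is encoded by any
  repetition-free list of its elements, so encodings are relations.\<close>

fun enc_nat :: "nat \<Rightarrow> val" where
  "enc_nat n = (if n = 0 then Atom else Cell (vbool (odd n)) (enc_nat (n div 2)))"

declare enc_nat.simps [simp del]

definition enc_list :: "val list \<Rightarrow> val" where
  "enc_list vs = foldr Cell vs Atom"

type_synonym 'a enc = "'a \<Rightarrow> val \<Rightarrow> bool"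

definition encodes_nat :: "nat enc" where
  "encodes_nat n v \<longleftrightarrow> v = enc_nat n"

definition encodes_bool :: "bool enc" where
  "encodes_bool b v \<longleftrightarrow> v = vbool b"

definition encodes_prod :: "'a enc \<Rightarrow> 'b enc \<Rightarrow> ('a \<times> 'b) enc" where
  "encodes_prod E F p v \<longleftrightarrow> (\<exists>v1 v2. v = Cell v1 v2 \<and> E (fst p) v1 \<and> F (snd p) v2)"

definition encodes_list :: "'a enc \<Rightarrow> 'a list enc" where
  "encodes_list E xs v \<longleftrightarrow> (\<exists>vs. list_all2 E xs vs \<and> v = enc_list vs)"

definition encodes_set :: "'a enc \<Rightarrow> 'a set enc" where
  "encodes_set E A v \<longleftrightarrow> (\<exists>xs. distinct xs \<and> set xs = A \<and> encodes_list E xs v)"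

inductive encodes_tree :: "'a enc \<Rightarrow> 'a tree enc" for E where
  "\<lbrakk> E x v; list_all2 (encodes_tree E) ts vs \<rbrakk>
     \<Longrightarrow> encodes_tree E (Node x ts) (Cell v (enc_list vs))"

fun encodes_lit :: "lit enc" where
  "encodes_lit (Pos u) v \<longleftrightarrow> v = Cell (vbool True) (enc_nat u)"
| "encodes_lit (Neg u) v \<longleftrightarrow> v = Cell (vbool False) (enc_nat u)"

definition encodes_clause :: "lit set enc" where
  "encodes_clause = encodes_set encodes_lit"

fun encodes_qcbf :: "qcbf enc" where
  "encodes_qcbf (Clause \<alpha>) v \<longleftrightarrow> (\<exists>w. v = Cell (enc_nat 0) w \<and> encodes_clause \<alpha> w)"
| "encodes_qcbf (Conj \<phi> \<chi>) v \<longleftrightarrow>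
     (\<exists>w1 w2. v = Cell (enc_nat 1) (Cell w1 w2) \<and> encodes_qcbf \<phi> w1 \<and> encodes_qcbf \<chi> w2)"
| "encodes_qcbf (All u \<phi>) v \<longleftrightarrow>
     (\<exists>w. v = Cell (enc_nat 2) (Cell (enc_nat u) w) \<and> encodes_qcbf \<phi> w)"
| "encodes_qcbf (Exi u \<phi>) v \<longleftrightarrow>
     (\<exists>w. v = Cell (enc_nat 3) (Cell (enc_nat u) w) \<and> encodes_qcbf \<phi> w)"

definition encodes_index :: "index enc" where
  "encodes_index = encodes_list encodes_nat"

definition encodes_proof_tree :: "judgement tree enc" where
  "encodes_proof_tree = encodes_tree (encodes_prod encodes_index encodes_clause)"

definition encodes_assignment :: "assignment enc" where
  "encodes_assignment a = encodes_set (encodes_prod encodes_nat encodes_bool) (Map.graph a)"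

definition encodes_label :: "label enc" where
  "encodes_label =
     encodes_prod (encodes_set (encodes_prod encodes_index encodes_nat)) encodes_assignment"

definition encodes_trace :: "label tree enc" where
  "encodes_trace = encodes_tree encodes_label"

text \<open>A polynomial-time translation sends every encoding of an instance \<open>\<psi>\<close> together with an
  object \<open>x\<close> such that \<open>A \<psi> x\<close> to an encoding of an object \<open>y\<close> such that \<open>B \<psi> x y\<close>; the same
  program works for all \<open>\<psi>\<close>.\<close>

definition poly_time_translation ::
    "'a enc \<Rightarrow> 'b enc \<Rightarrow> (qcbf \<Rightarrow> 'a \<Rightarrow> bool) \<Rightarrow> (qcbf \<Rightarrow> 'a \<Rightarrow> 'b \<Rightarrow> bool) \<Rightarrow> bool" where
  "poly_time_translation E F A B \<longleftrightarrow>
     (\<exists>f. poly_time_on {v. \<exists>\<psi> x. qcbf_instance \<psi> \<and> A \<psi> x \<and> encodes_prod encodes_qcbf E (\<psi>, x) v} f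
        \<and> (\<forall>\<psi> x v. qcbf_instance \<psi> \<and> A \<psi> x \<and> encodes_prod encodes_qcbf E (\<psi>, x) v
             \<longrightarrow> (\<exists>y. B \<psi> x y \<and> F y (f v))))"

end

theory Submission
  imports Defs
begin

text \<open>A judgement \<open>(i, \<alpha>)\<close> corresponds to the label consisting of the binders, as seen from \<open>i\<close>,
  of the variables of \<open>\<alpha>\<close>, and of the assignment falsifying \<open>\<alpha>\<close>. Flow steps do not change this
  label, and the clause, resolve and \<open>\<forall>\<close>-removal steps become the leaves, binary nodes and unary
  nodes of a trace. Conversely, a trace node labelled \<open>(S, a)\<close> becomes a proof of the clause
  falsified by \<open>a\<close>, located at the child of the innermost quantifier of \<open>S\<close>; the proofs of its
  children are carried there by flow steps along the branch of the syntax tree on which the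
  coherent set \<open>S\<close> lies.

  For the time bounds, functions on codes are built from operations under which polynomial time
  is closed. The only recursion needed is structural recursion on binary trees, which stays in
  polynomial time as long as its values have polynomial size.\<close>

section \<open>Polynomial bounds\<close>

text \<open>A trace does not say where a proof takes place, and this shapes the second half: a
  coherent \<open>S\<close> puts its quantifiers on one branch, but does not guarantee that the
  innermost variable is free just below its quantifier. That fact is read off from the root
  judgement of the proof already built for a child; only then is the index chosen for a resolution
  step known to follow \<open>S\<close>. The exact count hinges on steps that change nothing: a
  \<forall>-removal of an absent variable has the shape of a flow step and must yield no node,
  whereas every unary node must really remove a literal. Both constructions are determined by
  judgements or labels alone, never by the name of a rule or a stored witness, so that programs can
  repeat them on codes. Since sets may be coded in any order, a program keeps the arrangement it is
  given instead of sorting. Its output stays small because each tree node adds to the results of its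
  children an amount that is polynomial in the input and independent of these results.\<close>

inductive polyfun :: "(nat \<Rightarrow> nat) \<Rightarrow> bool" where
  polyfun_const: "polyfun (\<lambda>n. c)"
| polyfun_id: "polyfun (\<lambda>n. n)"
| polyfun_add: "\<lbrakk> polyfun p; polyfun q \<rbrakk> \<Longrightarrow> polyfun (\<lambda>n. p n + q n)"
| polyfun_mult: "\<lbrakk> polyfun p; polyfun q \<rbrakk> \<Longrightarrow> polyfun (\<lambda>n. p n * q n)"

lemma polyfun_mono: "polyfun p \<Longrightarrow> m \<le> n \<Longrightarrow> p m \<le> p n"
  by (induction rule: polyfun.induct) (auto intro: add_mono mult_mono)

lemma polyfun_comp: "polyfun p \<Longrightarrow> polyfun q \<Longrightarrow> polyfun (\<lambda>n. p (q n))"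
  by (induction rule: polyfun.induct) (auto intro: polyfun.intros)

text \<open>The cost bound demanded by \<open>poly_time_on\<close> is a single monomial. Every value
  has size at least 1, and from 1 on both exponents may be raised to their sum, so that the
  coefficients of two bounds can be added.\<close>

lemma polyfun_monomial_bound: "polyfun p \<Longrightarrow> \<exists>c d. \<forall>n\<ge>1. p n \<le> c * n ^ d"
proof (induction rule: polyfun.induct)
  case (polyfun_const c)
  show ?case by (rule exI[of _ c], rule exI[of _ 0]) simp
next
  case polyfun_id
  show ?case by (rule exI[of _ 1], rule exI[of _ 1]) simp
next
  case (polyfun_add p q)
  then obtain c d c' d' where *: "\<forall>n\<ge>1. p n \<le> c * n ^ d" "\<forall>n\<ge>1. q n \<le> c' * n ^ d'" by blast
  show ?case
  proof (rule exI[of _ "c + c'"], rule exI[of _ "d + d'"], intro allI impI)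
    fix n :: nat assume n: "1 \<le> n"
    have "n ^ d \<le> n ^ (d + d')" "n ^ d' \<le> n ^ (d + d')" using n by (auto intro: power_increasing)
    then have "c * n ^ d \<le> c * n ^ (d + d')" "c' * n ^ d' \<le> c' * n ^ (d + d')" by simp_all
    with * n show "p n + q n \<le> (c + c') * n ^ (d + d')"
      unfolding add_mult_distrib by (meson add_mono le_trans)
  qed
next
  case (polyfun_mult p q)
  then obtain c d c' d' where *: "\<forall>n\<ge>1. p n \<le> c * n ^ d" "\<forall>n\<ge>1. q n \<le> c' * n ^ d'" by blast
  show ?case
  proof (rule exI[of _ "c * c'"], rule exI[of _ "d + d'"], intro allI impI)
    fix n :: nat assume n: "1 \<le> n"
    have "p n * q n \<le> (c * n ^ d) * (c' * n ^ d')" using * n by (intro mult_mono) auto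
    then show "p n * q n \<le> c * c' * n ^ (d + d')" by (simp add: power_add mult_ac)
  qed
qed

lemma vsize_pos: "1 \<le> vsize v"
  by (cases v) auto

lemma vsize_vfst_le: "vsize (vfst v) \<le> vsize v"
  by (cases v) auto

lemma vsize_vsnd_le: "vsize (vsnd v) \<le> vsize v"
  by (cases v) auto

lemma vsize_vbool: "vsize (vbool b) \<le> 3"
  by (auto simp: vbool_def)

section \<open>Polynomial-time functions\<close>

primrec shift :: "nat \<Rightarrow> expr \<Rightarrow> expr" where
  "shift m (Arg n) = Arg n"
| "shift m EAtom = EAtom"
| "shift m (ECell e1 e2) = ECell (shift m e1) (shift m e2)"
| "shift m (EFst e) = EFst (shift m e)"
| "shift m (ESnd e) = ESnd (shift m e)"
| "shift m (EEq e1 e2) = EEq (shift m e1) (shift m e2)"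
| "shift m (EIf e0 e1 e2) = EIf (shift m e0) (shift m e1) (shift m e2)"
| "shift m (Call f es) = Call (m + f) (map (shift m) es)"

lemma run_append:
  "run \<Pi> \<rho> e v t \<Longrightarrow> run (\<Pi> @ \<Pi>') \<rho> e v t"
  "runs \<Pi> \<rho> es vs t \<Longrightarrow> runs (\<Pi> @ \<Pi>') \<rho> es vs t"
proof (induction rule: run_runs.inducts)
  case (run_Call f \<rho> es vs t0 v t)
  then show ?case
    by (intro run_runs.run_Call) (simp_all add: nth_append)
qed (blast intro: run_runs.intros)+

text \<open>Call targets are the only absolute references in a program, so shifting them by the
  length of a preceding program changes neither values nor costs.\<close>

lemma run_shift:
  "run \<Pi> \<rho> e v t \<Longrightarrow> run (\<Pi>' @ map (shift (length \<Pi>')) \<Pi>) \<rho> (shift (length \<Pi>') e) v t"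
  "runs \<Pi> \<rho> es vs t \<Longrightarrow>
     runs (\<Pi>' @ map (shift (length \<Pi>')) \<Pi>) \<rho> (map (shift (length \<Pi>')) es) vs t"
proof (induction rule: run_runs.inducts)
  case (run_Call f \<rho> es vs t0 v t)
  then show ?case
    unfolding shift.simps by (intro run_runs.run_Call) (simp_all add: nth_append)
qed (simp_all only: shift.simps list.map, (blast intro: run_runs.intros)+)

text \<open>Each evaluation step is charged the size of the value it yields. A cost bound is thereby
  also a size bound, which is what makes composition work.\<close>

lemma vsize_le_cost: "run \<Pi> \<rho> e v t \<Longrightarrow> vsize v \<le> t"
  by (cases rule: run.cases) auto

text \<open>All values are allowed as input, also those that encode nothing: closure properties then
  carry no side conditions, at the price of having to bound every program on malformed codes as
  well.\<close>

definition computes :: "prog \<Rightarrow> expr \<Rightarrow> (nat \<Rightarrow> nat) \<Rightarrow> (val \<Rightarrow> val) \<Rightarrow> bool" where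
  "computes \<Pi> e p f \<longleftrightarrow> (\<forall>x. \<exists>t \<le> p (vsize x). run \<Pi> [x] e (f x) t)"

definition ptime :: "(val \<Rightarrow> val) \<Rightarrow> bool" where
  "ptime f \<longleftrightarrow> (\<exists>\<Pi> e p. polyfun p \<and> computes \<Pi> e p f)"

lemma ptimeE:
  assumes "ptime f"
  obtains \<Pi> e p where "polyfun p" "computes \<Pi> e p f"
  using assms unfolding ptime_def by blast

text \<open>The second program is relocated behind the first, and the sum of the two bounds serves
  for both functions.\<close>

lemma ptime2E:
  assumes "ptime f" "ptime g"
  obtains \<Pi> ef eg p where "polyfun p" "computes \<Pi> ef p f" "computes \<Pi> eg p g"
proof -
  obtain \<Pi>f ef pf where f: "polyfun pf" "computes \<Pi>f ef pf f" using assms(1) by (rule ptimeE)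
  obtain \<Pi>g eg pg where g: "polyfun pg" "computes \<Pi>g eg pg g" using assms(2) by (rule ptimeE)
  let ?m = "length \<Pi>f"
  let ?\<Pi> = "\<Pi>f @ map (shift ?m) \<Pi>g"
  let ?p = "\<lambda>n. pf n + pg n"
  show thesis
  proof
    show "polyfun ?p" using f g by (intro polyfun_add)
    show "computes ?\<Pi> ef ?p f" unfolding computes_def
    proof
      fix x
      obtain t where "t \<le> pf (vsize x)" "run \<Pi>f [x] ef (f x) t"
        using f(2) unfolding computes_def by blast
      then show "\<exists>t\<le>?p (vsize x). run ?\<Pi> [x] ef (f x) t"
        by (intro exI[of _ t]) (auto intro: run_append)
    qed
    show "computes ?\<Pi> (shift ?m eg) ?p g" unfolding computes_def
    proof
      fix x
      obtain t where "t \<le> pg (vsize x)" "run \<Pi>g [x] eg (g x) t"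
        using g(2) unfolding computes_def by blast
      then show "\<exists>t\<le>?p (vsize x). run ?\<Pi> [x] (shift ?m eg) (g x) t"
        by (intro exI[of _ t]) (auto intro: run_shift)
    qed
  qed
qed

lemma computes_append: "computes \<Pi> e p f \<Longrightarrow> computes (\<Pi> @ \<Pi>') e p f"
  unfolding computes_def by (meson run_append(1))

lemma ptime_size:
  assumes "ptime f"
  obtains p where "polyfun p" "\<And>x. vsize (f x) \<le> p (vsize x)"
proof -
  obtain \<Pi> e p where f: "polyfun p" "computes \<Pi> e p f" using assms by (rule ptimeE)
  have "vsize (f x) \<le> p (vsize x)" for x
  proof -
    obtain t where "t \<le> p (vsize x)" "run \<Pi> [x] e (f x) t" using f(2) unfolding computes_def by blast
    then show ?thesis using vsize_le_cost le_trans by blast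
  qed
  with f(1) show thesis by (rule that)
qed

lemma ptimeI:
  assumes "polyfun p" "\<And>x. \<exists>t \<le> p (vsize x). run \<Pi> [x] e (f x) t"
  shows "ptime f"
  using assms unfolding ptime_def computes_def by blast

section \<open>Closure properties of polynomial time\<close>

lemma ptime_id: "ptime (\<lambda>x. x)"
proof (rule ptimeI)
  show "polyfun (\<lambda>n. 1 + n)" by (intro polyfun.intros)
  show "\<exists>t\<le>1 + vsize x. run [] [x] (Arg 0) x t" for x
    using run_Arg[of 0 "[x]" "[]"] by auto
qed

lemma ptime_Cell:
  assumes "ptime f" "ptime g"
  shows "ptime (\<lambda>x. Cell (f x) (g x))"
proof -
  obtain \<Pi> ef eg p where p: "polyfun p" and c: "computes \<Pi> ef p f" "computes \<Pi> eg p g"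
    using assms by (rule ptime2E)
  show ?thesis
  proof (rule ptimeI)
    show "polyfun (\<lambda>n. p n + p n + 1 + (1 + p n + p n))" using p by (intro polyfun.intros)
    fix x
    obtain t1 t2 where t: "t1 \<le> p (vsize x)" "run \<Pi> [x] ef (f x) t1"
      "t2 \<le> p (vsize x)" "run \<Pi> [x] eg (g x) t2"
      using c unfolding computes_def by metis
    show "\<exists>t\<le>p (vsize x) + p (vsize x) + 1 + (1 + p (vsize x) + p (vsize x)).
        run \<Pi> [x] (ECell ef eg) (Cell (f x) (g x)) t"
      using run_Cell[OF t(2,4)] t vsize_le_cost[OF t(2)] vsize_le_cost[OF t(4)]
      by (intro exI[of _ "t1 + t2 + 1 + vsize (Cell (f x) (g x))"]) auto
  qed
qed

lemma ptime_vfst: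
  assumes "ptime f"
  shows "ptime (\<lambda>x. vfst (f x))"
proof -
  obtain \<Pi> e p where p: "polyfun p" and c: "computes \<Pi> e p f" using assms by (rule ptimeE)
  show ?thesis
  proof (rule ptimeI)
    show "polyfun (\<lambda>n. p n + 1 + p n)" using p by (intro polyfun.intros)
    fix x
    obtain t where t: "t \<le> p (vsize x)" "run \<Pi> [x] e (f x) t"
      using c unfolding computes_def by metis
    show "\<exists>t\<le>p (vsize x) + 1 + p (vsize x). run \<Pi> [x] (EFst e) (vfst (f x)) t"
      using run_Fst[OF t(2)] t vsize_le_cost[OF t(2)] vsize_vfst_le[of "f x"]
      by (intro exI[of _ "t + 1 + vsize (vfst (f x))"]) auto
  qed
qed

lemma ptime_vsnd:
  assumes "ptime f"
  shows "ptime (\<lambda>x. vsnd (f x))"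
proof -
  obtain \<Pi> e p where p: "polyfun p" and c: "computes \<Pi> e p f" using assms by (rule ptimeE)
  show ?thesis
  proof (rule ptimeI)
    show "polyfun (\<lambda>n. p n + 1 + p n)" using p by (intro polyfun.intros)
    fix x
    obtain t where t: "t \<le> p (vsize x)" "run \<Pi> [x] e (f x) t"
      using c unfolding computes_def by metis
    show "\<exists>t\<le>p (vsize x) + 1 + p (vsize x). run \<Pi> [x] (ESnd e) (vsnd (f x)) t"
      using run_Snd[OF t(2)] t vsize_le_cost[OF t(2)] vsize_vsnd_le[of "f x"]
      by (intro exI[of _ "t + 1 + vsize (vsnd (f x))"]) auto
  qed
qed

lemma ptime_Atom: "ptime (\<lambda>x. Atom)"
proof (rule ptimeI)
  show "polyfun (\<lambda>n. 2)" by (intro polyfun.intros)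
  show "\<exists>t\<le>2. run [] [x] EAtom Atom t" for x
    using run_Atom[of "[]" "[x]"] by (intro exI[of _ 2]) (auto simp: numeral_2_eq_2)
qed

lemma ptime_const: "ptime (\<lambda>x. c)"
  by (induction c) (auto intro: ptime_Atom ptime_Cell)

definition ptest :: "(val \<Rightarrow> bool) \<Rightarrow> bool" where
  "ptest P \<longleftrightarrow> ptime (\<lambda>x. vbool (P x))"

lemma ptest_eq:
  assumes "ptime f" "ptime g"
  shows "ptest (\<lambda>x. f x = g x)"
proof -
  obtain \<Pi> ef eg p where p: "polyfun p" and c: "computes \<Pi> ef p f" "computes \<Pi> eg p g"
    using assms by (rule ptime2E)
  show ?thesis unfolding ptest_def
  proof (rule ptimeI)
    show "polyfun (\<lambda>n. p n + p n + 4)" using p by (intro polyfun.intros)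
    fix x
    obtain t1 t2 where t: "t1 \<le> p (vsize x)" "run \<Pi> [x] ef (f x) t1"
      "t2 \<le> p (vsize x)" "run \<Pi> [x] eg (g x) t2"
      using c unfolding computes_def by metis
    show "\<exists>t\<le>p (vsize x) + p (vsize x) + 4.
        run \<Pi> [x] (EEq ef eg) (vbool (f x = g x)) t"
      using run_Eq[OF t(2,4)] t vsize_vbool[of "f x = g x"]
      by (intro exI[of _ "t1 + t2 + 1 + vsize (vbool (f x = g x))"]) auto
  qed
qed

lemma run_Call1:
  "\<lbrakk> f < length \<Pi>; run \<Pi> \<rho> e v t0; run \<Pi> [v] (\<Pi> ! f) w t \<rbrakk>
    \<Longrightarrow> run \<Pi> \<rho> (Call f [e]) w (t0 + t + 1 + vsize w)"
  using run_Call[of f \<Pi> \<rho> "[e]" "[v]" "t0 + 0"] runs_Cons[OF _ runs_Nil] by auto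

text \<open>An expression can bind an intermediate value only through a call. The code of
  \<open>f\<close> therefore becomes a new function body, called on the value of \<open>g\<close>;
  since that value is no larger than its cost, the nested bound \<open>p (p n)\<close>
  suffices.\<close>

lemma ptime_comp:
  assumes "ptime f" "ptime g"
  shows "ptime (\<lambda>x. f (g x))"
proof -
  obtain \<Pi> ef eg p where p: "polyfun p" and c: "computes \<Pi> ef p f" "computes \<Pi> eg p g"
    using assms by (rule ptime2E)
  let ?\<Pi> = "\<Pi> @ [ef]"
  let ?q = "\<lambda>n. p n + p (p n) + 1 + p (p n)"
  show ?thesis
  proof (rule ptimeI)
    show "polyfun ?q" using p by (intro polyfun.intros polyfun_comp[of p p])
    fix x
    obtain t1 where t1: "t1 \<le> p (vsize x)" "run ?\<Pi> [x] eg (g x) t1"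
      using computes_append[OF c(2)] unfolding computes_def by metis
    obtain t2 where t2: "t2 \<le> p (vsize (g x))" "run ?\<Pi> [g x] ef (f (g x)) t2"
      using computes_append[OF c(1)] unfolding computes_def by metis
    have "vsize (g x) \<le> p (vsize x)" using t1 vsize_le_cost le_trans by blast
    then have t2': "t2 \<le> p (p (vsize x))" using t2(1) polyfun_mono[OF p] le_trans by blast
    have "run ?\<Pi> [x] (Call (length \<Pi>) [eg]) (f (g x)) (t1 + t2 + 1 + vsize (f (g x)))"
      using t1 t2 by (intro run_Call1) auto
    then show "\<exists>t\<le>?q (vsize x). run ?\<Pi> [x] (Call (length \<Pi>) [eg]) (f (g x)) t"
      using t1(1) t2' vsize_le_cost[OF t2(2)]
      by (intro exI[of _ "t1 + t2 + 1 + vsize (f (g x))"]) auto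
  qed
qed

text \<open>Programs take one argument, so a binary function is treated as a function on
  pairs.\<close>

lemma ptime_comp2:
  assumes "ptime (\<lambda>z. f (vfst z) (vsnd z))" "ptime g" "ptime h"
  shows "ptime (\<lambda>x. f (g x) (h x))"
  using ptime_comp[OF assms(1) ptime_Cell[OF assms(2,3)]] by simp

lemma ptime_if:
  assumes "ptest P" "ptime f" "ptime g"
  shows "ptime (\<lambda>x. if P x then f x else g x)"
proof -
  obtain \<Pi>1 ef1 eg1 p1 where p1: "polyfun p1" and c1: "computes \<Pi>1 ef1 p1 f" "computes \<Pi>1 eg1 p1 g"
    using assms(2,3) by (rule ptime2E)
  obtain \<Pi>2 eP p2 where p2: "polyfun p2" and c2: "computes \<Pi>2 eP p2 (\<lambda>x. vbool (P x))"
    using assms(1) unfolding ptest_def by (rule ptimeE)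
  let ?\<Pi> = "\<Pi>1 @ map (shift (length \<Pi>1)) \<Pi>2"
  let ?e = "EIf (shift (length \<Pi>1) eP) ef1 eg1"
  show ?thesis
  proof (rule ptimeI)
    show "polyfun (\<lambda>n. p2 n + p1 n + 1 + p1 n)" using p1 p2 by (intro polyfun.intros)
    fix x
    obtain t0 where t0: "t0 \<le> p2 (vsize x)" "run ?\<Pi> [x] (shift (length \<Pi>1) eP) (vbool (P x)) t0"
      using c2 run_shift(1) unfolding computes_def by metis
    show "\<exists>t\<le>p2 (vsize x) + p1 (vsize x) + 1 + p1 (vsize x).
        run ?\<Pi> [x] ?e (if P x then f x else g x) t"
    proof (cases "P x")
      case True
      obtain t where t: "t \<le> p1 (vsize x)" "run ?\<Pi> [x] ef1 (f x) t"
        using computes_append[OF c1(1)] unfolding computes_def by metis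
      have "run ?\<Pi> [x] ?e (f x) (t0 + t + 1 + vsize (f x))"
        using t0 t True by (intro run_If_true) (auto simp: vbool_def)
      then show ?thesis using True t0 t vsize_le_cost[OF t(2)]
        by (intro exI[of _ "t0 + t + 1 + vsize (f x)"]) auto
    next
      case False
      obtain t where t: "t \<le> p1 (vsize x)" "run ?\<Pi> [x] eg1 (g x) t"
        using computes_append[OF c1(2)] unfolding computes_def by metis
      have "run ?\<Pi> [x] ?e (g x) (t0 + t + 1 + vsize (g x))"
        using t0 t False by (intro run_If_false) (auto simp: vbool_def)
      then show ?thesis using False t0 t vsize_le_cost[OF t(2)]
        by (intro exI[of _ "t0 + t + 1 + vsize (g x)"]) auto
    qed
  qed
qed

lemma ptest_not:
  assumes "ptest P"
  shows "ptest (\<lambda>x. \<not> P x)"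
proof -
  have "(\<lambda>x. vbool (\<not> P x)) = (\<lambda>x. if P x then vbool False else vbool True)"
    by auto
  then show ?thesis
    using ptime_if[OF assms ptime_const[of "vbool False"] ptime_const[of "vbool True"]]
    unfolding ptest_def by simp
qed

lemma ptest_conj:
  assumes "ptest P" "ptest Q"
  shows "ptest (\<lambda>x. P x \<and> Q x)"
proof -
  have "(\<lambda>x. vbool (P x \<and> Q x)) = (\<lambda>x. if P x then vbool (Q x) else vbool False)"
    by auto
  then show ?thesis
    using ptime_if[OF assms(1) assms(2)[unfolded ptest_def] ptime_const[of "vbool False"]]
    unfolding ptest_def by simp
qed

lemma ptest_disj:
  assumes "ptest P" "ptest Q"
  shows "ptest (\<lambda>x. P x \<or> Q x)"
  using ptest_not[OF ptest_conj[OF ptest_not[OF assms(1)] ptest_not[OF assms(2)]]] by simp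


lemma ptime_poly_time_on:
  assumes "ptime f"
  shows "poly_time_on D f"
proof -
  obtain \<Pi> e p where p: "polyfun p" and c: "computes \<Pi> e p f" using assms by (rule ptimeE)
  \<comment> \<open>The run required by \<open>poly_time_on\<close> starts with a call: besides
    \<open>p n\<close> for \<open>e\<close>, the bound pays for reading the argument, one unit, and
    the size of the result.\<close>
  let ?q = "\<lambda>n. (1 + n) + p n + 1 + p n"
  let ?\<Pi> = "\<Pi> @ [e]"
  have "polyfun ?q" using p by (intro polyfun.intros)
  then obtain k d where kd: "\<And>n. n \<ge> 1 \<Longrightarrow> ?q n \<le> k * n ^ d" using polyfun_monomial_bound by blast
  have "\<exists>t. run ?\<Pi> [x] (Call (length \<Pi>) [Arg 0]) (f x) t \<and> t \<le> k * vsize x ^ d" for x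
  proof -
    obtain t where t: "t \<le> p (vsize x)" "run ?\<Pi> [x] e (f x) t"
      using computes_append[OF c] unfolding computes_def by blast
    have "run ?\<Pi> [x] (Arg 0) x (1 + vsize x)" using run_Arg[of 0 "[x]"] by simp
    then have r: "run ?\<Pi> [x] (Call (length \<Pi>) [Arg 0]) (f x) (1 + vsize x + t + 1 + vsize (f x))"
      using t(2) by (intro run_Call1) auto
    have "1 + vsize x + t + 1 + vsize (f x) \<le> ?q (vsize x)"
      using t(1) vsize_le_cost[OF t(2)] by simp
    then show ?thesis using r kd[OF vsize_pos[of x]] le_trans by blast
  qed
  then show ?thesis unfolding poly_time_on_def by blast
qed

text \<open>Structural recursion stays in polynomial time if its values have polynomial size: each
  node of the argument is visited once.\<close>

lemma ptime_rec_aux: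
  assumes a: "ptime a"
    and s: "ptime (\<lambda>z. s (vfst z) (vfst (vsnd z)) (vfst (vsnd (vsnd z)))
              (vfst (vsnd (vsnd (vsnd z)))) (vsnd (vsnd (vsnd (vsnd z)))))"
    and h_Atom: "\<And>e. h e Atom = a e"
    and h_Cell: "\<And>e v w. h e (Cell v w) = s e v w (h e v) (h e w)"
    and q: "polyfun q" and bound: "\<And>e x. vsize (h e x) \<le> q (vsize e + vsize x)"
  shows "ptime (\<lambda>z. h (vfst z) (vsnd z))"
proof -
  let ?s = "\<lambda>z. s (vfst z) (vfst (vsnd z)) (vfst (vsnd (vsnd z)))
              (vfst (vsnd (vsnd (vsnd z)))) (vsnd (vsnd (vsnd (vsnd z))))"
  obtain \<Pi> ea es p where p: "polyfun p" and c: "computes \<Pi> ea p a" "computes \<Pi> es p ?s"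
    using a s by (rule ptime2E)
  define m where "m = length \<Pi>"
  define ze where "ze = EFst (Arg 0)"
  define zv where "zv = EFst (ESnd (Arg 0))"
  define zw where "zw = ESnd (ESnd (Arg 0))"
  define call where "call = (\<lambda>e. Call (m + 2) [ECell ze e])"
  \<comment> \<open>The recursion is one function, of index \<open>m + 2\<close>, on pairs of a
    parameter and a value. It calls the code of \<open>s\<close> at index \<open>m + 1\<close> on a
    tuple containing both recursive results, and that of \<open>a\<close> at index
    \<open>m\<close>.\<close>
  define body where "body = EIf (ESnd (Arg 0))
     (Call (m + 1) [ECell ze (ECell zv (ECell zw (ECell (call zv) (call zw))))]) (Call m [ze])"
  define \<Pi>' where "\<Pi>' = \<Pi> @ [ea, es, body]"
  have nth: "\<Pi>' ! m = ea" "\<Pi>' ! (m + 1) = es" "\<Pi>' ! (m + 2) = body" "length \<Pi>' = m + 3"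
    by (auto simp: \<Pi>'_def m_def nth_append)
  have ca: "computes \<Pi>' ea p a" and cs: "computes \<Pi>' es p ?s"
    using c unfolding \<Pi>'_def by (auto intro: computes_append)
  \<comment> \<open>For a parameter and a value of size at most \<open>N\<close>, \<open>Q N\<close>
    bounds the result and \<open>K N\<close> the cost spent at one node outside the recursive calls.
    The argument of \<open>p\<close> in \<open>K\<close> is the size of the tuple passed to
    \<open>s\<close>: four cells, three inputs and two results. The factors 100 are slack for the
    bounded number of other steps.\<close>
  define Q where "Q N = q (N + N)" for N
  define K where "K N = 100 + 100 * N + 100 * Q N + p (3 * N + 2 * Q N + 4)" for N
  \<comment> \<open>\<open>N\<close> stays fixed while the argument shrinks, so every node is
    charged the same amount \<open>K N\<close> and the charges simply add up.\<close>
  have main: "\<exists>t \<le> vsize x * K N. run \<Pi>' [z] body (h (vfst z) x) t"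
    if "vsnd z = x" "vsize z \<le> N" for N x z
    using that
  proof (induction x arbitrary: z)
    case Atom
    have e: "run \<Pi>' [z] ze (vfst z) (1 + vsize z + 1 + vsize (vfst z))"
      unfolding ze_def using run_Fst[OF run_Arg[of 0 "[z]"]] by simp
    obtain t where t: "t \<le> p (vsize (vfst z))" "run \<Pi>' [vfst z] ea (a (vfst z)) t"
      using ca unfolding computes_def by blast
    have 1: "run \<Pi>' [z] (Call m [ze]) (a (vfst z))
        (1 + vsize z + 1 + vsize (vfst z) + t + 1 + vsize (a (vfst z)))"
      using t(2) nth by (intro run_Call1[OF _ e]) auto
    have "run \<Pi>' [z] (ESnd (Arg 0)) (vsnd z) (1 + vsize z + 1 + vsize (vsnd z))"
      using run_Snd[OF run_Arg[of 0 "[z]"]] by simp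
    then have 2: "run \<Pi>' [z] (ESnd (Arg 0)) Atom (1 + vsize z + 1 + 1)"
      using Atom by simp
    note r = run_If_false[OF 2 1,
      of "Call (m + 1) [ECell ze (ECell zv (ECell zw (ECell (call zv) (call zw))))]", folded body_def]
    have sz: "vsize (vfst z) \<le> N" using Atom(2) vsize_vfst_le le_trans by blast
    have sa: "vsize (a (vfst z)) \<le> Q N"
    proof -
      have "vsize (a (vfst z)) \<le> q (vsize (vfst z) + vsize Atom)"
        using bound[of "vfst z" Atom] h_Atom by simp
      also have "\<dots> \<le> Q N" unfolding Q_def using sz vsize_pos[of z] Atom(2)
        by (intro polyfun_mono[OF q]) auto
      finally show ?thesis .
    qed
    have "t \<le> p (3 * N + 2 * Q N + 4)"
      using t(1) sz by (elim order.trans) (intro polyfun_mono[OF p], simp)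
    then show ?case
      unfolding h_Atom
      by - (rule exI, rule conjI[OF _ r], use sz sa Atom(2) in \<open>simp add: K_def\<close>)
  next
    case (Cell v w)
    have sz: "vsize (vfst z) \<le> N" "vsize v \<le> N" "vsize w \<le> N" "vsize (vsnd z) \<le> N"
      using Cell(4) Cell(3) vsize_vfst_le[of z] vsize_vsnd_le[of z] by auto
    let ?e = "vfst z"
    obtain v' where z: "z = Cell v' (Cell v w)" using Cell(3) by (cases z) auto
    have sQ: "vsize (h ?e y) \<le> Q N" if "vsize y \<le> N" for y
      using bound[of ?e y] sz that unfolding Q_def
      by (elim order.trans) (intro polyfun_mono[OF q], simp)
    have A: "run \<Pi>' [z] (Arg 0) z (1 + vsize z)" using run_Arg[of 0 "[z]"] by simp
    have e: "\<exists>t\<le>2 + 2 * N. run \<Pi>' [z] ze ?e t"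
      unfolding ze_def by (rule exI, rule conjI[OF _ run_Fst[OF A]], use sz Cell(4) in simp)
    have S: "\<exists>t\<le>2 + 2 * N. run \<Pi>' [z] (ESnd (Arg 0)) (Cell v w) t"
      by (rule exI, rule conjI[OF _ run_Snd[OF A, unfolded Cell(3)]], use sz Cell(3,4) in simp)
    obtain ts where ts: "ts \<le> 2 + 2 * N" "run \<Pi>' [z] (ESnd (Arg 0)) (Cell v w) ts"
      using S by blast
    obtain te where te: "te \<le> 2 + 2 * N" "run \<Pi>' [z] ze ?e te" using e by blast
    have "\<exists>t\<le>3 + 3 * N. run \<Pi>' [z] zv v t"
      unfolding zv_def
      by (rule exI, rule conjI[OF _ run_Fst[OF ts(2), unfolded vfst.simps]], use sz ts in simp)
    then obtain tv where tv: "tv \<le> 3 + 3 * N" "run \<Pi>' [z] zv v tv" by blast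
    have "\<exists>t\<le>3 + 3 * N. run \<Pi>' [z] zw w t"
      unfolding zw_def
      by (rule exI, rule conjI[OF _ run_Snd[OF ts(2), unfolded vsnd.simps]], use sz ts in simp)
    then obtain tw where tw: "tw \<le> 3 + 3 * N" "run \<Pi>' [z] zw w tw" by blast
    have "vsize (Cell ?e v) \<le> N" "vsize (Cell ?e w) \<le> N" using Cell(4) by (auto simp: z)
    then obtain rv rw where rv: "rv \<le> vsize v * K N" "run \<Pi>' [Cell ?e v] body (h ?e v) rv"
      and rw: "rw \<le> vsize w * K N" "run \<Pi>' [Cell ?e w] body (h ?e w) rw"
      using Cell(1)[of "Cell ?e v"] Cell(2)[of "Cell ?e w"] by auto
    note ev = run_Cell[OF te(2) tv(2)]
    note ew = run_Cell[OF te(2) tw(2)]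
    have bodyrun: "run \<Pi>' [x] (\<Pi>' ! (m + 2)) y t \<longleftrightarrow> run \<Pi>' [x] body y t" for x y t
      using nth by simp
    have m2: "m + 2 < length \<Pi>'" using nth by simp
    note cv = run_Call1[OF m2 ev, unfolded bodyrun, OF rv(2), folded call_def[unfolded fun_eq_iff, rule_format]]
    note cw = run_Call1[OF m2 ew, unfolded bodyrun, OF rw(2), folded call_def[unfolded fun_eq_iff, rule_format]]
    let ?arg = "Cell ?e (Cell v (Cell w (Cell (h ?e v) (h ?e w))))"
    note pk = run_Cell[OF te(2) run_Cell[OF tv(2) run_Cell[OF tw(2) run_Cell[OF cv cw]]]]
    obtain t where t: "t \<le> p (vsize ?arg)" "run \<Pi>' [?arg] es (h ?e (Cell v w)) t"
      using cs unfolding computes_def h_Cell by (metis vfst.simps(2) vsnd.simps(2))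
    have m1: "m + 1 < length \<Pi>'" using nth by simp
    have esrun: "run \<Pi>' [x] (\<Pi>' ! (m + 1)) y t \<longleftrightarrow> run \<Pi>' [x] es y t" for x y t
      using nth by simp
    note cl = run_Call1[OF m1 pk, unfolded esrun, OF t(2)]
    note r = run_If_true[OF ts(2) val.distinct(2) cl, of "Call m [ze]", folded body_def]
    have "vsize ?arg \<le> 3 * N + 2 * Q N + 4"
      using sz sQ[OF sz(2)] sQ[OF sz(3)] by simp
    then have tp: "t \<le> p (3 * N + 2 * Q N + 4)"
      using t(1) by (elim order.trans) (intro polyfun_mono[OF p])
    have sx: "vsize (h ?e (Cell v w)) \<le> Q N" using sQ Cell(3) sz(4) by simp
    have KK: "vsize (Cell v w) * K N = vsize v * K N + vsize w * K N + K N"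
      by (simp add: algebra_simps)
    show ?case
      unfolding KK
      by (rule exI, rule conjI[OF _ r])
         (use tp sx sz sQ[OF sz(2)] sQ[OF sz(3)] ts te tv tw rv(1) rw(1) in \<open>simp add: K_def\<close>)
  qed
  show ?thesis
  proof (rule ptimeI)
    show "polyfun (\<lambda>n. n * K n)" unfolding K_def Q_def
      by (intro polyfun.intros polyfun_comp[OF p] polyfun_comp[OF q])
    fix z
    obtain t where "t \<le> vsize (vsnd z) * K (vsize z)" "run \<Pi>' [z] body (h (vfst z) (vsnd z)) t"
      using main[of z "vsnd z" "vsize z"] by auto
    moreover have "vsize (vsnd z) * K (vsize z) \<le> vsize z * K (vsize z)"
      using vsize_vsnd_le by simp
    ultimately show "\<exists>t\<le>vsize z * K (vsize z). run \<Pi>' [z] body (h (vfst z) (vsnd z)) t"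
      using le_trans by blast
  qed
qed


lemma ptime_rec:
  assumes "ptime a"
    and "ptime (\<lambda>z. s (vfst z) (vfst (vsnd z)) (vfst (vsnd (vsnd z)))
              (vfst (vsnd (vsnd (vsnd z)))) (vsnd (vsnd (vsnd (vsnd z)))))"
    and "\<And>e. h e Atom = a e"
    and "\<And>e v w. h e (Cell v w) = s e v w (h e v) (h e w)"
    and "polyfun q" and "\<And>e x. vsize (h e x) \<le> q (vsize e + vsize x)"
    and "ptime X"
  shows "ptime (\<lambda>e. h e (X e))"
  using ptime_comp2[OF ptime_rec_aux[OF assms(1-6)] ptime_id assms(7)] .

section \<open>Lists of values\<close>

text \<open>Every value is the code of exactly one list of values.\<close>

primrec dec_list :: "val \<Rightarrow> val list" where
  "dec_list Atom = []"
| "dec_list (Cell v w) = v # dec_list w"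

lemma enc_list_simps [simp]:
  "enc_list [] = Atom"
  "enc_list (v # vs) = Cell v (enc_list vs)"
  by (simp_all add: enc_list_def)

lemma dec_list_enc_list [simp]: "dec_list (enc_list vs) = vs"
  by (induction vs) auto

lemma enc_list_dec_list [simp]: "enc_list (dec_list v) = v"
  by (induction v) auto

lemma enc_list_eq_iff [simp]: "enc_list vs = enc_list ws \<longleftrightarrow> vs = ws"
  by (metis dec_list_enc_list)

lemma vsize_enc_list: "vsize (enc_list vs) = 1 + (\<Sum>v\<leftarrow>vs. 1 + vsize v)"
  by (induction vs) auto

lemma length_le_vsize_enc_list: "length vs \<le> vsize (enc_list vs)"
  by (induction vs) auto

lemma vsize_member_le: "v \<in> set vs \<Longrightarrow> vsize v \<le> vsize (enc_list vs)"
  by (induction vs) auto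

lemma vsize_enc_list_le:
  assumes "length vs \<le> m" "\<And>v. v \<in> set vs \<Longrightarrow> vsize v \<le> k"
  shows "vsize (enc_list vs) \<le> 1 + m * (1 + k)"
proof -
  have "vsize (enc_list vs) \<le> 1 + length vs * (1 + k)"
    using assms(2) by (induction vs) force+
  also have "\<dots> \<le> 1 + m * (1 + k)" using assms(1) by (intro add_mono mult_le_mono) auto
  finally show ?thesis .
qed

text \<open>A fold is structural recursion along the right spine of the list, with the result for
  the head ignored. The size hypothesis speaks of all lists because the recursion also meets the
  suffixes.\<close>

lemma ptime_foldr:
  assumes X: "ptime X" and z: "ptime z"
    and s: "ptime (\<lambda>w. s (vfst w) (vfst (vsnd w)) (vsnd (vsnd w)))"
    and q: "polyfun q"
    and bound: "\<And>e ys. vsize (foldr (s e) ys (z e)) \<le> q (vsize e + vsize (enc_list ys))"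
  shows "ptime (\<lambda>e. foldr (s e) (dec_list (X e)) (z e))"
proof (rule ptime_rec[where h = "\<lambda>e x. foldr (s e) (dec_list x) (z e)" and a = z and X = X
      and s = "\<lambda>e v w hv hw. s e v hw", OF z _ _ _ q _ X])
  show "ptime (\<lambda>z. s (vfst z) (vfst (vsnd z)) (vsnd (vsnd (vsnd (vsnd z)))))"
    using ptime_comp[OF s, of "\<lambda>z. Cell (vfst z) (Cell (vfst (vsnd z)) (vsnd (vsnd (vsnd (vsnd z)))))"]
    by (simp add: ptime_Cell ptime_vfst ptime_vsnd ptime_id)
  show "vsize (foldr (s e) (dec_list x) (z e)) \<le> q (vsize e + vsize x)" for e x
    using bound[of e "dec_list x"] by simp
qed auto

definition vmap :: "(val \<Rightarrow> val) \<Rightarrow> val \<Rightarrow> val" where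
  "vmap f v = enc_list (map f (dec_list v))"

definition vfilter :: "(val \<Rightarrow> bool) \<Rightarrow> val \<Rightarrow> val" where
  "vfilter P v = enc_list (filter P (dec_list v))"

definition vappend :: "val \<Rightarrow> val \<Rightarrow> val" where
  "vappend v w = enc_list (dec_list v @ dec_list w)"

definition vrev :: "val \<Rightarrow> val" where
  "vrev v = enc_list (rev (dec_list v))"

definition vmem :: "val \<Rightarrow> val \<Rightarrow> bool" where
  "vmem x v \<longleftrightarrow> x \<in> set (dec_list v)"

definition vex :: "(val \<Rightarrow> bool) \<Rightarrow> val \<Rightarrow> bool" where
  "vex P v \<longleftrightarrow> (\<exists>x \<in> set (dec_list v). P x)"

lemma vsize_vfilter_le: "vsize (vfilter P v) \<le> vsize v"
  by (induction v) (auto simp: vfilter_def)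

lemma vsize_vrev [simp]: "vsize (vrev v) = vsize v"
proof -
  have "vsize (vrev v) = vsize (enc_list (dec_list v))"
    unfolding vrev_def vsize_enc_list by (simp add: rev_map[symmetric])
  then show ?thesis by simp
qed

lemma vsize_vappend: "vsize (vappend v w) + 1 = vsize v + vsize w"
  by (induction v) (auto simp: vappend_def)

lemma ptime_vmap:
  assumes f: "ptime (\<lambda>z. f (vfst z) (vsnd z))" and X: "ptime X"
  shows "ptime (\<lambda>e. vmap (f e) (X e))"
proof -
  obtain p where p: "polyfun p" "\<And>z. vsize (f (vfst z) (vsnd z)) \<le> p (vsize z)"
    using f by (rule ptime_size) blast
  have fold: "foldr (\<lambda>y acc. Cell (f e y) acc) ys Atom = enc_list (map (f e) ys)" for e ys
    by (induction ys) auto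
  have "ptime (\<lambda>e. foldr (\<lambda>y acc. Cell (f e y) acc) (dec_list (X e)) Atom)"
  proof (rule ptime_foldr[OF X ptime_Atom])
    show "ptime (\<lambda>w. Cell (f (vfst w) (vfst (vsnd w))) (vsnd (vsnd w)))"
      by (intro ptime_Cell ptime_comp2[OF f] ptime_vfst ptime_vsnd ptime_id)
    show "polyfun (\<lambda>n. 1 + n * (1 + p (1 + n)))"
      by (intro polyfun.intros polyfun_comp[OF p(1)])
    fix e ys
    let ?n = "vsize e + vsize (enc_list ys)"
    have "vsize (f e y) \<le> p (1 + ?n)" if "y \<in> set ys" for y
    proof -
      have "vsize (f e y) \<le> p (vsize (Cell e y))" using p(2)[of "Cell e y"] by simp
      also have "\<dots> \<le> p (1 + ?n)" using vsize_member_le[OF that] by (intro polyfun_mono[OF p(1)]) simp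
      finally show ?thesis .
    qed
    then show "vsize (foldr (\<lambda>y acc. Cell (f e y) acc) ys Atom) \<le> 1 + ?n * (1 + p (1 + ?n))"
      unfolding fold using length_le_vsize_enc_list[of ys]
      by (intro vsize_enc_list_le) auto
  qed
  then show ?thesis by (simp add: fold vmap_def)
qed

lemma ptime_vfilter:
  assumes P: "ptest (\<lambda>z. P (vfst z) (vsnd z))" and X: "ptime X"
  shows "ptime (\<lambda>e. vfilter (P e) (X e))"
proof -
  have fold: "foldr (\<lambda>y acc. if P e y then Cell y acc else acc) ys Atom
      = enc_list (filter (P e) ys)" for e ys
    by (induction ys) auto
  have P': "ptest (\<lambda>w. P (vfst w) (vfst (vsnd w)))"
    using ptime_comp2[OF P[unfolded ptest_def], of vfst "\<lambda>w. vfst (vsnd w)"]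
    unfolding ptest_def by (simp add: ptime_vfst ptime_vsnd ptime_id)
  have "ptime (\<lambda>e. foldr (\<lambda>y acc. if P e y then Cell y acc else acc) (dec_list (X e)) Atom)"
  proof (rule ptime_foldr[OF X ptime_Atom])
    show "ptime (\<lambda>w. if P (vfst w) (vfst (vsnd w)) then Cell (vfst (vsnd w)) (vsnd (vsnd w))
        else vsnd (vsnd w))"
      by (intro ptime_if P' ptime_Cell ptime_vfst ptime_vsnd ptime_id)
    show "polyfun (\<lambda>n. n)" by (rule polyfun_id)
    show "vsize (foldr (\<lambda>y acc. if P e y then Cell y acc else acc) ys Atom)
        \<le> vsize e + vsize (enc_list ys)" for e ys
      unfolding fold using vsize_vfilter_le[of "P e" "enc_list ys"] by (simp add: vfilter_def)
  qed
  then show ?thesis by (simp add: fold vfilter_def)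
qed

lemma ptest_vex:
  assumes "ptest (\<lambda>z. P (vfst z) (vsnd z))" "ptime X"
  shows "ptest (\<lambda>e. vex (P e) (X e))"
proof -
  have "vex (P e) (X e) \<longleftrightarrow> \<not> (vfilter (P e) (X e) = Atom)" for e
    using enc_list_eq_iff[of "filter (P e) (dec_list (X e))" "[]"]
    by (auto simp: vex_def vfilter_def filter_empty_conv simp del: enc_list_eq_iff)
  then show ?thesis
    by (simp add: ptest_not ptest_eq ptime_vfilter[OF assms] ptime_Atom)
qed

lemma ptest_vmem:
  assumes f: "ptime f" and X: "ptime X"
  shows "ptest (\<lambda>e. vmem (f e) (X e))"
proof -
  have "ptest (\<lambda>e. vex (\<lambda>y. y = f e) (X e))"
    by (intro ptest_vex ptest_eq ptime_vsnd ptime_comp[OF f] ptime_vfst ptime_id X)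
  then show ?thesis by (simp add: vex_def vmem_def)
qed

lemma ptime_vappend:
  assumes X: "ptime X" and Y: "ptime Y"
  shows "ptime (\<lambda>e. vappend (X e) (Y e))"
proof -
  have fold: "foldr Cell xs y = vappend (enc_list xs) y" for xs y
    by (induction xs) (auto simp: vappend_def)
  have "ptime (\<lambda>z. foldr Cell (dec_list (vfst z)) (vsnd z))"
  proof (rule ptime_foldr[of vfst vsnd "\<lambda>e. Cell"])
    show "polyfun (\<lambda>n. n)" by (rule polyfun_id)
    show "vsize (foldr Cell ys (vsnd e)) \<le> vsize e + vsize (enc_list ys)" for e ys
      unfolding fold using vsize_vappend[of "enc_list ys" "vsnd e"] vsize_vsnd_le[of e] by simp
  qed (intro ptime_vfst ptime_vsnd ptime_Cell ptime_id)+
  then have "ptime (\<lambda>z. vappend (vfst z) (vsnd z))" by (simp add: fold)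
  then show ?thesis using X Y by (rule ptime_comp2)
qed

lemma ptime_vrev:
  assumes X: "ptime X"
  shows "ptime (\<lambda>e. vrev (X e))"
proof -
  have fold: "foldr (\<lambda>y acc. vappend acc (Cell y Atom)) ys Atom = vrev (enc_list ys)" for ys
    by (induction ys) (auto simp: vappend_def vrev_def)
  have "ptime (\<lambda>e. foldr (\<lambda>y acc. vappend acc (Cell y Atom)) (dec_list (X e)) Atom)"
  proof (rule ptime_foldr[OF X ptime_Atom])
    show "polyfun (\<lambda>n. n)" by (rule polyfun_id)
    show "ptime (\<lambda>w. vappend (vsnd (vsnd w)) (Cell (vfst (vsnd w)) Atom))"
      by (intro ptime_vappend ptime_vfst ptime_vsnd ptime_Cell ptime_id ptime_Atom)
    show "vsize (foldr (\<lambda>y acc. vappend acc (Cell y Atom)) ys Atom)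
        \<le> vsize e + vsize (enc_list ys)" for e ys
      unfolding fold by simp
  qed
  then show ?thesis by (simp add: fold)
qed

section \<open>Recursion over codes of trees\<close>

text \<open>A node is coded by its label and the list of its subtrees. The step receives this list
  along with the list of results, since both translations look at the labels of the
  children.\<close>

fun vtree :: "(val \<Rightarrow> val \<Rightarrow> val \<Rightarrow> val) \<Rightarrow> val \<Rightarrow> val"
  and vforest :: "(val \<Rightarrow> val \<Rightarrow> val \<Rightarrow> val) \<Rightarrow> val \<Rightarrow> val" where
  "vtree s Atom = Atom"
| "vtree s (Cell v w) = s v w (vforest s w)"
| "vforest s Atom = Atom"
| "vforest s (Cell v w) = Cell (vtree s v) (vforest s w)"

lemma vforest_eq_vmap: "vforest s v = vmap (vtree s) v"
  by (induction v) (auto simp: vmap_def)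

text \<open>The results of the children enter the size hypothesis with coefficient one. Each node
  then adds a polynomial amount independent of these results, and the total is at most the size of
  the argument times such an amount; a polynomial in \<open>vsize r\<close> would be iterated along
  the depth of the tree.\<close>

lemma ptime_vtree:
  assumes s: "ptime (\<lambda>z. s (vfst z) (vfst (vsnd z)) (vfst (vsnd (vsnd z))) (vsnd (vsnd (vsnd z))))"
    and g: "polyfun g"
    and bound: "\<And>e v w r. vsize (s e v w r) \<le> vsize r + g (vsize e + vsize v + vsize w)"
    and X: "ptime X"
  shows "ptime (\<lambda>e. vtree (s e) (X e))"
proof -
  \<comment> \<open>A subterm is a tree or a forest depending on where it stands: the recursion computes the
    result for both readings.\<close>
  define h where "h e x = Cell (vtree (s e) x) (vforest (s e) x)" for e x
  let ?s = "\<lambda>e v w hv hw. Cell (s e v w (vsnd hw)) (Cell (vfst hv) (vsnd hw))"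
  have size: "vsize (vtree (s e) x) \<le> vsize x * (1 + g (vsize e + vsize x)) \<and>
      vsize (vforest (s e) x) \<le> vsize x * (1 + g (vsize e + vsize x))" for e x
  proof (induction x)
    case (Cell v w)
    let ?G = "1 + g (vsize e + vsize (Cell v w))"
    have mono: "g (vsize e + vsize v) \<le> g (vsize e + vsize (Cell v w))"
      "g (vsize e + vsize w) \<le> g (vsize e + vsize (Cell v w))"
      "g (vsize e + vsize v + vsize w) \<le> g (vsize e + vsize (Cell v w))"
      by (auto intro!: polyfun_mono[OF g])
    have "vsize v * (1 + g (vsize e + vsize v)) \<le> vsize v * ?G"
      "vsize w * (1 + g (vsize e + vsize w)) \<le> vsize w * ?G"
      using mono by (auto intro!: mult_le_mono simp del: vsize.simps)
    then have IH: "vsize (vtree (s e) v) \<le> vsize v * ?G" "vsize (vforest (s e) w) \<le> vsize w * ?G"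
      using Cell le_trans by blast+
    have eq: "vsize (Cell v w) * ?G = ?G + vsize v * ?G + vsize w * ?G"
      by (simp add: algebra_simps del: vsize.simps(2)) (simp add: algebra_simps)
    have "vsize (vtree (s e) (Cell v w)) \<le> vsize (Cell v w) * ?G"
      unfolding eq using bound[of e v w "vforest (s e) w"] IH(2) mono(3)
      by (simp del: vsize.simps(2))
    moreover have "vsize (vforest (s e) (Cell v w)) \<le> vsize (Cell v w) * ?G"
      unfolding eq using IH by simp
    ultimately show ?case by blast
  qed auto
  have "ptime (\<lambda>e. h e (X e))"
  proof (rule ptime_rec[where s = ?s, OF _ _ _ _ _ _ X])
    show "ptime (\<lambda>_. Cell Atom Atom)" by (rule ptime_const)
    show "ptime (\<lambda>z. ?s (vfst z) (vfst (vsnd z)) (vfst (vsnd (vsnd z)))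
              (vfst (vsnd (vsnd (vsnd z)))) (vsnd (vsnd (vsnd (vsnd z)))))"
      using ptime_comp[OF s, of "\<lambda>z. Cell (vfst z) (Cell (vfst (vsnd z)) (Cell (vfst (vsnd (vsnd z)))
        (vsnd (vsnd (vsnd (vsnd (vsnd z)))))))"]
      by (simp add: ptime_Cell ptime_vfst ptime_vsnd ptime_id)
    show "polyfun (\<lambda>n. 1 + n * (1 + g n) + n * (1 + g n))"
      by (intro polyfun.intros g)
    fix e x
    have "vsize x * (1 + g (vsize e + vsize x)) \<le> (vsize e + vsize x) * (1 + g (vsize e + vsize x))"
      by (intro mult_le_mono) auto
    then show "vsize (h e x) \<le> 1 + (vsize e + vsize x) * (1 + g (vsize e + vsize x))
        + (vsize e + vsize x) * (1 + g (vsize e + vsize x))"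
      using size[of e x] unfolding h_def by simp
  qed (simp_all add: h_def)
  from ptime_vfst[OF this] show ?thesis by (simp add: h_def)
qed

section \<open>Proof trees\<close>

text \<open>Dropping the underlying sequence turns correctness into a local condition, so that
  proofs can be translated by induction on trees.\<close>

fun valid :: "qcbf \<Rightarrow> judgement tree \<Rightarrow> bool" where
  "valid \<psi> (Node J ts) \<longleftrightarrow>
     is_judgement \<psi> J \<and> derived \<psi> J (map root ts) \<and> (\<forall>t\<in>set ts. valid \<psi> t)"

lemma valid_root: "valid \<psi> P \<Longrightarrow> is_judgement \<psi> (root P)"
  by (cases P) auto

lemma induced_tree_valid:
  assumes "is_proof \<psi> \<pi>" "induced_tree \<pi> k P"
  shows "valid \<psi> P \<and> root P = fst (\<pi> ! k)"
  using assms(2)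
proof (induction rule: induced_tree.induct)
  case (1 k J ps ts)
  have len: "length ps = length ts" using 1(3) by (rule list_all2_lengthD)
  have nth: "valid \<psi> (ts ! n) \<and> root (ts ! n) = fst (\<pi> ! (ps ! n))" if "n < length ts" for n
    using 1(3) that len by (auto simp: list_all2_conv_all_nth)
  have "map root ts = map (\<lambda>p. fst (\<pi> ! p)) ps"
    using len nth by (intro nth_equalityI) auto
  moreover have "\<forall>t\<in>set ts. valid \<psi> t" using nth by (auto simp: in_set_conv_nth)
  ultimately show ?case using 1(1,2) assms(1) by (auto simp: is_proof_def)
qed

section \<open>Linearising proof trees\<close>

definition shift_preds :: "nat \<Rightarrow> judgement_seq \<Rightarrow> judgement_seq" where
  "shift_preds n \<pi> = map (\<lambda>(J, ps). (J, map ((+) n) ps)) \<pi>"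

lemma induced_tree_append: "induced_tree \<pi> k P \<Longrightarrow> induced_tree (\<pi> @ \<pi>') k P"
proof (induction rule: induced_tree.induct)
  case (1 k J ps ts)
  then show ?case
    by (intro induced_tree.intros[of _ _ _ ps]) (auto simp: nth_append elim: list.rel_mono_strong)
qed

lemma induced_tree_shift:
  "induced_tree \<pi> k P \<Longrightarrow> induced_tree (\<pi>' @ shift_preds (length \<pi>') \<pi>) (length \<pi>' + k) P"
proof (induction rule: induced_tree.induct)
  case (1 k J ps ts)
  have "list_all2 (induced_tree (\<pi>' @ shift_preds (length \<pi>') \<pi>)) (map ((+) (length \<pi>')) ps) ts"
    using 1(3) by (auto simp: list_all2_map1 elim: list.rel_mono_strong)
  then show ?case using 1(1,2)
    by (intro induced_tree.intros) (auto simp: nth_append shift_preds_def)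
qed

lemma is_proof_preds_bounded:
  assumes "is_proof \<psi> \<pi>" "p \<in> set (concat (map snd \<pi>))"
  shows "p < length \<pi>"
proof -
  obtain x where "x \<in> set \<pi>" "p \<in> set (snd x)" using assms(2) by auto
  then obtain k where "k < length \<pi>" "p \<in> set (snd (\<pi> ! k))" by (metis in_set_conv_nth)
  moreover obtain J ps where "\<pi> ! k = (J, ps)" by fastforce
  ultimately show ?thesis using assms(1) unfolding is_proof_def by fastforce
qed

lemma is_proof_append_shift:
  assumes "is_proof \<psi> \<pi>1" "is_proof \<psi> \<pi>2"
  shows "is_proof \<psi> (\<pi>1 @ shift_preds (length \<pi>1) \<pi>2)" (is "is_proof \<psi> ?\<pi>")
  unfolding is_proof_def
proof (intro allI impI)
  fix k assume k: "k < length ?\<pi>"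
  show "case ?\<pi> ! k of (J, ps) \<Rightarrow> is_judgement \<psi> J \<and> (\<forall>p\<in>set ps. p < k)
      \<and> derived \<psi> J (map (\<lambda>p. fst (?\<pi> ! p)) ps)"
  proof (cases "k < length \<pi>1")
    case True
    obtain J ps where Jps: "\<pi>1 ! k = (J, ps)" by fastforce
    then have *: "is_judgement \<psi> J" "\<forall>p\<in>set ps. p < k" "derived \<psi> J (map (\<lambda>p. fst (\<pi>1 ! p)) ps)"
      using assms(1) True by (auto simp: is_proof_def)
    have "map (\<lambda>p. fst (?\<pi> ! p)) ps = map (\<lambda>p. fst (\<pi>1 ! p)) ps"
      using *(2) True by (auto simp: nth_append)
    moreover have "?\<pi> ! k = (J, ps)" using True Jps by (simp add: nth_append)
    ultimately show ?thesis using * by (simp del: map_eq_conv)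
  next
    case False
    define m where "m = k - length \<pi>1"
    have m: "k = length \<pi>1 + m" "m < length \<pi>2" using False k by (auto simp: m_def shift_preds_def)
    obtain J ps where Jps: "\<pi>2 ! m = (J, ps)" by fastforce
    then have *: "is_judgement \<psi> J" "\<forall>p\<in>set ps. p < m" "derived \<psi> J (map (\<lambda>p. fst (\<pi>2 ! p)) ps)"
      using assms(2) m by (auto simp: is_proof_def)
    have "map (\<lambda>p. fst (?\<pi> ! p)) (map ((+) (length \<pi>1)) ps) = map (\<lambda>p. fst (\<pi>2 ! p)) ps"
      using *(2) m by (auto simp: nth_append shift_preds_def split: prod.splits)
    moreover have "?\<pi> ! k = (J, map ((+) (length \<pi>1)) ps)"
      using m Jps by (simp add: nth_append shift_preds_def)
    ultimately show ?thesis using * m by (simp del: map_eq_conv map_map)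
  qed
qed

text \<open>Distinctness of all predecessor lists together is stronger than being tree-like, as it
  also forbids one judgement to use the same position twice, but it is easily preserved when
  sequences are joined.\<close>

lemma distinct_preds_tree_like:
  assumes "distinct (concat (map snd \<pi>))"
  shows "tree_like \<pi>"
  unfolding tree_like_def
proof (intro allI impI)
  fix p
  have "k = k'" if "k < length \<pi>" "p \<in> set (snd (\<pi> ! k))" "k' < length \<pi>" "p \<in> set (snd (\<pi> ! k'))"
    for k k'
  proof (rule ccontr)
    assume ne: "k \<noteq> k'"
    \<comment> \<open>Cutting the sequence just before \<open>b\<close> puts the two uses of
      \<open>p\<close> into different halves, against distinctness.\<close>
    have *: False if "a < b" "b < length \<pi>" "p \<in> set (snd (\<pi> ! a))" "p \<in> set (snd (\<pi> ! b))" for a b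
    proof -
      have "\<pi> = take b \<pi> @ drop b \<pi>" by simp
      then have "distinct (concat (map snd (take b \<pi>)) @ concat (map snd (drop b \<pi>)))"
        using assms by (metis concat_append map_append)
      moreover have "p \<in> set (concat (map snd (take b \<pi>)))"
      proof -
        have "\<pi> ! a \<in> set (take b \<pi>)" using that by (auto simp: in_set_conv_nth intro: exI[of _ a])
        then show ?thesis using that by auto
      qed
      moreover have "\<pi> ! b \<in> set (drop b \<pi>)" using that by (metis Cons_nth_drop_Suc list.set_intros(1))
      then have "p \<in> set (concat (map snd (drop b \<pi>)))" using that by auto
      ultimately show False by (metis disjoint_iff distinct_append)
    qed
    from ne consider "k < k'" | "k' < k" by linarith
    then show False using * that by cases metis+
  qed
  then show "card {k. k < length \<pi> \<and> p \<in> set (snd (\<pi> ! k))} \<le> 1"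
    by (subst card_le_Suc0_iff_eq[unfolded One_nat_def[symmetric]]) auto
qed

text \<open>Linearising a tree in postorder uses every position at most once as a predecessor; the
  positions of the roots remain unused.\<close>

lemma valid_linearise:
  "valid \<psi> P \<Longrightarrow> \<exists>\<pi> k. is_proof \<psi> \<pi> \<and> distinct (concat (map snd \<pi>) @ [k]) \<and> k < length \<pi>
     \<and> induced_tree \<pi> k P"
proof (induction P)
  case (Node J ts)
  \<comment> \<open>The root positions are collected in \<open>ps\<close> and kept distinct from all
    used positions: afterwards \<open>ps\<close> itself can serve as the predecessor list of one
    more judgement.\<close>
  have forest: "\<exists>\<pi> ps. is_proof \<psi> \<pi> \<and> distinct (concat (map snd \<pi>) @ ps)
     \<and> (\<forall>p\<in>set ps. p < length \<pi>) \<and> list_all2 (induced_tree \<pi>) ps us" if "set us \<subseteq> set ts" for us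
    using that
  proof (induction us)
    case Nil
    show ?case by (rule exI[of _ "[]"], rule exI[of _ "[]"]) (simp add: is_proof_def)
  next
    case (Cons u us)
    obtain \<pi>1 k where 1: "is_proof \<psi> \<pi>1" "distinct (concat (map snd \<pi>1) @ [k])" "k < length \<pi>1"
      "induced_tree \<pi>1 k u"
      using Node Cons.prems by (metis insert_subset list.simps(15) valid.simps)
    obtain \<pi>2 ps where 2: "is_proof \<psi> \<pi>2" "distinct (concat (map snd \<pi>2) @ ps)"
      "\<forall>p\<in>set ps. p < length \<pi>2" "list_all2 (induced_tree \<pi>2) ps us"
      using Cons by auto
    let ?n = "length \<pi>1"
    let ?\<pi> = "\<pi>1 @ shift_preds ?n \<pi>2"
    have snd: "concat (map snd ?\<pi>) = concat (map snd \<pi>1) @ map ((+) ?n) (concat (map snd \<pi>2))"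
      by (simp add: shift_preds_def map_concat o_def case_prod_beta)
    show ?case
    proof (intro exI conjI)
      show "is_proof \<psi> ?\<pi>" using 1(1) 2(1) by (rule is_proof_append_shift)
      have "distinct (map ((+) ?n) (concat (map snd \<pi>2) @ ps))"
        using 2(2) by (subst distinct_map) simp
      then have d: "distinct (map ((+) ?n) (concat (map snd \<pi>2)) @ map ((+) ?n) ps)" by simp
      have lt: "\<forall>p\<in>set (concat (map snd \<pi>1) @ [k]). p < ?n"
        using is_proof_preds_bounded[OF 1(1)] 1(3) by auto
      \<comment> \<open>Positions of the first sequence lie below \<open>?n\<close>, those of the
        relocated second one do not.\<close>
      have "distinct ((concat (map snd \<pi>1) @ [k]) @
          (map ((+) ?n) (concat (map snd \<pi>2)) @ map ((+) ?n) ps))"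
        unfolding distinct_append[of "concat (map snd \<pi>1) @ [k]"]
      proof (intro conjI 1(2) d)
        show "set (concat (map snd \<pi>1) @ [k])
            \<inter> set (map ((+) ?n) (concat (map snd \<pi>2)) @ map ((+) ?n) ps) = {}"
          using lt by (fastforce simp del: set_concat)
      qed
      then show "distinct (concat (map snd ?\<pi>) @ (k # map ((+) ?n) ps))"
        unfolding snd by auto
      show "\<forall>p\<in>set (k # map ((+) ?n) ps). p < length ?\<pi>"
        using 1(3) 2(3) by (auto simp: shift_preds_def)
      have "list_all2 (induced_tree ?\<pi>) (map ((+) ?n) ps) us"
        using 2(4) by (auto simp: list_all2_map1 elim!: list.rel_mono_strong intro: induced_tree_shift)
      then show "list_all2 (induced_tree ?\<pi>) (k # map ((+) ?n) ps) (u # us)"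
        using induced_tree_append[OF 1(4)] by simp
    qed
  qed
  obtain \<pi> ps where f: "is_proof \<psi> \<pi>" "distinct (concat (map snd \<pi>) @ ps)"
     "\<forall>p\<in>set ps. p < length \<pi>" "list_all2 (induced_tree \<pi>) ps ts"
    using forest[of ts] by auto
  let ?\<pi> = "\<pi> @ [(J, ps)]"
  have len: "length ps = length ts" using f(4) by (rule list_all2_lengthD)
  have "root (ts ! n) = fst (\<pi> ! (ps ! n))" if "n < length ts" for n
    using f(4) that len induced_tree_valid[OF f(1)] by (auto simp: list_all2_conv_all_nth)
  then have roots: "map (\<lambda>p. fst (?\<pi> ! p)) ps = map root ts"
    using len f(3) by (intro nth_equalityI) (auto simp: nth_append)
  show ?case
  proof (intro exI conjI)
    have old: "map (\<lambda>p. fst (?\<pi> ! p)) qs = map (\<lambda>p. fst (\<pi> ! p)) qs"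
      if "\<pi> ! k = (K, qs)" "k < length \<pi>" for k K qs
    proof (rule map_cong[OF refl])
      fix p assume "p \<in> set qs"
      then have "p < length \<pi>" using that f(1) by (fastforce simp: is_proof_def)
      then show "fst (?\<pi> ! p) = fst (\<pi> ! p)" by (simp add: nth_append)
    qed
    show "is_proof \<psi> ?\<pi>"
      unfolding is_proof_def
    proof (intro allI impI)
      fix k assume k: "k < length ?\<pi>"
      show "case ?\<pi> ! k of (J, ps) \<Rightarrow> is_judgement \<psi> J \<and> (\<forall>p\<in>set ps. p < k)
          \<and> derived \<psi> J (map (\<lambda>p. fst (?\<pi> ! p)) ps)"
      proof (cases "k < length \<pi>")
        case True
        obtain K qs where "\<pi> ! k = (K, qs)" by fastforce
        moreover have "?\<pi> ! k = (K, qs)" using calculation True by (simp add: nth_append)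
        ultimately show ?thesis using old[of k K qs] True f(1) unfolding is_proof_def
          by (fastforce simp del: map_eq_conv)
      next
        case False
        then have "k = length \<pi>" using k by simp
        then show ?thesis using Node.prems f(3) roots by simp
      qed
    qed
    show "distinct (concat (map snd ?\<pi>) @ [length \<pi>])"
      using f(2,3) is_proof_preds_bounded[OF f(1)] by (auto simp del: set_concat)
    show "length \<pi> < length ?\<pi>" by simp
    show "induced_tree ?\<pi> (length \<pi>) (Node J ts)"
      using f(4) by (intro induced_tree.intros[of _ _ _ ps])
        (auto elim!: list.rel_mono_strong intro: induced_tree_append)
  qed
qed

lemma tree_like_empty_clause_proof_iff:
  "tree_like_empty_clause_proof \<psi> P \<longleftrightarrow> valid \<psi> P \<and> snd (root P) = {}"
proof
  assume "tree_like_empty_clause_proof \<psi> P"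
  then show "valid \<psi> P \<and> snd (root P) = {}"
    unfolding tree_like_empty_clause_proof_def using induced_tree_valid by fastforce
next
  assume P: "valid \<psi> P \<and> snd (root P) = {}"
  then obtain \<pi> k where \<pi>: "is_proof \<psi> \<pi>" "distinct (concat (map snd \<pi>) @ [k])" "k < length \<pi>"
    "induced_tree \<pi> k P"
    using valid_linearise by blast
  obtain i \<alpha> ps where k: "\<pi> ! k = ((i, \<alpha>), ps)" by (metis surj_pair)
  have "root P = (i, \<alpha>)" using induced_tree_valid[OF \<pi>(1,4)] k by simp
  then have "\<alpha> = {}" using P by simp
  then show "tree_like_empty_clause_proof \<psi> P"
    unfolding tree_like_empty_clause_proof_def using \<pi> k distinct_preds_tree_like[of \<pi>] by auto
qed

section \<open>Binders\<close>

lemma sub_at_append: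
  "sub_at \<psi> (i @ j) = (case sub_at \<psi> i of None \<Rightarrow> None | Some \<phi> \<Rightarrow> sub_at \<phi> j)"
  by (induction \<psi> i rule: sub_at.induct) auto

lemma indices_prefix: "prefix i j \<Longrightarrow> j \<in> indices \<psi> \<Longrightarrow> i \<in> indices \<psi>"
  by (auto simp: indices_def prefix_def sub_at_append split: option.splits)

lemma finite_indices: "finite (indices \<psi>)"
proof -
  have "finite {i. sub_at \<psi> i \<noteq> None}"
  proof (induction \<psi>)
    case (Clause \<alpha>)
    have "{i. sub_at (Clause \<alpha>) i \<noteq> None} \<subseteq> {[]}"
    proof
      fix i assume "i \<in> {i. sub_at (Clause \<alpha>) i \<noteq> None}"
      then show "i \<in> {[]}" by (cases i) auto
    qed
    then show ?case using finite_subset by blast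
  next
    case (Conj \<phi> \<chi>)
    have "{i. sub_at (Conj \<phi> \<chi>) i \<noteq> None} \<subseteq>
        {[]} \<union> (#) 0 ` {i. sub_at \<phi> i \<noteq> None} \<union> (#) 1 ` {i. sub_at \<chi> i \<noteq> None}"
    proof
      fix i assume "i \<in> {i. sub_at (Conj \<phi> \<chi>) i \<noteq> None}"
      then show "i \<in> {[]} \<union> (#) 0 ` {i. sub_at \<phi> i \<noteq> None} \<union> (#) 1 ` {i. sub_at \<chi> i \<noteq> None}"
        by (cases i) (auto simp: less_Suc_eq split: if_splits)
    qed
    then show ?case using Conj finite_subset by blast
  next
    case (All v \<phi>)
    have "{i. sub_at (All v \<phi>) i \<noteq> None} \<subseteq> {[]} \<union> (#) 0 ` {i. sub_at \<phi> i \<noteq> None}"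
    proof
      fix i assume "i \<in> {i. sub_at (All v \<phi>) i \<noteq> None}"
      then show "i \<in> {[]} \<union> (#) 0 ` {i. sub_at \<phi> i \<noteq> None}" by (cases i) (auto split: if_splits)
    qed
    then show ?case using All finite_subset by blast
  next
    case (Exi v \<phi>)
    have "{i. sub_at (Exi v \<phi>) i \<noteq> None} \<subseteq> {[]} \<union> (#) 0 ` {i. sub_at \<phi> i \<noteq> None}"
    proof
      fix i assume "i \<in> {i. sub_at (Exi v \<phi>) i \<noteq> None}"
      then show "i \<in> {[]} \<union> (#) 0 ` {i. sub_at \<phi> i \<noteq> None}" by (cases i) (auto split: if_splits)
    qed
    then show ?case using Exi finite_subset by blast
  qed
  then show ?thesis by (simp add: indices_def dom_def)
qed

lemma located_var_iff:
  "located_var \<psi> (k, u) \<longleftrightarrow> (\<exists>\<phi>. sub_at \<psi> k = Some (All u \<phi>) \<or> sub_at \<psi> k = Some (Exi u \<phi>))"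
  by (auto simp: located_var_def forall_located_def)

lemma located_var_index: "located_var \<psi> (k, u) \<Longrightarrow> k \<in> indices \<psi>"
  by (auto simp: located_var_iff indices_def)

lemma located_var_unique: "located_var \<psi> (k, u) \<Longrightarrow> located_var \<psi> (k, v) \<Longrightarrow> u = v"
  by (auto simp: located_var_iff)

lemma located_var_child:
  assumes "located_var \<psi> (k, u)"
  shows "k @ [0] \<in> indices \<psi>" "free_at \<psi> k = free_at \<psi> (k @ [0]) - {u}"
  using assms by (auto simp: located_var_iff indices_def sub_at_append free_at_def)

lemma located_var_below:
  assumes "located_var \<psi> (k, u)" "strict_prefix k j" "j \<in> indices \<psi>"
  shows "prefix (k @ [0]) j"
proof -
  obtain c r where j: "j = k @ c # r" using assms(2) by (metis strict_prefixE')
  have "c = 0" using assms(1,3) by (auto simp: j located_var_iff indices_def sub_at_append split: if_splits)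
  then show ?thesis by (simp add: j)
qed

text \<open>Finiteness is not part of the definition of a trace label. A quantifier binds a single
  variable, so different located variables sit at different indices, of which there are finitely
  many.\<close>

lemma finite_located: "(\<And>l. l \<in> S \<Longrightarrow> located_var \<psi> l) \<Longrightarrow> finite S"
proof -
  assume loc: "\<And>l. l \<in> S \<Longrightarrow> located_var \<psi> l"
  have "inj_on fst S"
  proof (rule inj_onI)
    fix l m assume "l \<in> S" "m \<in> S" "fst l = fst m"
    then show "l = m" using loc[of l] loc[of m] located_var_unique by (cases l; cases m) auto
  qed
  moreover have "fst ` S \<subseteq> indices \<psi>"
  proof
    fix k assume "k \<in> fst ` S"
    then obtain u where "(k, u) \<in> S" by auto
    then show "k \<in> indices \<psi>" using loc located_var_index by blast
  qed
  ultimately show ?thesis using finite_indices finite_subset finite_imageD by metis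
qed

lemma follows_snoc:
  assumes "follows \<psi> i (k, u)" "i @ [c] \<in> indices \<psi>" "u \<in> free_at \<psi> (i @ [c])"
  shows "follows \<psi> (i @ [c]) (k, u)"
proof -
  have "strict_prefix i (i @ [c])" by (simp add: strict_prefix_def)
  moreover have "strict_prefix k i" using assms(1) by (simp add: follows_def)
  ultimately have "strict_prefix k (i @ [c])" by (rule prefix_order.less_trans[rotated])
  then show ?thesis using assms by (auto simp: follows_def)
qed

lemma follows_self_child:
  assumes "i @ [c] \<in> indices \<psi>" "u \<in> free_at \<psi> (i @ [c])"
  shows "follows \<psi> (i @ [c]) (i, u)"
proof -
  have "k = i @ [c]" if "strict_prefix i k" "prefix k (i @ [c])" for k
    using that by (metis prefix_snoc prefix_order.less_le_not_le)
  moreover have "strict_prefix i (i @ [c])" by (simp add: strict_prefix_def)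
  ultimately show ?thesis using assms unfolding follows_def prod.case by blast
qed

lemma follows_prefix:
  assumes "follows \<psi> i l" "strict_prefix (fst l) j" "prefix j i"
  shows "follows \<psi> j l"
  using assms indices_prefix[of j i \<psi>] by (auto simp: follows_def split: prod.splits)

lemma follows_free: "follows \<psi> i (k, u) \<Longrightarrow> u \<in> free_at \<psi> i"
  by (auto simp: follows_def)

text \<open>A variable is not free at a location that quantifies it. Two quantifiers of the same
  variable thus never follow each other, and a coherent set of located variables contains each
  variable at most once.\<close>

lemma located_not_follows: "located_var \<psi> (k', u) \<Longrightarrow> \<not> follows \<psi> k' (k, u)"
  using follows_free located_var_child(2) by fastforce

text \<open>Moving up from \<open>i\<close>, \<open>u\<close> stays free until its quantifier is
  reached, and it must be reached because nothing is free at the root.\<close>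

lemma ex_binder:
  assumes "free \<psi> = {}" "i \<in> indices \<psi>" "u \<in> free_at \<psi> i"
  shows "\<exists>k. located_var \<psi> (k, u) \<and> follows \<psi> i (k, u)"
  using assms(2,3)
proof (induction i rule: rev_induct)
  case Nil
  then show ?case using assms(1) by (simp add: free_at_def)
next
  case (snoc c i)
  have i: "i \<in> indices \<psi>" using snoc.prems(1) by (rule indices_prefix[rotated]) simp
  then obtain \<phi> where \<phi>: "sub_at \<psi> i = Some \<phi>" by (auto simp: indices_def)
  show ?case
  proof (cases "located_var \<psi> (i, u)")
    case True
    then show ?thesis using follows_self_child snoc.prems by blast
  next
    case False
    have "c < length (children \<phi>)" "u \<in> free (children \<phi> ! c)"
      using snoc.prems \<phi> by (auto simp: indices_def sub_at_append free_at_def split: if_splits)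
    then have "u \<in> free_at \<psi> i"
      using False \<phi> by (cases \<phi>) (auto simp: free_at_def located_var_iff less_Suc_eq)
    then obtain k where "located_var \<psi> (k, u)" "follows \<psi> i (k, u)" using snoc.IH i by blast
    then show ?thesis using follows_snoc snoc.prems by blast
  qed
qed

text \<open>Both indices are ancestors of \<open>i\<close>, hence comparable, and freeness on the
  path from the upper one down to \<open>i\<close> covers the path to the lower one. Whatever is
  followed by one common index is therefore coherent.\<close>

lemma follows_comparable:
  assumes "follows \<psi> i (k, u)" "follows \<psi> i (k', u')" "located_var \<psi> (k, u)" "located_var \<psi> (k', u')"
    "(k, u) \<noteq> (k', u')"
  shows "follows \<psi> k (k', u') \<or> follows \<psi> k' (k, u)"
proof -
  have p: "prefix k i" "prefix k' i" using assms(1,2) by (auto simp: follows_def)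
  have "k \<noteq> k'" using assms(3-5) located_var_unique by blast
  then have "strict_prefix k k' \<or> strict_prefix k' k"
    using p prefix_same_cases strict_prefixI by metis
  then show ?thesis using follows_prefix[OF assms(1), of k'] follows_prefix[OF assms(2), of k] p by auto
qed

lemma coherent_if_followed:
  assumes "\<And>l. l \<in> S \<Longrightarrow> located_var \<psi> l \<and> follows \<psi> i l"
  shows "coherent \<psi> S"
  unfolding coherent_def using assms follows_comparable by (metis surj_pair fst_conv)

text \<open>The innermost quantifier of \<open>u\<close> strictly above \<open>i\<close>, written as
  a search through the ancestors rather than as a description so that a program can copy it. A
  quantifier at \<open>i\<close> itself does not count, because it binds only below.\<close>

definition binder_of :: "qcbf \<Rightarrow> index \<Rightarrow> nat \<Rightarrow> index" where
  "binder_of \<psi> i u = last (filter (\<lambda>k. k \<noteq> i \<and> located_var \<psi> (k, u)) (prefixes i))"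

text \<open>A quantifier of \<open>u\<close> strictly between \<open>k\<close> and \<open>i\<close>
  would make \<open>u\<close> non-free there, contrary to \<open>follows\<close>; so
  \<open>k\<close> is the last candidate.\<close>

lemma binder_eqI:
  assumes "located_var \<psi> (k, u)" "follows \<psi> i (k, u)"
  shows "binder_of \<psi> i u = k"
proof -
  let ?P = "\<lambda>k. k \<noteq> i \<and> located_var \<psi> (k, u)"
  obtain c r where i: "i = k @ c # r"
    using assms(2) by (auto simp: follows_def elim: strict_prefixE')
  have split: "prefixes i = prefixes k @ map ((@) k) (tl (prefixes (c # r)))"
    unfolding i by (rule prefixes_append)
  have "filter ?P (map ((@) k) (tl (prefixes (c # r)))) = []"
  proof (rule ccontr)
    assume "\<not> ?thesis"
    then obtain j where j: "j \<in> set (prefixes r)" "?P (k @ c # j)"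
      by (auto simp: filter_empty_conv)
    have "strict_prefix k (k @ c # j)" "prefix (k @ c # j) i" using j by (auto simp: i strict_prefix_def)
    then have "follows \<psi> (k @ c # j) (k, u)" using follows_prefix[OF assms(2)] by simp
    then show False using j located_not_follows by blast
  qed
  moreover obtain js where "prefixes k = js @ [k]"
    by (cases k rule: rev_cases) (auto simp: prefixes_snoc)
  ultimately show ?thesis using assms(1) i unfolding binder_of_def split by simp
qed

lemma binder_props:
  assumes "free \<psi> = {}" "i \<in> indices \<psi>" "u \<in> free_at \<psi> i"
  shows "located_var \<psi> (binder_of \<psi> i u, u)" "follows \<psi> i (binder_of \<psi> i u, u)"
  using ex_binder[OF assms] binder_eqI by metis+

text \<open>Freeness of \<open>u\<close> at both ends means that the step does not cross the
  quantifier of \<open>u\<close>: the binder seen from the parent is still followed by the child,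
  and binders are unique. This is why flow steps leave labels unchanged.\<close>

lemma binder_parent:
  assumes "free \<psi> = {}" "is_parent \<psi> i j" "u \<in> free_at \<psi> i" "u \<in> free_at \<psi> j"
  shows "binder_of \<psi> i u = binder_of \<psi> j u"
proof -
  obtain c where j: "j = i @ [c]" "j \<in> indices \<psi>" using assms(2) by (auto simp: is_parent_def)
  then have "i \<in> indices \<psi>" using indices_prefix[of i j] by simp
  then have "located_var \<psi> (binder_of \<psi> i u, u)" "follows \<psi> i (binder_of \<psi> i u, u)"
    using binder_props assms(1,3) by auto
  then show ?thesis using follows_snoc j assms(4) binder_eqI by metis
qed

section \<open>Clauses and assignments\<close>

definition asg :: "lit set \<Rightarrow> assignment" where
  "asg \<alpha> = (\<lambda>u. if Pos u \<in> \<alpha> then Some False else if Neg u \<in> \<alpha> then Some True else None)"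

definition clause_of :: "assignment \<Rightarrow> lit set" where
  "clause_of a = {L. lit_false a L}"

lemma in_cvars_iff: "u \<in> cvars \<alpha> \<longleftrightarrow> Pos u \<in> \<alpha> \<or> Neg u \<in> \<alpha>"
proof
  assume "u \<in> cvars \<alpha>"
  then obtain L where "L \<in> \<alpha>" "var_of L = u" by (auto simp: cvars_def)
  then show "Pos u \<in> \<alpha> \<or> Neg u \<in> \<alpha>" by (cases L) auto
next
  assume "Pos u \<in> \<alpha> \<or> Neg u \<in> \<alpha>"
  then show "u \<in> cvars \<alpha>" unfolding cvars_def by (metis image_eqI var_of.simps)
qed

lemma is_clause_iff: "is_clause \<alpha> \<longleftrightarrow> finite \<alpha> \<and> (\<forall>u. Pos u \<in> \<alpha> \<longrightarrow> Neg u \<notin> \<alpha>)"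
proof -
  have "inj_on var_of \<alpha> \<longleftrightarrow> (\<forall>u. Pos u \<in> \<alpha> \<longrightarrow> Neg u \<notin> \<alpha>)"
  proof
    assume "inj_on var_of \<alpha>"
    then show "\<forall>u. Pos u \<in> \<alpha> \<longrightarrow> Neg u \<notin> \<alpha>"
      by (metis inj_onD lit.distinct(1) var_of.simps)
  next
    assume *: "\<forall>u. Pos u \<in> \<alpha> \<longrightarrow> Neg u \<notin> \<alpha>"
    show "inj_on var_of \<alpha>"
    proof (rule inj_onI)
      fix L M assume "L \<in> \<alpha>" "M \<in> \<alpha>" "var_of L = var_of M"
      then show "L = M" using * by (cases L; cases M) auto
    qed
  qed
  then show ?thesis by (simp add: is_clause_def)
qed

lemma cvars_simps [simp]:
  "cvars {} = {}" "cvars (insert L \<alpha>) = insert (var_of L) (cvars \<alpha>)"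
  "cvars (\<alpha> \<union> \<beta>) = cvars \<alpha> \<union> cvars \<beta>"
  by (auto simp: cvars_def)

lemma is_clause_subset: "is_clause \<alpha> \<Longrightarrow> \<beta> \<subseteq> \<alpha> \<Longrightarrow> is_clause \<beta>"
  by (auto simp: is_clause_iff intro: finite_subset)

lemma dom_asg: "dom (asg \<alpha>) = cvars \<alpha>"
  by (auto simp: asg_def in_cvars_iff dom_def)

lemma clause_of_asg:
  assumes "is_clause \<alpha>"
  shows "clause_of (asg \<alpha>) = \<alpha>"
proof -
  have "lit_false (asg \<alpha>) L \<longleftrightarrow> L \<in> \<alpha>" for L
    using assms by (cases L) (auto simp: asg_def is_clause_iff)
  then show ?thesis by (simp add: clause_of_def)
qed

lemma asg_clause_of: "asg (clause_of a) = a"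
proof
  fix u
  show "asg (clause_of a) u = a u"
    by (cases "a u") (auto simp: asg_def clause_of_def)
qed

lemma cvars_clause_of: "cvars (clause_of a) = dom a"
  using dom_asg[of "clause_of a"] by (simp add: asg_clause_of)

lemma falsified_asg: "is_clause \<alpha> \<Longrightarrow> falsified \<alpha> (asg \<alpha>)"
  using clause_of_asg[of \<alpha>] by (auto simp: falsified_def dom_asg clause_of_def)

text \<open>A literal false under \<open>a\<close> is determined by its variable, so a falsified
  clause on exactly the variables of \<open>a\<close> contains every literal that \<open>a\<close>
  makes false.\<close>

lemma falsified_clause_of:
  assumes "falsified \<alpha> a" "cvars \<alpha> = dom a"
  shows "\<alpha> = clause_of a"
proof
  show "\<alpha> \<subseteq> clause_of a" using assms(1) by (auto simp: falsified_def clause_of_def)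
  show "clause_of a \<subseteq> \<alpha>"
  proof
    fix L assume L: "L \<in> clause_of a"
    then have "var_of L \<in> cvars \<alpha>" using assms(2) cvars_clause_of by (metis cvars_def imageI)
    then obtain M where M: "M \<in> \<alpha>" "var_of M = var_of L" by (auto simp: cvars_def)
    then have "lit_false a M" using assms(1) by (auto simp: falsified_def)
    then have "M = L" using L M(2) by (cases L; cases M) (auto simp: clause_of_def)
    then show "L \<in> \<alpha>" using M by simp
  qed
qed

text \<open>Since \<open>\<gamma>\<close> has at most one literal on each variable, the variables of
  \<open>\<delta>\<close> already select the literals of \<open>\<delta>\<close> from
  \<open>\<gamma>\<close>.\<close>

lemma asg_restrict:
  assumes "is_clause \<gamma>" "\<delta> \<subseteq> \<gamma>"
  shows "asg \<gamma> |` cvars \<delta> = asg \<delta>"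
proof
  fix u
  show "(asg \<gamma> |` cvars \<delta>) u = asg \<delta> u"
    using assms by (auto simp: restrict_map_def asg_def in_cvars_iff is_clause_iff)
qed

lemma asg_insert:
  assumes "u \<notin> cvars \<delta>"
  shows "asg (insert (Pos u) \<delta>) = (asg \<delta>)(u \<mapsto> False)" "asg (insert (Neg u) \<delta>) = (asg \<delta>)(u \<mapsto> True)"
  using assms by (auto simp: asg_def in_cvars_iff fun_eq_iff)

section \<open>From proofs to traces\<close>

definition label :: "qcbf \<Rightarrow> judgement \<Rightarrow> label" where
  "label \<psi> J = ((\<lambda>u. (binder_of \<psi> (fst J) u, u)) ` cvars (snd J), asg (snd J))"

text \<open>The kind of step is read off from the clauses. A single premise contained in the
  conclusion is a flow step or the removal of an absent variable, and yields no node. If the first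
  premise loses a negative literal, it belongs to the value 1 of the resolved variable, and the
  subtrees are swapped because a binary node expects the value 0 first.\<close>

definition trace_step :: "qcbf \<Rightarrow> judgement \<Rightarrow> judgement list \<Rightarrow> label tree list \<Rightarrow> label tree" where
  "trace_step \<psi> J Js rs =
     (if length Js = 1 \<and> snd (hd Js) \<subseteq> snd J then hd rs
      else if 2 \<le> length Js \<and> (\<exists>u. Neg u \<in> snd (hd Js) - snd J) then Node (label \<psi> J) (rev rs)
      else Node (label \<psi> J) rs)"

fun trace_of :: "qcbf \<Rightarrow> judgement tree \<Rightarrow> label tree" where
  "trace_of \<psi> (Node J ts) = trace_step \<psi> J (map root ts) (map (trace_of \<psi>) ts)"

lemma lvars_label: "lvars (fst (label \<psi> J)) = cvars (snd J)"
  by (force simp: lvars_def label_def)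

lemma label_followed:
  assumes "free \<psi> = {}" "is_judgement \<psi> (i, \<alpha>)" "l \<in> fst (label \<psi> (i, \<alpha>))"
  shows "located_var \<psi> l \<and> follows \<psi> i l"
  using assms binder_props[OF assms(1)] by (auto simp: is_judgement_def label_def)

lemma trace_label_label:
  assumes "free \<psi> = {}" "is_judgement \<psi> J"
  shows "trace_label \<psi> (label \<psi> J)"
proof -
  obtain i \<alpha> where J: "J = (i, \<alpha>)" by fastforce
  have *: "\<And>l. l \<in> fst (label \<psi> (i, \<alpha>)) \<Longrightarrow> located_var \<psi> l \<and> follows \<psi> i l"
    using label_followed assms J by blast
  have "dom (snd (label \<psi> J)) = lvars (fst (label \<psi> J))"
    unfolding lvars_label by (simp add: label_def dom_asg)
  then show ?thesis
    using * coherent_if_followed[OF *] unfolding trace_label_def by (simp add: J case_prod_beta)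
qed

lemma follows_set_label:
  assumes "free \<psi> = {}" "is_judgement \<psi> (i, \<alpha>)"
  shows "follows_set \<psi> i (fst (label \<psi> (i, \<alpha>)))"
  using label_followed[OF assms] assms(2) by (auto simp: follows_set_def is_judgement_def)

lemma label_parent:
  assumes "free \<psi> = {}" "is_parent \<psi> i j" "is_judgement \<psi> (i, \<alpha>)" "cvars \<alpha> \<subseteq> free_at \<psi> j"
  shows "label \<psi> (i, \<alpha>) = label \<psi> (j, \<alpha>)"
proof -
  have "binder_of \<psi> i u = binder_of \<psi> j u" if "u \<in> cvars \<alpha>" for u
    using that assms(3,4) by (intro binder_parent[OF assms(1,2)]) (auto simp: is_judgement_def)
  then show ?thesis by (simp add: label_def)
qed

text \<open>\<open>\<delta>0\<close> and \<open>\<delta>1\<close> are what the premises contribute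
  to the resolvent, and their binders provide the subsets \<open>S0\<close> and \<open>S1\<close>.
  Coherence with the new located variable holds because \<open>i\<close> follows all of these
  binders.\<close>

lemma binary_node_label:
  assumes "free \<psi> = {}" "is_judgement \<psi> (i, \<delta>0 \<union> \<delta>1)"
    and j0: "is_judgement \<psi> (i, insert (Pos u) \<delta>0)"
    and u: "u \<notin> cvars \<delta>0" "u \<notin> cvars \<delta>1"
  shows "binary_node \<psi> (label \<psi> (i, \<delta>0 \<union> \<delta>1)) (label \<psi> (i, insert (Pos u) \<delta>0))
     (label \<psi> (i, insert (Neg u) \<delta>1))"
proof -
  let ?\<gamma> = "\<delta>0 \<union> \<delta>1"
  let ?b = "binder_of \<psi> i"
  have cl: "is_clause ?\<gamma>" using assms(2) by (simp add: is_judgement_def)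
  have ub: "located_var \<psi> (?b u, u) \<and> follows \<psi> i (?b u, u)"
    using binder_props[OF assms(1)] j0 by (auto simp: is_judgement_def)
  have S: "fst (label \<psi> (i, \<delta>)) = (\<lambda>u. (?b u, u)) ` cvars \<delta>" for \<delta> by (simp add: label_def)
  have coh: "coherent \<psi> (fst (label \<psi> (i, ?\<gamma>)) \<union> {(?b u, u)})"
    using label_followed[OF assms(1,2)] ub by (intro coherent_if_followed) auto
  have lv: "lvars ((\<lambda>u. (?b u, u)) ` cvars \<delta>) = cvars \<delta>" for \<delta>
    using lvars_label[of \<psi> "(i, \<delta>)"] by (simp add: S)
  show ?thesis
    unfolding binary_node_def label_def fst_conv snd_conv prod.case
  proof (intro exI conjI)
    show "located_var \<psi> (?b u, u)" using ub by simp
    show "(?b u, u) \<notin> (\<lambda>u. (?b u, u)) ` cvars ?\<gamma>" using u by auto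
    show "coherent \<psi> ((\<lambda>u. (?b u, u)) ` cvars ?\<gamma> \<union> {(?b u, u)})" using coh by (simp add: S)
    show "(\<lambda>u. (?b u, u)) ` cvars \<delta>0 \<subseteq> (\<lambda>u. (?b u, u)) ` cvars ?\<gamma>" by auto
    show "(\<lambda>u. (?b u, u)) ` cvars \<delta>1 \<subseteq> (\<lambda>u. (?b u, u)) ` cvars ?\<gamma>" by auto
    show "(\<lambda>u. (?b u, u)) ` cvars \<delta>0 \<union> (\<lambda>u. (?b u, u)) ` cvars \<delta>1 = (\<lambda>u. (?b u, u)) ` cvars ?\<gamma>"
      by auto
    show "((\<lambda>u. (?b u, u)) ` cvars (insert (Pos u) \<delta>0), asg (insert (Pos u) \<delta>0)) =
      ((\<lambda>u. (?b u, u)) ` cvars \<delta>0 \<union> {(?b u, u)},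
       (asg ?\<gamma> |` lvars ((\<lambda>u. (?b u, u)) ` cvars \<delta>0))(u \<mapsto> False))"
      using asg_restrict[OF cl, of \<delta>0] asg_insert[OF u(1)] by (simp add: lv)
    show "((\<lambda>u. (?b u, u)) ` cvars (insert (Neg u) \<delta>1), asg (insert (Neg u) \<delta>1)) =
      ((\<lambda>u. (?b u, u)) ` cvars \<delta>1 \<union> {(?b u, u)},
       (asg ?\<gamma> |` lvars ((\<lambda>u. (?b u, u)) ` cvars \<delta>1))(u \<mapsto> True))"
      using asg_restrict[OF cl, of \<delta>1] asg_insert[OF u(2)] by (simp add: lv)
  qed
qed

lemma trace_of_correct:
  assumes "free \<psi> = {}"
  shows "valid \<psi> P \<Longrightarrow> is_trace \<psi> (trace_of \<psi> P) \<and> root (trace_of \<psi> P) = label \<psi> (root P)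
     \<and> num_nodes (trace_of \<psi> P) = num_nonflow \<psi> P"
proof (induction P)
  case (Node J ts)
  have J: "is_judgement \<psi> J" and d: "derived \<psi> J (map root ts)" using Node.prems by auto
  have IH: "is_trace \<psi> (trace_of \<psi> t)" "root (trace_of \<psi> t) = label \<psi> (root t)"
    "num_nodes (trace_of \<psi> t) = num_nonflow \<psi> t" "is_judgement \<psi> (root t)" if "t \<in> set ts" for t
    using Node that valid_root by auto
  have tl: "trace_label \<psi> (label \<psi> J)" by (rule trace_label_label[OF assms J])
  \<comment> \<open>This serves both directions of flow and, in the last case, the removal of a
    variable that does not occur.\<close>
  have flow: ?case if ts: "ts = [t]" and Jt: "J = (i, \<alpha>)" "root t = (j, \<alpha>)"
      "is_parent \<psi> i j \<or> is_parent \<psi> j i" for t i j \<alpha>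
  proof -
    have "label \<psi> J = label \<psi> (root t)"
      using Jt J IH(4)[of t] label_parent[OF assms, of i j \<alpha>] label_parent[OF assms, of j i \<alpha>]
      by (auto simp: ts is_judgement_def)
    moreover have "upward_flow \<psi> J (map root ts) \<or> downward_flow \<psi> J (map root ts)"
      using Jt by (auto simp: ts upward_flow_def downward_flow_def)
    ultimately show ?thesis using IH[of t] Jt by (simp add: ts trace_step_def)
  qed
  from d consider "clause_rule \<psi> J (map root ts)" | "resolve_rule \<psi> J (map root ts)"
    | "upward_flow \<psi> J (map root ts)" | "forall_removal \<psi> J (map root ts)"
    | "downward_flow \<psi> J (map root ts)"
    unfolding derived_def by blast
  then show ?case
  proof cases
    case 1
    then obtain i \<alpha> where i: "J = (i, \<alpha>)" "ts = []" "sub_at \<psi> i = Some (Clause \<alpha>)"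
      by (auto simp: clause_rule_def)
    have "is_clause \<alpha>" using J i by (simp add: is_judgement_def)
    then have "leaf_node \<psi> (label \<psi> J)"
      using follows_set_label[OF assms, of i \<alpha>] J i falsified_asg[of \<alpha>] lvars_label[of \<psi> J]
      unfolding leaf_node_def by (auto simp: label_def)
    then show ?thesis using tl i
      by (simp add: trace_step_def upward_flow_def downward_flow_def)
  next
    case 2
    then obtain i \<alpha> \<beta> \<gamma> where i: "J = (i, \<gamma>)" "map root ts = [(i, \<alpha>), (i, \<beta>)]" "resolvent \<alpha> \<beta> \<gamma>"
      by (auto simp: resolve_rule_def)
    obtain t0 t1 where ts: "ts = [t0, t1]" "root t0 = (i, \<alpha>)" "root t1 = (i, \<beta>)"
      using i(2) by (auto simp: map_eq_Cons_conv)
    have cl: "is_clause \<alpha>" "is_clause \<beta>"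
      using IH(4)[of t0] IH(4)[of t1] ts by (auto simp: is_judgement_def)
    have nf: "\<not> upward_flow \<psi> J (map root ts)" "\<not> downward_flow \<psi> J (map root ts)"
      using ts by (auto simp: upward_flow_def downward_flow_def)
    obtain L where L: "L \<in> \<alpha>" "compl L \<in> \<beta>" "\<gamma> = (\<alpha> - {L}) \<union> (\<beta> - {compl L})"
      using i(3) by (auto simp: resolvent_def)
    show ?thesis
    proof (cases L)
      case (Pos u)
      have eq: "insert (Pos u) (\<alpha> - {Pos u}) = \<alpha>" "insert (Neg u) (\<beta> - {Neg u}) = \<beta>"
        using L Pos by auto
      have "u \<notin> cvars (\<alpha> - {Pos u})" "u \<notin> cvars (\<beta> - {Neg u})"
        using cl L Pos by (auto simp: in_cvars_iff is_clause_iff)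
      then have "binary_node \<psi> (label \<psi> J) (label \<psi> (i, \<alpha>)) (label \<psi> (i, \<beta>))"
        using binary_node_label[OF assms, of i "\<alpha> - {Pos u}" "\<beta> - {Neg u}" u]
          J IH(4)[of t0] ts L i Pos unfolding eq by simp
      \<comment> \<open>Only the resolved literal of \<open>\<alpha>\<close> can be missing from the
        resolvent, and here it is positive.\<close>
      moreover have "\<not> (\<exists>v. Neg v \<in> \<alpha> - \<gamma>)" using L Pos by auto
      ultimately show ?thesis using tl IH[of t0] IH[of t1] nf ts i by (auto simp: trace_step_def)
    next
      case (Neg u)
      have eq: "insert (Neg u) (\<alpha> - {Neg u}) = \<alpha>" "insert (Pos u) (\<beta> - {Pos u}) = \<beta>"
        using L Neg by auto
      have u: "u \<notin> cvars (\<alpha> - {Neg u})" "u \<notin> cvars (\<beta> - {Pos u})"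
        using cl L Neg by (auto simp: in_cvars_iff is_clause_iff)
      then have "binary_node \<psi> (label \<psi> J) (label \<psi> (i, \<beta>)) (label \<psi> (i, \<alpha>))"
        using binary_node_label[OF assms, of i "\<beta> - {Pos u}" "\<alpha> - {Neg u}" u]
          J IH(4)[of t1] ts L i Neg unfolding eq by (simp add: Un_commute)
      \<comment> \<open>\<open>Neg u\<close> cannot return from the other premise, which contains
        \<open>Pos u\<close> and is a clause.\<close>
      moreover have "Neg u \<in> \<alpha> - \<gamma>" using L Neg u by (auto simp: in_cvars_iff)
      then have "\<exists>v. Neg v \<in> \<alpha> - \<gamma>" by blast
      ultimately show ?thesis using tl IH[of t0] IH[of t1] nf ts i
        by (simp add: trace_step_def add.commute)
    qed
  next
    case 3
    then obtain i j \<alpha> where *: "J = (i, \<alpha>)" "map root ts = [(j, \<alpha>)]" "is_parent \<psi> i j"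
      by (auto simp: upward_flow_def)
    then obtain t where "ts = [t]" "root t = (j, \<alpha>)" by (auto simp: map_eq_Cons_conv)
    then show ?thesis using flow * by blast
  next
    case 5
    then obtain i j \<alpha> where *: "J = (j, \<alpha>)" "map root ts = [(i, \<alpha>)]" "is_parent \<psi> i j"
      by (auto simp: downward_flow_def)
    then obtain t where "ts = [t]" "root t = (i, \<alpha>)" by (auto simp: map_eq_Cons_conv)
    then show ?thesis using flow * by blast
  next
    case 4
    then obtain i j y \<alpha> \<phi> where *: "J = (i, \<alpha> - {Pos y, Neg y})" "map root ts = [(j, \<alpha>)]"
      "is_parent \<psi> i j" "sub_at \<psi> i = Some (All y \<phi>)"
      by (auto simp: forall_removal_def)
    then obtain t where t: "ts = [t]" "root t = (j, \<alpha>)" by (auto simp: map_eq_Cons_conv)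
    show ?thesis
    proof (cases "y \<in> cvars \<alpha>")
      case False
      then have "J = (i, \<alpha>)" using * by (auto simp: in_cvars_iff)
      then show ?thesis using flow * t by blast
    next
      case True
      let ?\<alpha> = "\<alpha> - {Pos y, Neg y}"
      have jt: "is_judgement \<psi> (j, \<alpha>)" using IH(4)[of t] t by simp
      have ji: "is_judgement \<psi> (i, ?\<alpha>)" using J * by simp
      have cv: "cvars \<alpha> = insert y (cvars ?\<alpha>)" "y \<notin> cvars ?\<alpha>"
        using True by (auto simp: in_cvars_iff)
      have "cvars ?\<alpha> \<subseteq> free_at \<psi> j" using jt cv by (auto simp: is_judgement_def)
      then have lab: "label \<psi> (i, ?\<alpha>) = label \<psi> (j, ?\<alpha>)" using label_parent[OF assms] * ji by blast
      have loc: "forall_located \<psi> (i, y)" using * by (auto simp: forall_located_def)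
      have fo: "follows \<psi> j (i, y)"
        using follows_self_child *(3) jt cv by (auto simp: is_parent_def is_judgement_def)
      \<comment> \<open>Seen from the child, \<open>y\<close> is bound by the quantifier being
        removed, so the label of the premise extends that of the conclusion by exactly
        \<open>(i, y)\<close>.\<close>
      have bi: "binder_of \<psi> j y = i"
        using loc fo by (intro binder_eqI) (auto simp: located_var_def)
      have "is_clause \<alpha>" using jt by (simp add: is_judgement_def)
      then have "(\<alpha> = insert (Pos y) ?\<alpha>) \<or> (\<alpha> = insert (Neg y) ?\<alpha>)"
        using True by (auto simp: is_clause_iff in_cvars_iff)
      then obtain b where b: "asg \<alpha> = (asg ?\<alpha>)(y \<mapsto> b)" using asg_insert[OF cv(2)] by metis
      have "unary_node \<psi> (label \<psi> J) (label \<psi> (j, \<alpha>))"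
        unfolding unary_node_def *(1)
        using loc follows_set_label[OF assms ji] b cv bi lab
        by (auto simp: label_def intro!: exI[of _ i] exI[of _ y] exI[of _ b])
      moreover have "\<not> \<alpha> \<subseteq> ?\<alpha>" using True by (auto simp: in_cvars_iff)
      moreover have "\<not> upward_flow \<psi> J (map root ts)" "\<not> downward_flow \<psi> J (map root ts)"
        using calculation(2) * by (auto simp: upward_flow_def downward_flow_def)
      ultimately show ?thesis using tl IH[of t] t * by (simp add: trace_step_def)
    qed
  qed
qed


section \<open>From traces to proofs\<close>

text \<open>The proof for a trace node labelled \<open>(S, a)\<close> ends at the highest index that can follow
  \<open>S\<close>: the child of its innermost quantifier.\<close>

definition loc :: "located set \<Rightarrow> index" where
  "loc S = (if S = {} then [] else (THE k. k \<in> fst ` S \<and> (\<forall>k' \<in> fst ` S. prefix k' k)) @ [0])"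

text \<open>The starting index is omitted and the index reached last comes first, because
  \<open>wrap\<close> makes the head of its list the root. The same holds for
  \<open>downs\<close>.\<close>

definition ups :: "index \<Rightarrow> index \<Rightarrow> index list" where
  "ups i t = filter (\<lambda>k. prefix t k \<and> k \<noteq> i) (prefixes i)"

definition downs :: "index \<Rightarrow> index \<Rightarrow> index list" where
  "downs t j = rev (filter (\<lambda>k. prefix t k \<and> k \<noteq> t) (prefixes j))"

definition wrap :: "index list \<Rightarrow> lit set \<Rightarrow> judgement tree \<Rightarrow> judgement tree" where
  "wrap ks \<alpha> Q = foldr (\<lambda>k q. Node (k, \<alpha>) [q]) ks Q"

fun clause_paths :: "qcbf \<Rightarrow> index list" where
  "clause_paths (Clause \<alpha>) = [[]]"
| "clause_paths (Conj \<phi> \<chi>) = map ((#) 0) (clause_paths \<phi>) @ map ((#) 1) (clause_paths \<chi>)"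
| "clause_paths (All v \<phi>) = map ((#) 0) (clause_paths \<phi>)"
| "clause_paths (Exi v \<phi>) = map ((#) 0) (clause_paths \<phi>)"

text \<open>A trace leaf does not record the index that justifies it, so the index is recovered by
  searching the clauses of the formula.\<close>

definition leaf_index :: "qcbf \<Rightarrow> label \<Rightarrow> index" where
  "leaf_index \<psi> L =
     hd (filter (\<lambda>i. \<exists>\<alpha>. sub_at \<psi> i = Some (Clause \<alpha>) \<and> label \<psi> (i, \<alpha>) = L) (clause_paths \<psi>))"

text \<open>The quantifier of a unary node is recovered as the only element by which the child's
  label grows. For a binary node the union of the children's sets is \<open>S\<close> together with
  the new located variable; resolution happens just below the innermost of these quantifiers, and
  both premises flow down to it.\<close>

definition proof_step :: "qcbf \<Rightarrow> label \<Rightarrow> label list \<Rightarrow> judgement tree list \<Rightarrow> judgement tree" where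
  "proof_step \<psi> L Ls rs = (let t = loc (fst L); \<alpha> = clause_of (snd L) in
     if Ls = [] then let i = leaf_index \<psi> L in wrap (ups i t) \<alpha> (Node (i, \<alpha>) [])
     else if length Ls = 1 then
       let i = fst (THE l. l \<in> fst (hd Ls) - fst L) in wrap (ups i t) \<alpha> (Node (i, \<alpha>) rs)
     else let L0 = Ls ! 0; L1 = Ls ! 1; i = loc (fst L0 \<union> fst L1) in
       wrap (ups i t) \<alpha> (Node (i, \<alpha>)
         [wrap (downs (loc (fst L0)) i) (clause_of (snd L0)) (rs ! 0),
          wrap (downs (loc (fst L1)) i) (clause_of (snd L1)) (rs ! 1)]))"

fun proof_of :: "qcbf \<Rightarrow> label tree \<Rightarrow> judgement tree" where
  "proof_of \<psi> (Node L ts) = proof_step \<psi> L (map root ts) (map (proof_of \<psi>) ts)"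

lemma ups_refl: "ups t t = []"
  by (auto simp: ups_def filter_empty_conv prefix_order.antisym)

lemma downs_refl: "downs t t = []"
  by (auto simp: downs_def filter_empty_conv prefix_order.antisym)

lemma ups_snoc:
  assumes "prefix t i"
  shows "ups (i @ [c]) t = ups i t @ [i]"
proof -
  obtain js where js: "prefixes i = js @ [i]" by (cases i rule: rev_cases) auto
  have ne: "k \<noteq> i" if "k \<in> set js" for k
    using distinct_prefixes[of i] that unfolding js by auto
  have "k \<noteq> i @ [c]" if "k \<in> set (prefixes i)" for k
    using that by (auto dest: prefix_length_le)
  then have "ups (i @ [c]) t = filter (prefix t) (prefixes i)"
    unfolding ups_def by (auto intro: filter_cong)
  moreover have "ups i t = filter (prefix t) js"
    unfolding ups_def js using ne by (auto intro: filter_cong)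
  ultimately show ?thesis using assms by (simp add: js)
qed

lemma downs_snoc:
  assumes "prefix t j"
  shows "downs t (j @ [c]) = (j @ [c]) # downs t j"
  using assms prefix_length_le[OF assms] by (auto simp: downs_def)

lemma wrap_up:
  assumes "valid \<psi> Q" "root Q = (t @ d, \<alpha>)"
    "\<And>k. prefix t k \<Longrightarrow> prefix k (t @ d) \<Longrightarrow> cvars \<alpha> \<subseteq> free_at \<psi> k"
  shows "valid \<psi> (wrap (ups (t @ d) t) \<alpha> Q) \<and> root (wrap (ups (t @ d) t) \<alpha> Q) = (t, \<alpha>)
    \<and> num_nonflow \<psi> (wrap (ups (t @ d) t) \<alpha> Q) = num_nonflow \<psi> Q"
  using assms
proof (induction d arbitrary: Q rule: rev_induct)
  case Nil
  then show ?case by (simp add: ups_refl wrap_def)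
next
  case (snoc c d)
  let ?Q = "Node (t @ d, \<alpha>) [Q]"
  have j: "is_judgement \<psi> (t @ d @ [c], \<alpha>)" using valid_root[OF snoc.prems(1)] snoc.prems(2) by simp
  then have p: "is_parent \<psi> (t @ d) (t @ d @ [c])" by (simp add: is_parent_def is_judgement_def)
  then have up: "upward_flow \<psi> (t @ d, \<alpha>) [root Q]" by (simp add: upward_flow_def snoc.prems(2))
  have "t @ d \<in> indices \<psi>"
    using j indices_prefix[of "t @ d" "t @ d @ [c]"] by (simp add: is_judgement_def)
  then have "is_judgement \<psi> (t @ d, \<alpha>)"
    using j snoc.prems(3)[of "t @ d"] by (simp add: is_judgement_def)
  then have "valid \<psi> ?Q" using snoc.prems(1) up by (simp add: derived_def)
  moreover have "num_nonflow \<psi> ?Q = num_nonflow \<psi> Q" using up by simp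
  moreover have "cvars \<alpha> \<subseteq> free_at \<psi> k" if "prefix t k" "prefix k (t @ d)" for k
    using snoc.prems(3)[OF that(1)] that(2) prefix_order.trans[of k "t @ d" "t @ d @ [c]"] by simp
  ultimately have "valid \<psi> (wrap (ups (t @ d) t) \<alpha> ?Q) \<and> root (wrap (ups (t @ d) t) \<alpha> ?Q) = (t, \<alpha>)
    \<and> num_nonflow \<psi> (wrap (ups (t @ d) t) \<alpha> ?Q) = num_nonflow \<psi> Q"
    using snoc.IH[of ?Q] by simp
  moreover have "wrap (ups (t @ d @ [c]) t) \<alpha> Q = wrap (ups (t @ d) t) \<alpha> ?Q"
    using ups_snoc[of t "t @ d" c] by (simp add: wrap_def)
  ultimately show ?case by simp
qed

lemma wrap_down:
  assumes "valid \<psi> Q" "root Q = (t, \<alpha>)" "t @ d \<in> indices \<psi>"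
    "\<And>k. prefix t k \<Longrightarrow> prefix k (t @ d) \<Longrightarrow> cvars \<alpha> \<subseteq> free_at \<psi> k"
  shows "valid \<psi> (wrap (downs t (t @ d)) \<alpha> Q) \<and> root (wrap (downs t (t @ d)) \<alpha> Q) = (t @ d, \<alpha>)
    \<and> num_nonflow \<psi> (wrap (downs t (t @ d)) \<alpha> Q) = num_nonflow \<psi> Q"
  using assms
proof (induction d rule: rev_induct)
  case Nil
  then show ?case by (simp add: downs_refl wrap_def)
next
  case (snoc c d)
  let ?W = "wrap (downs t (t @ d)) \<alpha> Q"
  have "t @ d \<in> indices \<psi>" using snoc.prems(3) indices_prefix[of "t @ d" "t @ d @ [c]"] by simp
  moreover have "cvars \<alpha> \<subseteq> free_at \<psi> k" if "prefix t k" "prefix k (t @ d)" for k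
    using snoc.prems(4)[OF that(1)] that(2) prefix_order.trans[of k "t @ d" "t @ d @ [c]"] by simp
  ultimately have IH: "valid \<psi> ?W" "root ?W = (t @ d, \<alpha>)" "num_nonflow \<psi> ?W = num_nonflow \<psi> Q"
    using snoc.IH snoc.prems(1,2) by auto
  have eq: "wrap (downs t (t @ d @ [c])) \<alpha> Q = Node (t @ d @ [c], \<alpha>) [?W]"
    using downs_snoc[of t "t @ d" c] by (simp add: wrap_def)
  have "downward_flow \<psi> (t @ d @ [c], \<alpha>) [root ?W]"
    using snoc.prems(3) by (simp add: IH downward_flow_def is_parent_def)
  moreover have "is_judgement \<psi> (t @ d @ [c], \<alpha>)"
    using valid_root[OF IH(1)] IH(2) snoc.prems(3) snoc.prems(4)[of "t @ d @ [c]"]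
    by (simp add: is_judgement_def)
  ultimately show ?case using IH unfolding eq by (simp add: derived_def)
qed

text \<open>An element of greatest depth works: coherence makes it comparable with every other
  element, and an element following it would lie deeper.\<close>

lemma loc_max:
  assumes "\<And>l. l \<in> S \<Longrightarrow> located_var \<psi> l" "coherent \<psi> S" "S \<noteq> {}"
  obtains k u where "(k, u) \<in> S" "loc S = k @ [0]" "\<And>l. l \<in> S \<Longrightarrow> l \<noteq> (k, u) \<Longrightarrow> follows \<psi> k l"
proof -
  have "finite S" using assms(1) by (rule finite_located)
  let ?len = "\<lambda>l::located. length (fst l)"
  have "Max (?len ` S) \<in> ?len ` S" using \<open>finite S\<close> assms(3) by simp
  then obtain m where m: "m \<in> S" "Max (?len ` S) = ?len m" by (rule imageE) simp
  have mx: "?len l \<le> ?len m" if "l \<in> S" for l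
    using that \<open>finite S\<close> unfolding m(2)[symmetric] by simp
  have fo: "follows \<psi> (fst m) l" if l: "l \<in> S" "l \<noteq> m" for l
  proof -
    have "\<not> follows \<psi> (fst l) m"
    proof
      assume "follows \<psi> (fst l) m"
      then have "strict_prefix (fst m) (fst l)" by (auto simp: follows_def split: prod.splits)
      then have "length (fst m) < length (fst l)" by (rule prefix_length_less)
      then show False using mx[OF l(1)] by simp
    qed
    then show ?thesis using assms(2) l m(1) unfolding coherent_def by blast
  qed
  have pre: "prefix k (fst m)" if k: "k \<in> fst ` S" for k
  proof -
    obtain l where l: "l \<in> S" "k = fst l" using k by blast
    show ?thesis
    proof (cases "l = m")
      case False
      then have "follows \<psi> (fst m) l" using fo l by blast
      then show ?thesis using l(2) by (auto simp: follows_def split: prod.splits)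
    qed (use l in simp)
  qed
  have "(THE k. k \<in> fst ` S \<and> (\<forall>k' \<in> fst ` S. prefix k' k)) = fst m"
    using m(1) pre by (intro the_equality) (auto intro: prefix_order.antisym)
  then have "loc S = fst m @ [0]" using assms(3) by (simp add: loc_def)
  then show thesis using that[of "fst m" "snd m"] m(1) fo by simp
qed

text \<open>The innermost quantifier of \<open>S\<close> follows all other elements, so their
  variables are free at it and hence also just below it. For the innermost element itself coherence
  says nothing about freeness below; if it belongs to \<open>S0\<close>, then
  \<open>loc S0 = loc S\<close> and the last hypothesis supplies it.\<close>

lemma loc_follows_subset:
  assumes "\<And>l. l \<in> S \<Longrightarrow> located_var \<psi> l" "coherent \<psi> S" "S0 \<subseteq> S" "S0 \<noteq> {}"
    and free: "lvars S0 \<subseteq> free_at \<psi> (loc S0)"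
  shows "prefix (loc S0) (loc S)" "follows_set \<psi> (loc S) S0"
proof -
  obtain m u where m: "(m, u) \<in> S" "loc S = m @ [0]" "\<And>l. l \<in> S \<Longrightarrow> l \<noteq> (m, u) \<Longrightarrow> follows \<psi> m l"
    using loc_max[of S \<psi>] assms by blast
  have coh0: "coherent \<psi> S0" using assms(2,3) unfolding coherent_def by blast
  obtain m0 u0 where m0: "(m0, u0) \<in> S0" "loc S0 = m0 @ [0]"
    "\<And>l. l \<in> S0 \<Longrightarrow> l \<noteq> (m0, u0) \<Longrightarrow> follows \<psi> m0 l"
    using loc_max[of S0 \<psi>] assms coh0 by blast
  have locm: "located_var \<psi> (m, u)" "located_var \<psi> (m0, u0)" using assms m m0 by auto
  have ind: "m @ [0] \<in> indices \<psi>" by (rule located_var_child(1)[OF locm(1)])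
  show "prefix (loc S0) (loc S)"
  proof (cases "(m0, u0) = (m, u)")
    case False
    then have "follows \<psi> m (m0, u0)" using m(3) m0(1) assms(3) by blast
    then have "prefix (m0 @ [0]) m"
      using located_var_below[OF locm(2)] located_var_index[OF locm(1)] by (simp add: follows_def)
    then show ?thesis using m0(2) m(2) by (simp add: prefix_order.trans[of _ m])
  qed (use m m0 in simp)
  have "follows \<psi> (loc S) l" if l: "l \<in> S0" for l
  proof (cases "l = (m, u)")
    case True
    have "(m0, u0) = (m, u)"
    proof (rule ccontr)
      assume ne: "(m0, u0) \<noteq> (m, u)"
      then have "follows \<psi> m (m0, u0)" using m(3) m0(1) assms(3) by blast
      moreover have "follows \<psi> m0 (m, u)" using m0(3)[of l] l True ne by auto
      ultimately show False by (auto simp: follows_def)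
    qed
    then have "loc S0 = loc S" using m m0 by simp
    moreover have "u \<in> lvars S0" using l True by (force simp: lvars_def)
    ultimately have "u \<in> free_at \<psi> (m @ [0])" using free m(2) by auto
    then show ?thesis using follows_self_child[OF ind] m(2) True by simp
  next
    case False
    obtain n w where nw: "l = (n, w)" by fastforce
    have "follows \<psi> m (n, w)" using m(3)[of l] l assms(3) False nw by auto
    moreover have "w \<in> free_at \<psi> (m @ [0])"
      using follows_free[OF calculation] located_var_child(2)[OF locm(1)] by simp
    ultimately show ?thesis using follows_snoc[OF _ ind] m(2) nw by simp
  qed
  then show "follows_set \<psi> (loc S) S0" using ind m(2) by (simp add: follows_set_def)
qed

text \<open>An index that follows a nonempty \<open>S\<close> lies below the innermost quantifier,
  hence at or below its only child. The second claim is what lets a clause on the variables of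
  \<open>S\<close> flow along this path.\<close>

lemma follows_set_loc:
  assumes "\<And>l. l \<in> S \<Longrightarrow> located_var \<psi> l" "coherent \<psi> S" "follows_set \<psi> i S"
  shows "prefix (loc S) i" "\<And>k. prefix (loc S) k \<Longrightarrow> prefix k i \<Longrightarrow> lvars S \<subseteq> free_at \<psi> k"
proof -
  have "prefix (loc S) i \<and> (\<forall>k. prefix (loc S) k \<longrightarrow> prefix k i \<longrightarrow> lvars S \<subseteq> free_at \<psi> k)"
  proof (cases "S = {}")
    case True
    then show ?thesis by (simp add: loc_def lvars_def)
  next
    case False
    obtain m u where m: "(m, u) \<in> S" "loc S = m @ [0]" "\<And>l. l \<in> S \<Longrightarrow> l \<noteq> (m, u) \<Longrightarrow> follows \<psi> m l"
      using loc_max[of S \<psi>] assms False by blast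
    have "follows \<psi> i (m, u)" using assms(3) m(1) by (simp add: follows_set_def)
    then have "prefix (loc S) i"
      using located_var_below assms(1)[OF m(1)] m(2) by (auto simp: follows_def)
    moreover have "w \<in> free_at \<psi> k" if k: "prefix (loc S) k" "prefix k i" and nw: "(n, w) \<in> S" for k n w
    proof -
      have "prefix n m" using m(3)[OF nw] by (cases "(n, w) = (m, u)") (auto simp: follows_def)
      moreover have "strict_prefix m k" using k(1) m(2) by (auto simp: prefix_def strict_prefix_def)
      ultimately have "strict_prefix n k" by (rule prefix_order.le_less_trans)
      moreover have "follows \<psi> i (n, w)" using assms(3) nw by (simp add: follows_set_def)
      ultimately show ?thesis using k(2) by (simp add: follows_def)
    qed
    ultimately show ?thesis by (auto simp: lvars_def)
  qed
  then show "prefix (loc S) i" "\<And>k. prefix (loc S) k \<Longrightarrow> prefix k i \<Longrightarrow> lvars S \<subseteq> free_at \<psi> k"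
    by blast+
qed

lemma wrap_up_loc:
  assumes "\<And>l. l \<in> S \<Longrightarrow> located_var \<psi> l" "coherent \<psi> S" "follows_set \<psi> i S"
    and "valid \<psi> Q" "root Q = (i, \<alpha>)" "cvars \<alpha> = lvars S"
  shows "valid \<psi> (wrap (ups i (loc S)) \<alpha> Q) \<and> root (wrap (ups i (loc S)) \<alpha> Q) = (loc S, \<alpha>)
    \<and> num_nonflow \<psi> (wrap (ups i (loc S)) \<alpha> Q) = num_nonflow \<psi> Q"
proof -
  note f = follows_set_loc[OF assms(1-3)]
  obtain d where d: "i = loc S @ d" using f(1) by (auto simp: prefix_def)
  show ?thesis
    unfolding d using f(2) assms(4-6) unfolding d by (intro wrap_up) auto
qed

lemma clause_paths_complete: "sub_at \<psi> i = Some (Clause \<alpha>) \<Longrightarrow> i \<in> set (clause_paths \<psi>)"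
proof (induction \<psi> arbitrary: i)
  case (Clause \<beta>)
  then show ?case by (cases i) auto
next
  case (Conj \<phi> \<chi>)
  show ?case by (cases i) (use Conj in \<open>auto simp: less_Suc_eq split: if_splits\<close>)
next
  case (All v \<phi>)
  show ?case by (cases i) (use All in \<open>auto split: if_splits\<close>)
next
  case (Exi v \<phi>)
  show ?case by (cases i) (use Exi in \<open>auto split: if_splits\<close>)
qed

lemma wf_qcbf_sub_at: "wf_qcbf \<psi> \<Longrightarrow> sub_at \<psi> i = Some \<phi> \<Longrightarrow> wf_qcbf \<phi>"
proof (induction \<psi> i rule: sub_at.induct)
  case (2 \<psi> k i)
  then show ?case by (cases \<psi>) (auto simp: less_Suc_eq split: if_splits)
qed simp

lemma clause_judgement:
  assumes "wf_qcbf \<psi>" "sub_at \<psi> i = Some (Clause \<alpha>)"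
  shows "is_judgement \<psi> (i, \<alpha>)"
  using wf_qcbf_sub_at[OF assms] assms(2) by (auto simp: is_judgement_def indices_def free_at_def)

text \<open>The witnessing index determines the whole label: its clause must be
  \<open>clause_of a\<close>, and an element of \<open>S\<close> that it follows must be the binder
  it sees. Hence comparing labels, as \<open>leaf_index\<close> does, succeeds whenever there is a
  witness.\<close>

lemma leaf_node_label:
  assumes "trace_label \<psi> L" "leaf_node \<psi> L"
  shows "\<exists>i \<alpha>. sub_at \<psi> i = Some (Clause \<alpha>) \<and> label \<psi> (i, \<alpha>) = L"
proof -
  obtain S a where L: "L = (S, a)" by fastforce
  obtain i \<alpha> where i: "follows_set \<psi> i S" "sub_at \<psi> i = Some (Clause \<alpha>)" "falsified \<alpha> a" "cvars \<alpha> = lvars S"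
    using assms(2) by (auto simp: leaf_node_def L)
  have S: "\<And>l. l \<in> S \<Longrightarrow> located_var \<psi> l" "dom a = lvars S" using assms(1) by (auto simp: trace_label_def L)
  have "\<alpha> = clause_of a" using falsified_clause_of i(3,4) S(2) by simp
  then have "asg \<alpha> = a" by (simp add: asg_clause_of)
  moreover have "binder_of \<psi> i u = k" if "(k, u) \<in> S" for k u
    using that S(1) i(1) by (intro binder_eqI) (auto simp: follows_set_def)
  then have "(\<lambda>u. (binder_of \<psi> i u, u)) ` cvars \<alpha> = S"
    unfolding i(4) lvars_def by (force simp: image_image)
  ultimately show ?thesis using i(2) by (auto simp: label_def L)
qed

lemma leaf_index_label:
  assumes "trace_label \<psi> L" "leaf_node \<psi> L"
  shows "\<exists>\<alpha>. sub_at \<psi> (leaf_index \<psi> L) = Some (Clause \<alpha>) \<and> label \<psi> (leaf_index \<psi> L, \<alpha>) = L"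
proof -
  let ?P = "\<lambda>i. \<exists>\<alpha>. sub_at \<psi> i = Some (Clause \<alpha>) \<and> label \<psi> (i, \<alpha>) = L"
  have "filter ?P (clause_paths \<psi>) \<noteq> []"
    using leaf_node_label[OF assms] clause_paths_complete by (fastforce simp: filter_empty_conv)
  then have "leaf_index \<psi> L \<in> set (filter ?P (clause_paths \<psi>))"
    unfolding leaf_index_def by (rule hd_in_set)
  then show ?thesis by simp
qed

lemma clause_of_upd:
  assumes "u \<notin> dom a"
  shows "clause_of (a(u \<mapsto> False)) = insert (Pos u) (clause_of a)"
    "clause_of (a(u \<mapsto> True)) = insert (Neg u) (clause_of a)"
proof -
  have "lit_false (a(u \<mapsto> False)) M \<longleftrightarrow> M = Pos u \<or> lit_false a M"
    "lit_false (a(u \<mapsto> True)) M \<longleftrightarrow> M = Neg u \<or> lit_false a M" for M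
    using assms by (cases M; auto)+
  then show "clause_of (a(u \<mapsto> False)) = insert (Pos u) (clause_of a)"
    "clause_of (a(u \<mapsto> True)) = insert (Neg u) (clause_of a)"
    by (auto simp: clause_of_def)
qed

lemma clause_of_restrict: "clause_of (a |` X) = {L \<in> clause_of a. var_of L \<in> X}"
proof -
  have "lit_false (a |` X) M \<longleftrightarrow> lit_false a M \<and> var_of M \<in> X" for M
    by (cases M) (auto simp: restrict_map_def)
  then show ?thesis by (simp add: clause_of_def)
qed

lemma proof_of_correct:
  assumes "qcbf_instance \<psi>"
  shows "is_trace \<psi> T \<Longrightarrow> valid \<psi> (proof_of \<psi> T)
     \<and> root (proof_of \<psi> T) = (loc (fst (root T)), clause_of (snd (root T)))
     \<and> num_nonflow \<psi> (proof_of \<psi> T) = num_nodes T"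
proof (induction T)
  case (Node L ts)
  have wf: "wf_qcbf \<psi>" "free \<psi> = {}" using assms by (auto simp: qcbf_instance_def)
  obtain S a where L: "L = (S, a)" by fastforce
  let ?\<alpha> = "clause_of a"
  have tl: "trace_label \<psi> L" and tn: "trace_node \<psi> L (map root ts)" using Node.prems by auto
  have S: "\<And>l. l \<in> S \<Longrightarrow> located_var \<psi> l" "coherent \<psi> S" and dom: "dom a = lvars S"
    using tl by (auto simp: trace_label_def L)
  have cv: "cvars ?\<alpha> = lvars S" using dom by (simp add: cvars_clause_of)
  have IH: "valid \<psi> (proof_of \<psi> t)"
    "root (proof_of \<psi> t) = (loc (fst (root t)), clause_of (snd (root t)))"
    "num_nonflow \<psi> (proof_of \<psi> t) = num_nodes t" "trace_label \<psi> (root t)" if "t \<in> set ts" for t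
  proof -
    have "is_trace \<psi> t" using Node.prems that by simp
    then show "valid \<psi> (proof_of \<psi> t)"
      "root (proof_of \<psi> t) = (loc (fst (root t)), clause_of (snd (root t)))"
      "num_nonflow \<psi> (proof_of \<psi> t) = num_nodes t" "trace_label \<psi> (root t)"
      using Node.IH[OF that] by (auto, cases t, auto)
  qed
  consider "ts = []" | t where "ts = [t]" | t0 t1 where "ts = [t0, t1]"
    using tn by (cases "(\<psi>, L, map root ts)" rule: trace_node.cases) (auto simp: map_eq_Cons_conv)
  then show ?case
  proof cases
    case 1
    then have "leaf_node \<psi> L" using tn by simp
    then obtain \<alpha> where \<alpha>: "sub_at \<psi> (leaf_index \<psi> L) = Some (Clause \<alpha>)" "label \<psi> (leaf_index \<psi> L, \<alpha>) = L"
      using leaf_index_label[OF tl] by blast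
    let ?i = "leaf_index \<psi> L"
    have j: "is_judgement \<psi> (?i, \<alpha>)" using clause_judgement[OF wf(1) \<alpha>(1)] .
    then have eq: "\<alpha> = ?\<alpha>" using clause_of_asg[of \<alpha>] \<alpha>(2) by (auto simp: is_judgement_def label_def L)
    have "follows_set \<psi> ?i S" using follows_set_label[OF wf(2) j] unfolding \<alpha>(2) by (simp add: L)
    moreover have "valid \<psi> (Node (?i, ?\<alpha>) [])"
      using j \<alpha>(1) eq by (auto simp: derived_def clause_rule_def)
    moreover have "num_nonflow \<psi> (Node (?i, ?\<alpha>) []) = 1"
      by (simp add: upward_flow_def downward_flow_def)
    ultimately show ?thesis
      using wrap_up_loc[OF S, of ?i "Node (?i, ?\<alpha>) []" ?\<alpha>] cv 1
      by (simp add: proof_step_def Let_def L)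
  next
    case (2 t)
    then have "unary_node \<psi> L (root t)" using tn by simp
    then obtain i y b where i: "forall_located \<psi> (i, y)" "follows_set \<psi> i S"
      "root t = (S \<union> {(i, y)}, a(y \<mapsto> b))"
      by (auto simp: unary_node_def L)
    let ?S = "S \<union> {(i, y)}"
    have li: "located_var \<psi> (i, y)" using i(1) by (simp add: located_var_def)
    have S': "\<And>l. l \<in> ?S \<Longrightarrow> located_var \<psi> l" "coherent \<psi> ?S"
      using IH(4)[of t] 2 by (auto simp: i(3) trace_label_def)
    have nS: "(i, y) \<notin> S" using i(2) by (auto simp: follows_set_def follows_def)
    \<comment> \<open>An occurrence of \<open>y\<close> in \<open>S\<close> would be followed by
      \<open>i\<close>, but \<open>i\<close> quantifies \<open>y\<close>.\<close>
    have yd: "y \<notin> dom a"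
    proof
      assume "y \<in> dom a"
      then obtain k where "(k, y) \<in> S" using dom by (auto simp: lvars_def)
      then have "follows \<psi> i (k, y)" using i(2) by (simp add: follows_set_def)
      then show False using located_not_follows[OF li] by blast
    qed
    obtain k u where k: "(k, u) \<in> ?S" "loc ?S = k @ [0]" "\<And>l. l \<in> ?S \<Longrightarrow> l \<noteq> (k, u) \<Longrightarrow> follows \<psi> k l"
      using loc_max[OF S'] by auto
    \<comment> \<open>The new quantifier is innermost, so the child's proof ends exactly at the
      child of \<open>i\<close>, where \<forall>-removal needs its premise.\<close>
    have "(k, u) = (i, y)"
    proof (rule ccontr)
      assume ne: "(k, u) \<noteq> (i, y)"
      then have "(k, u) \<in> S" using k(1) by auto
      then have "follows \<psi> i (k, u)" using i(2) by (simp add: follows_set_def)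
      moreover have "follows \<psi> k (i, y)" using k(3)[of "(i, y)"] ne by auto
      ultimately show False by (auto simp: follows_def)
    qed
    then have ls: "loc ?S = i @ [0]" using k by simp
    let ?\<beta> = "clause_of (a(y \<mapsto> b))"
    \<comment> \<open>The inequality keeps this removal from being an instance of upward flow, which
      would not be counted.\<close>
    have \<beta>: "?\<beta> - {Pos y, Neg y} = ?\<alpha>" "?\<beta> \<noteq> ?\<alpha>"
    proof -
      have "Pos y \<notin> ?\<alpha>" "Neg y \<notin> ?\<alpha>" using yd by (auto simp: clause_of_def dom_def)
      then show "?\<beta> - {Pos y, Neg y} = ?\<alpha>" "?\<beta> \<noteq> ?\<alpha>"
        using clause_of_upd[OF yd] by (cases b; auto)+
    qed
    let ?Q = "Node (i, ?\<alpha>) [proof_of \<psi> t]"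
    have rt: "root (proof_of \<psi> t) = (i @ [0], ?\<beta>)" using IH(2)[of t] 2 i(3) ls by simp
    then have jb: "is_judgement \<psi> (i @ [0], ?\<beta>)" using valid_root[OF IH(1)[of t]] 2 by simp
    have ja: "is_judgement \<psi> (i, ?\<alpha>)"
    proof -
      have "is_clause ?\<alpha>" using jb \<beta>(1) is_clause_subset[of ?\<beta> ?\<alpha>] by (auto simp: is_judgement_def)
      moreover have "lvars S \<subseteq> free_at \<psi> i"
        using i(2) follows_free by (auto simp: follows_set_def lvars_def)
      ultimately show ?thesis using located_var_index[OF li] cv by (simp add: is_judgement_def)
    qed
    have "forall_removal \<psi> (i, ?\<alpha>) [(i @ [0], ?\<beta>)]"
      using i(1) \<beta>(1) located_var_child(1)[OF li]
      unfolding forall_removal_def by (auto simp: forall_located_def is_parent_def intro!: exI[of _ y])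
    then have "valid \<psi> ?Q" using ja IH(1)[of t] 2 rt by (simp add: derived_def)
    moreover have "num_nonflow \<psi> ?Q = 1 + num_nodes t"
      using \<beta>(2) rt IH(3)[of t] 2 by (simp add: upward_flow_def downward_flow_def)
    moreover have "(THE l. l \<in> ?S - S) = (i, y)" using nS by (intro the_equality) auto
    ultimately show ?thesis
      using wrap_up_loc[OF S i(2), of ?Q ?\<alpha>] cv 2 i(3)
      by (simp add: proof_step_def Let_def L)
  next
    case (3 t0 t1)
    then have "binary_node \<psi> L (root t0) (root t1)" using tn by simp
    then obtain i u S0 S1 where b: "located_var \<psi> (i, u)" "(i, u) \<notin> S" "coherent \<psi> (S \<union> {(i, u)})"
      "S0 \<subseteq> S" "S1 \<subseteq> S" "S0 \<union> S1 = S"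
      "root t0 = (S0 \<union> {(i, u)}, (a |` lvars S0)(u \<mapsto> False))"
      "root t1 = (S1 \<union> {(i, u)}, (a |` lvars S1)(u \<mapsto> True))"
      by (auto simp: binary_node_def L)
    let ?S = "S \<union> {(i, u)}"
    let ?l = "loc ?S"
    have S': "\<And>l. l \<in> ?S \<Longrightarrow> located_var \<psi> l" using S(1) b(1) by blast
    have us: "u \<notin> lvars S"
    proof
      assume "u \<in> lvars S"
      then obtain k where k: "(k, u) \<in> S" by (auto simp: lvars_def)
      then have "(k, u) \<noteq> (i, u)" using b(2) by auto
      then have "follows \<psi> k (i, u) \<or> follows \<psi> i (k, u)"
        using b(3) k unfolding coherent_def by (metis UnI1 UnI2 fst_conv singletonI)
      then show False using located_not_follows b(1) S(1)[OF k] by blast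
    qed
    let ?\<delta>a = "clause_of (a |` lvars S0)" and ?\<delta>b = "clause_of (a |` lvars S1)"
    have "u \<notin> dom (a |` lvars S0)" "u \<notin> dom (a |` lvars S1)" using us dom by auto
    then have r: "clause_of (snd (root t0)) = insert (Pos u) ?\<delta>a" "clause_of (snd (root t1)) = insert (Neg u) ?\<delta>b"
      using clause_of_upd b(7,8) by simp_all
    have "lvars S0 \<union> lvars S1 = dom a" using b(6) dom by (auto simp: lvars_def)
    then have "var_of M \<in> lvars S0 \<union> lvars S1" if "M \<in> ?\<alpha>" for M
      using that cvars_clause_of[of a] by (metis cvars_def imageI)
    \<comment> \<open>Because \<open>S0\<close> and \<open>S1\<close> cover \<open>S\<close>, the
      two restrictions together lose no literal.\<close>
    then have g: "?\<delta>a \<union> ?\<delta>b = ?\<alpha>"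
      unfolding clause_of_restrict by auto
    have "var_of ` ?\<alpha> = lvars S" using cv by (simp add: cvars_def)
    then have "Pos u \<notin> ?\<alpha>" "Neg u \<notin> ?\<alpha>" using us by force+
    then have nu: "Neg u \<notin> ?\<delta>b" "Pos u \<notin> ?\<delta>a" using g by auto
    have down: "valid \<psi> (wrap (downs (loc (fst (root t))) ?l) (clause_of (snd (root t))) (proof_of \<psi> t))
        \<and> root (wrap (downs (loc (fst (root t))) ?l) (clause_of (snd (root t))) (proof_of \<psi> t))
          = (?l, clause_of (snd (root t)))
        \<and> num_nonflow \<psi> (wrap (downs (loc (fst (root t))) ?l) (clause_of (snd (root t))) (proof_of \<psi> t))
          = num_nodes t
        \<and> follows_set \<psi> ?l (fst (root t))"
      if t: "t \<in> set ts" "fst (root t) \<subseteq> ?S" "fst (root t) \<noteq> {}" for t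
    proof -
      let ?R = "fst (root t)" and ?\<beta> = "clause_of (snd (root t))"
      have cvb: "cvars ?\<beta> = lvars ?R"
        using IH(4)[OF t(1)] by (auto simp: cvars_clause_of trace_label_def split: prod.splits)
      \<comment> \<open>The conditions on labels do not give freeness just below the innermost
        quantifier; it comes from the root judgement of the proof already built for the
        child.\<close>
      have "is_judgement \<psi> (loc ?R, ?\<beta>)" using valid_root[OF IH(1)] IH(2) t(1) by fastforce
      then have fr: "lvars ?R \<subseteq> free_at \<psi> (loc ?R)" by (simp add: is_judgement_def cvb)
      note f = loc_follows_subset[OF S' b(3) t(2,3) fr]
      obtain d where d: "?l = loc ?R @ d" using f(1) by (auto simp: prefix_def)
      have cohR: "coherent \<psi> ?R" using b(3) t(2) unfolding coherent_def by blast
      have locR: "\<And>l. l \<in> ?R \<Longrightarrow> located_var \<psi> l" using S' t(2) by blast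
      have "?l \<in> indices \<psi>" using f(2) by (simp add: follows_set_def)
      then show ?thesis
        using wrap_down[OF IH(1,2)[OF t(1)], of d] follows_set_loc(2)[OF locR cohR f(2)] cvb
          IH(3)[OF t(1)] f(2) unfolding d by simp
    qed
    have d0: "t0 \<in> set ts" "fst (root t0) \<subseteq> ?S" "fst (root t0) \<noteq> {}"
      and d1: "t1 \<in> set ts" "fst (root t1) \<subseteq> ?S" "fst (root t1) \<noteq> {}"
      using 3 b by auto
    note D0 = down[OF d0, unfolded r] and D1 = down[OF d1, unfolded r]
    have un: "fst (root t0) \<union> fst (root t1) = ?S" using b by auto
    have fS: "follows_set \<psi> ?l S" using D0 D1 b(6-8) by (auto simp: follows_set_def)
    let ?Wa = "wrap (downs (loc (fst (root t0))) ?l) (insert (Pos u) ?\<delta>a) (proof_of \<psi> t0)"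
    let ?Wb = "wrap (downs (loc (fst (root t1))) ?l) (insert (Neg u) ?\<delta>b) (proof_of \<psi> t1)"
    let ?Q = "Node (?l, ?\<alpha>) [?Wa, ?Wb]"
    have j0: "is_judgement \<psi> (?l, insert (Pos u) ?\<delta>a)" and j1: "is_judgement \<psi> (?l, insert (Neg u) ?\<delta>b)"
      using D0 D1 valid_root by metis+
    \<comment> \<open>Finiteness of the resolvent is inherited from the premises; that no variable
      occurs twice is automatic for \<open>clause_of\<close>.\<close>
    have "finite ?\<delta>a" "finite ?\<delta>b" using j0 j1 by (auto simp: is_judgement_def is_clause_iff)
    then have "finite ?\<alpha>" using g by (metis finite_UnI)
    then have cla: "is_clause ?\<alpha>" by (auto simp: is_clause_iff clause_of_def)
    have "lvars S \<subseteq> free_at \<psi> ?l"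
      using fS follows_free by (auto simp: follows_set_def lvars_def)
    then have ja: "is_judgement \<psi> (?l, ?\<alpha>)" using cla cv fS by (simp add: is_judgement_def follows_set_def)
    have "resolvent (insert (Pos u) ?\<delta>a) (insert (Neg u) ?\<delta>b) ?\<alpha>"
      unfolding resolvent_def using g nu cla by (intro bexI[of _ "Pos u"]) auto
    then have "resolve_rule \<psi> (?l, ?\<alpha>) (map root [?Wa, ?Wb])"
      using D0 D1 unfolding resolve_rule_def by auto
    then have "valid \<psi> ?Q" using ja D0 D1 by (simp add: derived_def)
    moreover have "num_nonflow \<psi> ?Q = 1 + num_nodes t0 + num_nodes t1"
      using D0 D1 by (simp add: upward_flow_def downward_flow_def)
    moreover have "proof_of \<psi> (Node L ts) = wrap (ups ?l (loc S)) ?\<alpha> ?Q"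
      unfolding 3 L proof_of.simps proof_step_def Let_def by (simp add: un r)
    ultimately show ?thesis
      using wrap_up_loc[OF S fS, of ?Q ?\<alpha>] cv 3 L by simp
  qed
qed

section \<open>Deterministic encodings\<close>

lemma vbool_eq_iff [simp]: "vbool b = vbool c \<longleftrightarrow> b = c"
  by (auto simp: vbool_def)

lemma vbool_eq_Atom [simp]: "vbool b = Atom \<longleftrightarrow> \<not> b" "Atom = vbool b \<longleftrightarrow> \<not> b"
  by (auto simp: vbool_def)

lemma enc_nat_eq_iff [simp]: "enc_nat m = enc_nat n \<longleftrightarrow> m = n"
proof
  show "enc_nat m = enc_nat n \<Longrightarrow> m = n"
  proof (induction m arbitrary: n rule: less_induct)
    case (less m)
    note eq = less.prems[unfolded enc_nat.simps[of m] enc_nat.simps[of n]]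
    show ?case
    proof (cases "m = 0 \<or> n = 0")
      case True
      then show ?thesis using eq by (auto split: if_splits)
    next
      case False
      then have "odd m = odd n" "enc_nat (m div 2) = enc_nat (n div 2)" using eq by auto
      then have "odd m = odd n" "m div 2 = n div 2" using less.IH[of "m div 2" "n div 2"] False by auto
      then show ?thesis by (metis dvd_mult_div_cancel odd_two_times_div_two_succ)
    qed
  qed
qed simp

lemma enc_nat_0 [simp]: "enc_nat 0 = Atom"
  by (simp add: enc_nat.simps)

lemma enc_nat_eq_Atom [simp]: "enc_nat n = Atom \<longleftrightarrow> n = 0" "Atom = enc_nat n \<longleftrightarrow> n = 0"
  using enc_nat_eq_iff[of n 0] enc_nat_eq_iff[of 0 n] by (auto simp del: enc_nat_eq_iff)

definition enc_index :: "index \<Rightarrow> val" where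
  "enc_index i = enc_list (map enc_nat i)"

fun enc_lit :: "lit \<Rightarrow> val" where
  "enc_lit (Pos u) = Cell (vbool True) (enc_nat u)"
| "enc_lit (Neg u) = Cell (vbool False) (enc_nat u)"

definition enc_located :: "located \<Rightarrow> val" where
  "enc_located l = Cell (enc_index (fst l)) (enc_nat (snd l))"

definition enc_binding :: "nat \<times> bool \<Rightarrow> val" where
  "enc_binding p = Cell (enc_nat (fst p)) (vbool (snd p))"

lemma inj_enc_nat: "inj enc_nat"
  by (auto intro: injI)

lemma enc_index_eq_iff [simp]: "enc_index i = enc_index j \<longleftrightarrow> i = j"
  by (simp add: enc_index_def inj_map_eq_map[OF inj_enc_nat])

lemma enc_index_simps [simp]: "enc_index [] = Atom" "enc_index (k # i) = Cell (enc_nat k) (enc_index i)"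
  by (simp_all add: enc_index_def)

lemma inj_enc_lit: "inj enc_lit"
proof (rule injI)
  fix L M assume "enc_lit L = enc_lit M"
  then show "L = M" by (cases L; cases M) auto
qed

lemma inj_enc_located: "inj enc_located"
  by (auto intro!: injI simp: enc_located_def prod_eq_iff)

lemma inj_enc_binding: "inj enc_binding"
  by (auto intro!: injI simp: enc_binding_def prod_eq_iff)

lemma encodes_list_det:
  assumes "\<And>x v. E x v \<longleftrightarrow> v = e x"
  shows "encodes_list E xs v \<longleftrightarrow> v = enc_list (map e xs)"
proof -
  have "list_all2 E xs vs \<longleftrightarrow> vs = map e xs" for vs
    by (induction xs arbitrary: vs) (auto simp: list_all2_Cons1 assms)
  then show ?thesis by (auto simp: encodes_list_def)
qed

text \<open>Injectivity of the element code lets freedom from repetitions be checked on the codes.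
  Any repetition-free arrangement counts, so programs never need to sort.\<close>

lemma encodes_set_det:
  assumes "\<And>x v. E x v \<longleftrightarrow> v = e x" "inj e"
  shows "encodes_set E A v \<longleftrightarrow> distinct (dec_list v) \<and> set (dec_list v) = e ` A"
proof
  assume "encodes_set E A v"
  then show "distinct (dec_list v) \<and> set (dec_list v) = e ` A"
    using assms(2) by (auto simp: encodes_set_def encodes_list_det[OF assms(1)] distinct_map
      intro: inj_on_subset[OF _ subset_UNIV])
next
  assume v: "distinct (dec_list v) \<and> set (dec_list v) = e ` A"
  let ?xs = "map (inv e) (dec_list v)"
  have "map e ?xs = dec_list v"
    unfolding map_map using v by (intro map_idI) (auto simp: f_inv_into_f)
  then have "encodes_list E ?xs v" by (simp add: encodes_list_det[OF assms(1)] del: map_map)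
  moreover have "distinct ?xs"
    using v assms(2) by (auto simp: distinct_map intro!: inj_onI)
  moreover have "set ?xs = A" using v assms(2) by (simp add: image_image)
  ultimately show "encodes_set E A v" unfolding encodes_set_def by blast
qed

lemma encodes_index_iff: "encodes_index i v \<longleftrightarrow> v = enc_index i"
  unfolding encodes_index_def enc_index_def by (rule encodes_list_det) (simp add: encodes_nat_def)

lemma encodes_lit_iff: "encodes_lit L v \<longleftrightarrow> v = enc_lit L"
  by (cases L) auto

lemma encodes_clause_iff:
  "encodes_clause \<alpha> v \<longleftrightarrow> distinct (dec_list v) \<and> set (dec_list v) = enc_lit ` \<alpha>"
  unfolding encodes_clause_def by (intro encodes_set_det encodes_lit_iff inj_enc_lit)

lemma encodes_located_set_iff:
  "encodes_set (encodes_prod encodes_index encodes_nat) S v \<longleftrightarrow>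
     distinct (dec_list v) \<and> set (dec_list v) = enc_located ` S"
  by (intro encodes_set_det inj_enc_located)
    (simp add: encodes_prod_def encodes_index_iff encodes_nat_def enc_located_def)

lemma encodes_assignment_iff:
  "encodes_assignment a v \<longleftrightarrow> distinct (dec_list v) \<and> set (dec_list v) = enc_binding ` Map.graph a"
  unfolding encodes_assignment_def by (intro encodes_set_det inj_enc_binding)
    (simp add: encodes_prod_def encodes_bool_def encodes_nat_def enc_binding_def)

lemma encodes_label_iff:
  "encodes_label L v \<longleftrightarrow> (\<exists>vS va. v = Cell vS va
     \<and> distinct (dec_list vS) \<and> set (dec_list vS) = enc_located ` fst L
     \<and> distinct (dec_list va) \<and> set (dec_list va) = enc_binding ` Map.graph (snd L))"
  unfolding encodes_label_def encodes_prod_def[of "encodes_set _"]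
    encodes_located_set_iff encodes_assignment_iff by auto

lemma encodes_judgement_iff:
  "encodes_prod encodes_index encodes_clause J v \<longleftrightarrow>
     (\<exists>w. v = Cell (enc_index (fst J)) w \<and> encodes_clause (snd J) w)"
  by (auto simp: encodes_prod_def encodes_index_iff)

section \<open>Programs on codes\<close>

lemma ptime_vbool: "ptest P \<Longrightarrow> ptime (\<lambda>x. vbool (P x))"
  by (simp add: ptest_def)

lemmas ptime_intros = ptime_const ptime_id ptime_Cell ptime_vfst ptime_vsnd ptime_if ptime_vbool
  ptime_vmap ptime_vfilter ptime_vappend ptime_vrev
  ptest_eq ptest_not ptest_conj ptest_disj ptest_vex ptest_vmem

section \<open>Navigation in the syntax tree, on codes\<close>

definition vprefs :: "val \<Rightarrow> val" where
  "vprefs v = enc_list (map enc_list (prefixes (dec_list v)))"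

lemma vsize_prefix: "prefix xs ys \<Longrightarrow> vsize (enc_list xs) \<le> vsize (enc_list ys)"
  by (auto simp: prefix_def vsize_enc_list)

lemma ptime_vprefs:
  assumes "ptime X"
  shows "ptime (\<lambda>e. vprefs (X e))"
proof -
  \<comment> \<open>Prepending \<open>y\<close> to a list adds the empty prefix and extends each
    former prefix by \<open>y\<close>.\<close>
  have fold: "foldr (\<lambda>y acc. Cell Atom (vmap (Cell y) acc)) ys (Cell Atom Atom) = vprefs (enc_list ys)" for ys
    by (induction ys) (auto simp: vprefs_def vmap_def)
  have "ptime (\<lambda>e. foldr (\<lambda>y acc. Cell Atom (vmap (Cell y) acc)) (dec_list (X e)) (Cell Atom Atom))"
  proof (rule ptime_foldr[OF assms])
    show "polyfun (\<lambda>n. 1 + (n + 1) * (1 + n))" by (intro polyfun.intros)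
    fix e ys
    show "vsize (foldr (\<lambda>y acc. Cell Atom (vmap (Cell y) acc)) ys (Cell Atom Atom))
        \<le> 1 + (vsize e + vsize (enc_list ys) + 1) * (1 + (vsize e + vsize (enc_list ys)))"
      unfolding fold vprefs_def using length_le_vsize_enc_list[of ys] vsize_prefix
      by (intro vsize_enc_list_le) (auto intro: trans_le_add2)
  qed (intro ptime_intros)+
  then show ?thesis by (simp add: fold)
qed

lemma prefixes_map: "prefixes (map f xs) = map (map f) (prefixes xs)"
  by (induction xs) auto

lemma vprefs_enc_index: "vprefs (enc_index i) = enc_list (map enc_index (prefixes i))"
  by (simp add: vprefs_def enc_index_def[abs_def] prefixes_map)

lemma vmem_vprefs: "vmem (enc_index t) (vprefs (enc_index k)) \<longleftrightarrow> prefix t k"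
  by (auto simp: vprefs_enc_index vmem_def)

lemma vfilter_map:
  assumes "\<And>x. x \<in> set xs \<Longrightarrow> P (e x) \<longleftrightarrow> Q x"
  shows "vfilter P (enc_list (map e xs)) = enc_list (map e (filter Q xs))"
  using assms by (auto simp: vfilter_def filter_map o_def intro!: arg_cong[of _ _ "map e"] filter_cong)

text \<open>The body of a quantifier and the right conjunct occupy the same place in their codes, so
  only the left conjunct needs a case of its own.\<close>

definition vchild :: "val \<Rightarrow> val \<Rightarrow> val" where
  "vchild x k = (if vfst x = enc_nat 1 \<and> k = Atom then vfst (vsnd x) else vsnd (vsnd x))"

text \<open>The path is reversed because a right fold processes the last entry first, whereas the
  descent starts with the first step.\<close>

definition vsub :: "val \<Rightarrow> val \<Rightarrow> val" where
  "vsub x i = foldr (\<lambda>k y. vchild y k) (dec_list (vrev i)) x"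

lemma vsize_vchild_le: "vsize (vchild x k) \<le> vsize x"
  unfolding vchild_def using vsize_vfst_le vsize_vsnd_le le_trans by (metis (full_types))

lemma ptime_vsub:
  assumes "ptime f" "ptime g"
  shows "ptime (\<lambda>e. vsub (f e) (g e))"
proof (rule ptime_comp2[OF _ assms])
  show "ptime (\<lambda>z. vsub (vfst z) (vsnd z))"
    unfolding vsub_def
  proof (rule ptime_foldr)
    show "polyfun (\<lambda>n. n)" by (rule polyfun_id)
    have "vsize (foldr (\<lambda>k y. vchild y k) ys x) \<le> vsize x" for ys x
      by (induction ys) (auto intro: le_trans[OF vsize_vchild_le])
    then show "vsize (foldr (\<lambda>k y. vchild y k) ys (vfst e)) \<le> vsize e + vsize (enc_list ys)" for e ys
      by (meson le_trans trans_le_add1 vsize_vfst_le)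
    show "ptime (\<lambda>w. vchild (vsnd (vsnd w)) (vfst (vsnd w)))"
      unfolding vchild_def by (intro ptime_intros)
  qed (intro ptime_intros)+
qed

lemma vsub_simps [simp]: "vsub x Atom = x" "vsub x (Cell k i) = vsub (vchild x k) i"
  by (simp_all add: vsub_def vrev_def)

lemma encodes_qcbf_vsub:
  "encodes_qcbf \<psi> x \<Longrightarrow> sub_at \<psi> i = Some \<phi> \<Longrightarrow> encodes_qcbf \<phi> (vsub x (enc_index i))"
proof (induction \<psi> i arbitrary: x rule: sub_at.induct)
  case (2 \<psi> k i)
  then have k: "k < length (children \<psi>)" "sub_at (children \<psi> ! k) i = Some \<phi>"
    by (auto split: if_splits)
  have "encodes_qcbf (children \<psi> ! k) (vchild x (enc_nat k))"
    using k(1) 2(2) by (cases \<psi>) (auto simp: vchild_def less_Suc_eq)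
  then show ?case using 2(1)[OF k(1) _ k(2)] by simp
qed simp

text \<open>Tag 0 has the code \<open>Atom\<close>; on codes of formulas, the tags left after
  excluding 0 and 1 are those of the two quantifiers.\<close>

definition vquant :: "val \<Rightarrow> val \<Rightarrow> bool" where
  "vquant x u \<longleftrightarrow> vfst x \<noteq> Atom \<and> vfst x \<noteq> enc_nat 1 \<and> vfst (vsnd x) = u"

definition vbind :: "val \<Rightarrow> val \<Rightarrow> val \<Rightarrow> val" where
  "vbind x i u = vfst (vrev (vfilter (\<lambda>k. k \<noteq> i \<and> vquant (vsub x k) u) (vprefs i)))"

lemma ptime_vbind:
  assumes "ptime f" "ptime g" "ptime h"
  shows "ptime (\<lambda>e. vbind (f e) (g e) (h e))"
  unfolding vbind_def vquant_def
  by (intro ptime_intros ptime_vprefs ptime_vsub assms assms[THEN ptime_comp])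

lemma vquant_iff:
  assumes "encodes_qcbf \<psi> x" "k \<in> indices \<psi>"
  shows "vquant (vsub x (enc_index k)) (enc_nat u) \<longleftrightarrow> located_var \<psi> (k, u)"
proof -
  obtain \<phi> where \<phi>: "sub_at \<psi> k = Some \<phi>" using assms(2) by (auto simp: indices_def)
  have "encodes_qcbf \<phi> (vsub x (enc_index k))" using encodes_qcbf_vsub[OF assms(1) \<phi>] .
  then show ?thesis using \<phi> by (cases \<phi>) (auto simp: vquant_def located_var_iff)
qed

lemma vfst_vrev: "xs \<noteq> [] \<Longrightarrow> vfst (vrev (enc_list xs)) = last xs"
  by (cases xs rule: rev_cases) (auto simp: vrev_def)

lemma vbind_eq:
  assumes "encodes_qcbf \<psi> x" "free \<psi> = {}" "i \<in> indices \<psi>" "u \<in> free_at \<psi> i"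
  shows "vbind x (enc_index i) (enc_nat u) = enc_index (binder_of \<psi> i u)"
proof -
  let ?xs = "filter (\<lambda>k. k \<noteq> i \<and> located_var \<psi> (k, u)) (prefixes i)"
  have "vfilter (\<lambda>k. k \<noteq> enc_index i \<and> vquant (vsub x k) (enc_nat u)) (vprefs (enc_index i))
      = enc_list (map enc_index ?xs)"
    unfolding vprefs_enc_index
    using vquant_iff[OF assms(1) indices_prefix[OF _ assms(3)]] by (intro vfilter_map) auto
  \<comment> \<open>The program takes the head of the reversed list, which is \<open>last\<close>
    only if some binder exists.\<close>
  moreover have "?xs \<noteq> []"
  proof -
    have "binder_of \<psi> i u \<in> set ?xs"
      using binder_props[OF assms(2-4)] by (auto simp: follows_def)
    then show ?thesis by (metis list.set(1) empty_iff)
  qed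
  ultimately show ?thesis
    unfolding vbind_def binder_of_def by (simp add: vfst_vrev last_map)
qed

definition vlabel :: "val \<Rightarrow> val \<Rightarrow> val \<Rightarrow> val" where
  "vlabel x i \<alpha> = Cell (vmap (\<lambda>l. Cell (vbind x i (vsnd l)) (vsnd l)) \<alpha>)
     (vmap (\<lambda>l. Cell (vsnd l) (vbool (vfst l = Atom))) \<alpha>)"

lemma ptime_vlabel:
  assumes "ptime f" "ptime g" "ptime h"
  shows "ptime (\<lambda>e. vlabel (f e) (g e) (h e))"
  unfolding vlabel_def
  by (intro ptime_intros ptime_vbind assms assms[THEN ptime_comp])

lemma vsnd_enc_lit [simp]: "vsnd (enc_lit L) = enc_nat (var_of L)"
  by (cases L) auto

lemma graph_asg:
  assumes "is_clause \<alpha>"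
  shows "Map.graph (asg \<alpha>) = (\<lambda>L. (var_of L, vfst (enc_lit L) = Atom)) ` \<alpha>"
proof
  show "Map.graph (asg \<alpha>) \<subseteq> (\<lambda>L. (var_of L, vfst (enc_lit L) = Atom)) ` \<alpha>"
  proof
    fix p assume "p \<in> Map.graph (asg \<alpha>)"
    then obtain u b where p: "p = (u, b)" "asg \<alpha> u = Some b" by (auto simp: graph_def)
    then have "(if b then Neg u else Pos u) \<in> \<alpha>" by (auto simp: asg_def split: if_splits)
    then show "p \<in> (\<lambda>L. (var_of L, vfst (enc_lit L) = Atom)) ` \<alpha>"
      using p(1) by (intro image_eqI[of _ _ "if b then Neg u else Pos u"]) auto
  qed
  show "(\<lambda>L. (var_of L, vfst (enc_lit L) = Atom)) ` \<alpha> \<subseteq> Map.graph (asg \<alpha>)"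
  proof
    fix p assume "p \<in> (\<lambda>L. (var_of L, vfst (enc_lit L) = Atom)) ` \<alpha>"
    then obtain L where "L \<in> \<alpha>" "p = (var_of L, vfst (enc_lit L) = Atom)" by blast
    then show "p \<in> Map.graph (asg \<alpha>)"
      using assms by (cases L) (auto simp: graph_def asg_def is_clause_iff)
  qed
qed

lemma encodes_label_vlabel:
  assumes "encodes_qcbf \<psi> x" "free \<psi> = {}" "is_judgement \<psi> (i, \<alpha>)" "encodes_clause \<alpha> w"
  shows "encodes_label (label \<psi> (i, \<alpha>)) (vlabel x (enc_index i) w)"
proof -
  let ?f = "\<lambda>l. Cell (vbind x (enc_index i) (vsnd l)) (vsnd l)"
  let ?g = "\<lambda>l. Cell (vsnd l) (vbool (vfst l = Atom))"
  have w: "distinct (dec_list w)" "set (dec_list w) = enc_lit ` \<alpha>"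
    using assms(4) by (auto simp: encodes_clause_iff)
  have j: "i \<in> indices \<psi>" "is_clause \<alpha>" "cvars \<alpha> \<subseteq> free_at \<psi> i"
    using assms(3) by (auto simp: is_judgement_def)
  have inj: "inj_on var_of \<alpha>" using j(2) by (simp add: is_clause_def)
  have bd: "vbind x (enc_index i) (enc_nat (var_of L)) = enc_index (binder_of \<psi> i (var_of L))"
    if "L \<in> \<alpha>" for L
    using that j(3) by (intro vbind_eq[OF assms(1,2) j(1)]) (auto simp: cvars_def)
  \<comment> \<open>A clause has one literal per variable, so neither the binders nor the bindings
    repeat and the order of the clause code can be kept.\<close>
  have "inj_on ?f (enc_lit ` \<alpha>)" "inj_on ?g (enc_lit ` \<alpha>)"
    using inj by (auto intro!: inj_onI dest: inj_onD)
  then have d: "distinct (map ?f (dec_list w))" "distinct (map ?g (dec_list w))"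
    using w by (simp_all add: distinct_map)
  have "?f ` enc_lit ` \<alpha> = enc_located ` fst (label \<psi> (i, \<alpha>))"
    using bd by (auto simp: label_def cvars_def image_image enc_located_def cong: image_cong)
  moreover have "?g ` enc_lit ` \<alpha> = enc_binding ` Map.graph (snd (label \<psi> (i, \<alpha>)))"
    by (auto simp: label_def graph_asg[OF j(2)] image_image enc_binding_def cong: image_cong)
  ultimately show ?thesis
    using d w(2) by (auto simp: encodes_label_iff vlabel_def vmap_def)
qed


section \<open>Translating proofs in polynomial time\<close>

text \<open>\<open>vsnd (vfst (vfst cs))\<close> goes to the first subtree, its judgement, and the
  clause in it. A list has length one if it is not \<open>Atom\<close> but its \<open>vsnd\<close>
  is, and a literal is negative if its sign is \<open>Atom\<close>.\<close>

definition vtrace_step :: "val \<Rightarrow> val \<Rightarrow> val \<Rightarrow> val \<Rightarrow> val" where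
  "vtrace_step x J cs rs = (let \<beta> = vsnd (vfst (vfst cs)) in
     if cs \<noteq> Atom \<and> vsnd cs = Atom \<and> \<not> vex (\<lambda>l. \<not> vmem l (vsnd J)) \<beta> then vfst rs
     else if vsnd cs \<noteq> Atom \<and> vex (\<lambda>l. vfst l = Atom \<and> \<not> vmem l (vsnd J)) \<beta>
       then Cell (vlabel x (vfst J) (vsnd J)) (vrev rs)
     else Cell (vlabel x (vfst J) (vsnd J)) rs)"

definition vtrace :: "val \<Rightarrow> val" where
  "vtrace z = vtree (vtrace_step (vfst z)) (vsnd z)"

lemma ptime_vtrace: "ptime vtrace"
proof -
  let ?lab = "\<lambda>z. vlabel (vfst z) (vfst (vsnd z)) (vsnd (vsnd z))"
  \<comment> \<open>The label is the only part of the output not taken from the results of the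
    children; selecting from these or reversing them does not enlarge them, so a bound for the label
    suffices.\<close>
  have "ptime ?lab" by (intro ptime_vlabel ptime_intros)
  then obtain p where p: "polyfun p" "\<And>z. vsize (?lab z) \<le> p (vsize z)"
    by (rule ptime_size) blast
  have "ptime (\<lambda>z. vtree (vtrace_step (vfst z)) (vsnd z))"
  proof (rule ptime_vtree)
    show "ptime (\<lambda>z. vtrace_step (vfst (vfst z)) (vfst (vsnd z)) (vfst (vsnd (vsnd z)))
        (vsnd (vsnd (vsnd z))))"
      unfolding vtrace_step_def Let_def by (intro ptime_intros ptime_vlabel)
    show "polyfun (\<lambda>n. 1 + p (1 + n))" by (intro polyfun.intros polyfun_comp[OF p(1)])
    fix e v w r
    have "vsize (vlabel (vfst e) (vfst v) (vsnd v)) \<le> p (vsize (Cell (vfst e) v))"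
      using p(2)[of "Cell (vfst e) v"] by simp
    also have "\<dots> \<le> p (1 + (vsize e + vsize v + vsize w))"
      using vsize_vfst_le[of e] by (intro polyfun_mono[OF p(1)]) simp
    finally show "vsize (vtrace_step (vfst e) v w r)
        \<le> vsize r + (1 + p (1 + (vsize e + vsize v + vsize w)))"
      using vsize_vfst_le[of r] unfolding vtrace_step_def by (auto simp: Let_def)
  qed (intro ptime_intros)
  then show ?thesis by (simp add: vtrace_def[abs_def])
qed

lemma vmem_enc_lit:
  assumes "encodes_clause \<alpha> w"
  shows "vmem (enc_lit L) w \<longleftrightarrow> L \<in> \<alpha>"
  using assms inj_enc_lit by (auto simp: encodes_clause_iff vmem_def inj_image_mem_iff)

lemma vex_enc_lit:
  assumes "encodes_clause \<alpha> w"
  shows "vex P w \<longleftrightarrow> (\<exists>L\<in>\<alpha>. P (enc_lit L))"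
  using assms by (auto simp: encodes_clause_iff vex_def)

lemma encodes_treeE:
  assumes "encodes_tree E (Node x ts) v"
  obtains w vs where "v = Cell w (enc_list vs)" "E x w" "list_all2 (encodes_tree E) ts vs"
  using assms by (cases rule: encodes_tree.cases) auto

lemma encodes_tree_root:
  assumes "encodes_tree E t v"
  shows "E (root t) (vfst v)"
  using assms by (cases rule: encodes_tree.cases) auto

lemma vtree_node: "vtree s (Cell v (enc_list vs)) = s v (enc_list vs) (enc_list (map (vtree s) vs))"
  by (simp add: vforest_eq_vmap vmap_def)

lemma enc_list_eq_Atom [simp]: "enc_list xs = Atom \<longleftrightarrow> xs = []"
  by (cases xs) auto

lemma encodes_trace_of:
  assumes "encodes_qcbf \<psi> x" "free \<psi> = {}"
  shows "valid \<psi> P \<Longrightarrow> encodes_proof_tree P v \<Longrightarrow>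
     encodes_trace (trace_of \<psi> P) (vtree (vtrace_step x) v)"
proof (induction P arbitrary: v)
  case (Node J ts)
  obtain j vs where v: "v = Cell j (enc_list vs)"
    and j: "encodes_prod encodes_index encodes_clause J j"
    and vs: "list_all2 encodes_proof_tree ts vs"
    using Node.prems(2) unfolding encodes_proof_tree_def by (rule encodes_treeE)
  let ?rs = "map (trace_of \<psi>) ts" and ?ws = "map (vtree (vtrace_step x)) vs"
  have rs: "list_all2 encodes_trace ?rs ?ws"
    using vs Node.IH Node.prems(1)
    by (auto simp: list_all2_map1 list_all2_map2 elim!: list.rel_mono_strong)
  obtain w where w: "j = Cell (enc_index (fst J)) w" "encodes_clause (snd J) w"
    using j by (auto simp: encodes_judgement_iff)
  have lab: "encodes_label (label \<psi> J) (vlabel x (vfst j) (vsnd j))"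
    using encodes_label_vlabel[OF assms, of "fst J" "snd J" w] Node.prems(1) w by simp
  have lab_tree: "encodes_trace (Node (label \<psi> J) rs) (Cell (vlabel x (vfst j) (vsnd j)) (enc_list ws))"
    if "list_all2 encodes_trace rs ws" for rs ws
    using that lab unfolding encodes_trace_def by (intro encodes_tree.intros)
  have len: "length ts = length vs" using vs by (rule list_all2_lengthD)
  have hd: "encodes_clause (snd (hd (map root ts))) (vsnd (vfst (vfst (enc_list vs))))" if nonempty: "ts \<noteq> []"
  proof -
    obtain t ts' y vs' where tv: "ts = t # ts'" "vs = y # vs'" "encodes_proof_tree t y"
      using nonempty vs by (cases ts) (auto simp: list_all2_Cons1)
    then show ?thesis using encodes_tree_root[of _ t y]
      unfolding encodes_proof_tree_def by (fastforce simp: encodes_judgement_iff)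
  qed
  have s1: "vsnd (enc_list vs) = Atom \<longleftrightarrow> length vs \<le> 1" by (cases vs) auto
  have c1: "\<not> vex (\<lambda>l. \<not> vmem l (vsnd j)) (vsnd (vfst (vfst (enc_list vs))))
      \<longleftrightarrow> snd (hd (map root ts)) \<subseteq> snd J" if "ts \<noteq> []"
    unfolding vex_enc_lit[OF hd[OF that]] using vmem_enc_lit[OF w(2)] by (auto simp: w)
  have neg: "vfst (enc_lit L) = Atom \<longleftrightarrow> (\<exists>u. L = Neg u)" for L by (cases L) auto
  have c2: "vex (\<lambda>l. vfst l = Atom \<and> \<not> vmem l (vsnd j)) (vsnd (vfst (vfst (enc_list vs))))
      \<longleftrightarrow> (\<exists>u. Neg u \<in> snd (hd (map root ts)) - snd J)" if "ts \<noteq> []"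
    unfolding vex_enc_lit[OF hd[OF that]] using vmem_enc_lit[OF w(2)] by (auto simp: w neg)
  have rev: "vrev (enc_list ?ws) = enc_list (rev ?ws)" by (simp add: vrev_def)
  have rs_rev: "list_all2 encodes_trace (rev ?rs) (rev ?ws)" using rs by simp
  show ?case
  proof (cases "ts = []")
    case True
    then show ?thesis using lab_tree[OF rs] len unfolding v vtree_node
      by (simp add: vtrace_step_def trace_step_def)
  next
    case False
    have ne: "enc_list vs \<noteq> Atom" using False len by auto
    have hdr: "encodes_trace (hd ?rs) (vfst (enc_list ?ws))"
      using rs False by (cases ts; cases vs) auto
    have l1: "length (map root ts) = 1 \<longleftrightarrow> vsnd (enc_list vs) = Atom"
      using s1 False len by (cases ts) auto
    have l2: "2 \<le> length (map root ts) \<longleftrightarrow> vsnd (enc_list vs) \<noteq> Atom"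
      using s1 False len by (cases ts) auto
    show ?thesis
      unfolding v vtree_node trace_of.simps trace_step_def
        vtrace_step_def[of x j "enc_list vs"] Let_def l1 l2
        c1[OF False] c2[OF False] rev
      using hdr lab_tree[OF rs] lab_tree[OF rs_rev] ne by auto
  qed
qed

section \<open>Translating traces in polynomial time\<close>

text \<open>The literal that a binding falsifies has the sign opposite to the bound value.\<close>

definition vclause_of :: "val \<Rightarrow> val" where
  "vclause_of a = vmap (\<lambda>p. Cell (vbool (vsnd p = Atom)) (vfst p)) a"

lemma ptime_vclause_of: "ptime f \<Longrightarrow> ptime (\<lambda>e. vclause_of (f e))"
  unfolding vclause_of_def by (intro ptime_intros)

lemma encodes_vclause_of:
  assumes "encodes_assignment a w"
  shows "encodes_clause (clause_of a) (vclause_of w)"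
proof -
  let ?f = "\<lambda>p. Cell (vbool (vsnd p = Atom)) (vfst p)"
  have w: "distinct (dec_list w)" "set (dec_list w) = enc_binding ` Map.graph a"
    using assms by (auto simp: encodes_assignment_iff)
  have f: "?f (enc_binding (u, b)) = enc_lit (if b then Neg u else Pos u)" for u b
    by (auto simp: enc_binding_def)
  have "inj_on ?f (set (dec_list w))"
    unfolding w(2) by (auto intro!: inj_onI simp: enc_binding_def)
  then have "distinct (map ?f (dec_list w))" using w(1) by (simp add: distinct_map)
  moreover have "?f ` enc_binding ` Map.graph a = enc_lit ` clause_of a"
  proof
    show "?f ` enc_binding ` Map.graph a \<subseteq> enc_lit ` clause_of a"
    proof
      fix y assume "y \<in> ?f ` enc_binding ` Map.graph a"
      then obtain u b where "a u = Some b" "y = enc_lit (if b then Neg u else Pos u)"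
        using f by (auto simp: graph_def)
      then show "y \<in> enc_lit ` clause_of a"
        by (intro image_eqI[of _ _ "if b then Neg u else Pos u"]) (auto simp: clause_of_def)
    qed
    show "enc_lit ` clause_of a \<subseteq> ?f ` enc_binding ` Map.graph a"
    proof
      fix y assume "y \<in> enc_lit ` clause_of a"
      then obtain M where M: "lit_false a M" "y = enc_lit M" by (auto simp: clause_of_def)
      then obtain u b where "a u = Some b" "M = (if b then Neg u else Pos u)" by (cases M) auto
      then have "y = ?f (enc_binding (u, b))" "(u, b) \<in> Map.graph a"
        using M f by (auto simp: graph_def)
      then show "y \<in> ?f ` enc_binding ` Map.graph a" by blast
    qed
  qed
  ultimately show ?thesis using w by (simp add: encodes_clause_iff vclause_of_def vmap_def)
qed

text \<open>In a coherent set the children of all quantifiers lie on one branch, so comparing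
  prefixes finds the deepest one. The start value \<open>Atom\<close> codes the root, which is a
  prefix of everything.\<close>

definition vloc :: "val \<Rightarrow> val" where
  "vloc S = foldr (\<lambda>l b. let k = vappend (vfst l) (Cell Atom Atom) in
     if vmem b (vprefs k) then k else b) (dec_list S) Atom"

lemma ptime_vloc:
  assumes "ptime f"
  shows "ptime (\<lambda>e. vloc (f e))"
  unfolding vloc_def
proof (rule ptime_foldr[OF assms ptime_Atom])
  show "ptime (\<lambda>w. let k = vappend (vfst (vfst (vsnd w))) (Cell Atom Atom) in
     if vmem (vsnd (vsnd w)) (vprefs k) then k else (vsnd (vsnd w)))"
    unfolding Let_def by (intro ptime_intros ptime_vprefs)
  show "polyfun (\<lambda>n. n + 3)" by (intro polyfun.intros)
  show "vsize (foldr (\<lambda>l b. let k = vappend (vfst l) (Cell Atom Atom) in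
     if vmem b (vprefs k) then k else b) ys Atom) \<le> vsize e + vsize (enc_list ys) + 3" for e ys
  proof (induction ys)
    case (Cons y ys)
    have "vsize (vappend (vfst y) (Cell Atom Atom)) \<le> vsize y + 3"
      using vsize_vappend[of "vfst y" "Cell Atom Atom"] vsize_vfst_le[of y] by simp
    then show ?case using Cons by (auto simp: Let_def)
  qed simp
qed

lemma loc_upper:
  assumes "\<And>l. l \<in> S \<Longrightarrow> located_var \<psi> l" "coherent \<psi> S" "l \<in> S"
  shows "prefix (fst l @ [0]) (loc S)"
proof -
  obtain k u where k: "(k, u) \<in> S" "loc S = k @ [0]" "\<And>l. l \<in> S \<Longrightarrow> l \<noteq> (k, u) \<Longrightarrow> follows \<psi> k l"
    using loc_max[of S \<psi>] assms by blast
  show ?thesis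
  proof (cases "l = (k, u)")
    case False
    obtain n w where l: "l = (n, w)" by fastforce
    have "follows \<psi> k (n, w)" using k(3) assms(3) False l by blast
    then have "prefix (n @ [0]) k"
      using located_var_below[of \<psi> n w k] assms(1)[OF assms(3)] l by (simp add: follows_def)
    then show ?thesis using k(2) l by (simp add: prefix_order.trans[of _ k])
  qed (use k in simp)
qed

lemma loc_attained:
  assumes "\<And>l. l \<in> S \<Longrightarrow> located_var \<psi> l" "coherent \<psi> S" "S \<noteq> {}"
  shows "\<exists>l\<in>S. loc S = fst l @ [0]"
  using loc_max[of S \<psi>] assms by (metis fst_conv)

text \<open>The invariant of the fold in \<open>vloc\<close>: the location of the enlarged set is
  one of the two candidates and has both of them as prefixes.\<close>

lemma loc_insert:
  assumes "\<And>m. m \<in> insert l S \<Longrightarrow> located_var \<psi> m" "coherent \<psi> (insert l S)"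
  shows "loc (insert l S) = (if prefix (loc S) (fst l @ [0]) then fst l @ [0] else loc S)"
proof (cases "S = {}")
  case True
  have "\<exists>m\<in>insert l S. loc (insert l S) = fst m @ [0]"
    using loc_attained[OF assms] by blast
  then show ?thesis using True by (simp add: loc_def)
next
  case False
  let ?c = "loc (insert l S)"
  have S: "\<And>m. m \<in> S \<Longrightarrow> located_var \<psi> m" "coherent \<psi> S"
    using assms unfolding coherent_def by blast+
  obtain m where m: "m \<in> S" "loc S = fst m @ [0]" using loc_attained[OF S False] by blast
  have b: "prefix (loc S) ?c" using loc_upper[OF assms] m by simp
  have k: "prefix (fst l @ [0]) ?c" using loc_upper[OF assms, of l] by simp
  obtain m' where m': "m' \<in> insert l S" "?c = fst m' @ [0]" using loc_attained[OF assms] by blast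
  show ?thesis
  proof (cases "m' = l")
    case True
    then show ?thesis using m' b by simp
  next
    case False
    then have "prefix ?c (loc S)" using m' loc_upper[OF S, of m'] by simp
    then have "?c = loc S" using b by (simp add: prefix_order.antisym)
    then show ?thesis using k by (auto intro: prefix_order.antisym)
  qed
qed

lemma vloc_list:
  assumes "\<And>l. l \<in> set ls \<Longrightarrow> located_var \<psi> l" "coherent \<psi> (set ls)"
  shows "vloc (enc_list (map enc_located ls)) = enc_index (loc (set ls))"
  using assms
proof (induction ls)
  case Nil
  then show ?case by (simp add: vloc_def loc_def)
next
  case (Cons l ls)
  have coh: "coherent \<psi> (set ls)" using Cons.prems(2) unfolding coherent_def by auto
  have IH: "vloc (enc_list (map enc_located ls)) = enc_index (loc (set ls))"
    using Cons.IH Cons.prems(1) coh by simp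
  have k: "vappend (vfst (enc_located l)) (Cell Atom Atom) = enc_index (fst l @ [0])"
    by (simp add: enc_located_def vappend_def enc_index_def)
  have "vloc (enc_list (map enc_located (l # ls))) =
      (if vmem (vloc (enc_list (map enc_located ls))) (vprefs (enc_index (fst l @ [0])))
       then enc_index (fst l @ [0]) else vloc (enc_list (map enc_located ls)))"
    by (simp add: vloc_def k Let_def)
  also have "\<dots> = enc_index (loc (insert l (set ls)))"
    unfolding IH vmem_vprefs using loc_insert[of l "set ls" \<psi>] Cons.prems by simp
  finally show ?case by simp
qed

lemma vloc_eq:
  assumes "\<And>l. l \<in> S \<Longrightarrow> located_var \<psi> l" "coherent \<psi> S" "set (dec_list w) = enc_located ` S"
  shows "vloc w = enc_index (loc S)"
proof -
  let ?ls = "map (inv enc_located) (dec_list w)"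
  have m: "map enc_located ?ls = dec_list w"
    unfolding map_map using assms(3) by (intro map_idI) (auto simp: f_inv_into_f)
  have s: "set ?ls = S" using assms(3) inj_enc_located by (simp add: image_image)
  have "vloc (enc_list (map enc_located ?ls)) = enc_index (loc (set ?ls))"
    using assms(1,2) by (intro vloc_list[of _ \<psi>]) (simp_all only: s)
  then show ?thesis unfolding m s by simp
qed

section \<open>Flow paths, on codes\<close>

definition vups :: "val \<Rightarrow> val \<Rightarrow> val" where
  "vups i t = vfilter (\<lambda>k. vmem t (vprefs k) \<and> k \<noteq> i) (vprefs i)"

definition vdowns :: "val \<Rightarrow> val \<Rightarrow> val" where
  "vdowns t j = vrev (vfilter (\<lambda>k. vmem t (vprefs k) \<and> k \<noteq> t) (vprefs j))"

definition vwrap :: "val \<Rightarrow> val \<Rightarrow> val \<Rightarrow> val" where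
  "vwrap ks \<alpha> Q = foldr (\<lambda>k q. Cell (Cell k \<alpha>) (Cell q Atom)) (dec_list ks) Q"

lemma ptime_vups:
  assumes "ptime f" "ptime g"
  shows "ptime (\<lambda>e. vups (f e) (g e))"
  unfolding vups_def by (intro ptime_intros ptime_vprefs assms assms[THEN ptime_comp])

lemma ptime_vdowns:
  assumes "ptime f" "ptime g"
  shows "ptime (\<lambda>e. vdowns (f e) (g e))"
  unfolding vdowns_def by (intro ptime_intros ptime_vprefs assms assms[THEN ptime_comp])

lemma vups_eq: "vups (enc_index i) (enc_index t) = enc_list (map enc_index (ups i t))"
  unfolding vups_def ups_def vprefs_enc_index[of i]
  by (intro vfilter_map) (simp add: vmem_vprefs)

lemma vdowns_eq: "vdowns (enc_index t) (enc_index j) = enc_list (map enc_index (downs t j))"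
proof -
  have "vfilter (\<lambda>k. vmem (enc_index t) (vprefs k) \<and> k \<noteq> enc_index t) (vprefs (enc_index j))
      = enc_list (map enc_index (filter (\<lambda>k. prefix t k \<and> k \<noteq> t) (prefixes j)))"
    unfolding vprefs_enc_index[of j] by (intro vfilter_map) (simp add: vmem_vprefs)
  then show ?thesis by (simp add: vdowns_def downs_def vrev_def rev_map)
qed

text \<open>The clause is copied once for each index of the path, together with three cells and one
  \<open>Atom\<close>; this accounts for the factor and the 4.\<close>

lemma vsize_vwrap: "vsize (vwrap ks \<alpha> Q) \<le> vsize Q + vsize ks * (vsize \<alpha> + 4)"
proof -
  have "vsize (foldr (\<lambda>k q. Cell (Cell k \<alpha>) (Cell q Atom)) xs Q)
      \<le> vsize Q + vsize (enc_list xs) * (vsize \<alpha> + 4)" for xs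
    by (induction xs) (auto simp: algebra_simps)
  from this[of "dec_list ks"] show ?thesis by (simp add: vwrap_def)
qed

lemma ptime_vwrap:
  assumes "ptime f" "ptime g" "ptime h"
  shows "ptime (\<lambda>e. vwrap (f e) (g e) (h e))"
proof -
  have "ptime (\<lambda>z. vwrap (vfst z) (vfst (vsnd z)) (vsnd (vsnd z)))"
    unfolding vwrap_def
  proof (rule ptime_foldr)
    show "polyfun (\<lambda>n. n + n * (n + 4))" by (intro polyfun.intros)
    fix e ys
    let ?n = "vsize e + vsize (enc_list ys)"
    have sz: "vsize (vsnd (vsnd e)) \<le> ?n" "vsize (vfst (vsnd e)) \<le> ?n"
      using vsize_vsnd_le[of e] vsize_vsnd_le[of "vsnd e"] vsize_vfst_le[of "vsnd e"] by simp_all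
    have "vsize (enc_list ys) * (vsize (vfst (vsnd e)) + 4) \<le> ?n * (?n + 4)"
      using sz by (intro mult_le_mono) auto
    then show "vsize (foldr (\<lambda>k q. Cell (Cell k (vfst (vsnd e))) (Cell q Atom)) ys (vsnd (vsnd e)))
        \<le> ?n + ?n * (?n + 4)"
      using vsize_vwrap[of "enc_list ys" "vfst (vsnd e)" "vsnd (vsnd e)"] sz
      by (simp add: vwrap_def)
  qed (intro ptime_intros)+
  from ptime_comp[OF this, of "\<lambda>e. Cell (f e) (Cell (g e) (h e))"] show ?thesis
    by (simp add: ptime_Cell assms)
qed

lemma encodes_wrap:
  assumes "encodes_clause \<alpha> w" "encodes_proof_tree Q q"
  shows "encodes_proof_tree (wrap ks \<alpha> Q) (vwrap (enc_list (map enc_index ks)) w q)"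
proof (induction ks)
  case Nil
  then show ?case using assms by (simp add: wrap_def vwrap_def)
next
  case (Cons k ks)
  let ?Q = "wrap ks \<alpha> Q" and ?q = "vwrap (enc_list (map enc_index ks)) w q"
  have "encodes_proof_tree (Node (k, \<alpha>) [?Q]) (Cell (Cell (enc_index k) w) (enc_list [?q]))"
    unfolding encodes_proof_tree_def
    by (rule encodes_tree.intros)
      (use Cons assms(1) in \<open>simp_all add: encodes_judgement_iff encodes_proof_tree_def\<close>)
  then show ?case by (simp add: wrap_def vwrap_def)
qed

text \<open>A clause must be recognised by its tag, since the code of a nonempty clause has the same
  outer shape as that of a compound formula; the empty clause falls under the catch-all
  equation.\<close>

fun formula_paths :: "val \<Rightarrow> val list" where
  "formula_paths (Cell t (Cell x y)) =
     (if t = Atom then [Atom]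
      else if t = enc_nat 1 then map (Cell Atom) (formula_paths x) @ map (Cell (enc_nat 1)) (formula_paths y)
      else map (Cell Atom) (formula_paths y))"
| "formula_paths _ = [Atom]"

definition vpaths :: "val \<Rightarrow> val" where
  "vpaths x = enc_list (formula_paths x)"

text \<open>Paths come from disjoint parts of the code, which bounds their number. One step of a
  path adds a cell and the code of 0 or 1, hence the factor.\<close>

lemma formula_paths_bounds:
  "length (formula_paths x) \<le> vsize x \<and> (\<forall>p\<in>set (formula_paths x). vsize p \<le> (1 + vsize (enc_nat 1)) * vsize x)"
proof (induction x rule: formula_paths.induct)
  case (1 t x y)
  let ?c = "1 + vsize (enc_nat 1)"
  have IHx: "length (formula_paths x) \<le> vsize x" "\<And>p. p \<in> set (formula_paths x) \<Longrightarrow> vsize p \<le> ?c * vsize x"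
    if "t = enc_nat 1" using 1(1) that by auto
  have IHy: "length (formula_paths y) \<le> vsize y" "\<And>p. p \<in> set (formula_paths y) \<Longrightarrow> vsize p \<le> ?c * vsize y"
    if "t \<noteq> Atom" using 1(2,3) that by (cases "t = enc_nat 1"; auto)+
  have eq: "?c * vsize (Cell t (Cell x y)) = ?c * (2 + vsize t) + ?c * vsize x + ?c * vsize y"
    by (simp add: algebra_simps)
  have c2: "1 + vsize (enc_nat 1) \<le> ?c * (2 + vsize t)" "2 \<le> ?c * (2 + vsize t)"
    by (simp_all add: algebra_simps)
  have "length (formula_paths (Cell t (Cell x y))) \<le> vsize (Cell t (Cell x y))"
    using IHx(1) IHy(1) by auto
  moreover have "vsize p \<le> ?c * vsize (Cell t (Cell x y))"
    if p: "p \<in> set (formula_paths (Cell t (Cell x y)))" for p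
    unfolding eq using p c2 IHx(2) IHy(2)
    by (fastforce split: if_splits simp del: enc_nat_eq_iff)
  ultimately show ?case by blast
qed auto

lemma ptime_vpaths:
  assumes "ptime f"
  shows "ptime (\<lambda>e. vpaths (f e))"
proof -
  \<comment> \<open>\<open>formula_paths\<close> recurses on the components of the second component,
    but structural recursion provides results only for immediate components. Each result therefore
    also carries those for its own two components.\<close>
  define h where "h e x = Cell (vpaths x) (Cell (vpaths (vfst x)) (vpaths (vsnd x)))" for e x :: val
  let ?a = "Cell Atom Atom"
  let ?s = "\<lambda>e t b ht hb. Cell
     (if t = Atom \<or> b = Atom then ?a
      else if t = enc_nat 1 then vappend (vmap (Cell Atom) (vfst (vsnd hb))) (vmap (Cell (enc_nat 1)) (vsnd (vsnd hb)))
      else vmap (Cell Atom) (vsnd (vsnd hb))) (Cell (vfst ht) (vfst hb))"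
  let ?c = "1 + vsize (enc_nat 1)"
  have "ptime (\<lambda>e. h e (f e))"
  proof (rule ptime_rec[where s = ?s, OF _ _ _ _ _ _ assms])
    show "ptime (\<lambda>_. Cell ?a (Cell ?a ?a))" by (rule ptime_const)
    show "ptime (\<lambda>z. ?s (vfst z) (vfst (vsnd z)) (vfst (vsnd (vsnd z)))
              (vfst (vsnd (vsnd (vsnd z)))) (vsnd (vsnd (vsnd (vsnd z)))))"
      by (intro ptime_intros)
    show "h e Atom = Cell ?a (Cell ?a ?a)" for e by (simp add: h_def vpaths_def)
    show "h e (Cell t b) = ?s e t b (h e t) (h e b)" for e t b
      by (cases b) (simp_all add: h_def vpaths_def vmap_def vappend_def)
    \<comment> \<open>Three lists within the bound \<open>b\<close> below, joined by two cells: 5 is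
      2 plus the three leading ones.\<close>
    show "polyfun (\<lambda>n. 5 + 3 * (n * (1 + ?c * n)))" by (intro polyfun.intros)
    fix e x
    let ?n = "vsize e + vsize x"
    have b: "vsize (vpaths y) \<le> 1 + ?n * (1 + ?c * ?n)" if "vsize y \<le> ?n" for y
    proof -
      have "length (formula_paths y) \<le> ?n" using formula_paths_bounds[of y] that by simp
      moreover have "vsize p \<le> ?c * ?n" if p: "p \<in> set (formula_paths y)" for p
      proof -
        have "vsize p \<le> ?c * vsize y" using formula_paths_bounds[of y] p by blast
        also have "\<dots> \<le> ?c * ?n" using \<open>vsize y \<le> ?n\<close> by (intro mult_le_mono) auto
        finally show ?thesis .
      qed
      ultimately show ?thesis unfolding vpaths_def by (rule vsize_enc_list_le)
    qed
    have "vsize x \<le> ?n" "vsize (vfst x) \<le> ?n" "vsize (vsnd x) \<le> ?n"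
      using vsize_vfst_le[of x] vsize_vsnd_le[of x] by simp_all
    from this[THEN b] show "vsize (h e x) \<le> 5 + 3 * (?n * (1 + ?c * ?n))"
      unfolding h_def vsize.simps by linarith
  qed
  from ptime_vfst[OF this] show ?thesis by (simp add: h_def)
qed

lemma vpaths_eq: "encodes_qcbf \<phi> x \<Longrightarrow> vpaths x = enc_list (map enc_index (clause_paths \<phi>))"
proof -
  have "encodes_qcbf \<phi> x \<Longrightarrow> formula_paths x = map enc_index (clause_paths \<phi>)"
  proof (induction \<phi> arbitrary: x)
    case (Clause \<alpha>)
    then obtain w where "x = Cell Atom w" by auto
    then show ?case by (cases w) auto
  qed auto
  then show "encodes_qcbf \<phi> x \<Longrightarrow> vpaths x = enc_list (map enc_index (clause_paths \<phi>))"
    by (simp add: vpaths_def)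
qed

lemma clause_paths_sound: "i \<in> set (clause_paths \<psi>) \<Longrightarrow> \<exists>\<alpha>. sub_at \<psi> i = Some (Clause \<alpha>)"
  by (induction \<psi> arbitrary: i) auto

text \<open>Codes of one label may list its elements in different orders, so labels cannot be
  compared by equality of codes.\<close>

definition vseteq :: "val \<Rightarrow> val \<Rightarrow> bool" where
  "vseteq x y \<longleftrightarrow> \<not> vex (\<lambda>l. \<not> vmem l y) x \<and> \<not> vex (\<lambda>l. \<not> vmem l x) y"

lemma ptest_vseteq:
  assumes "ptime f" "ptime g"
  shows "ptest (\<lambda>e. vseteq (f e) (g e))"
  unfolding vseteq_def by (intro ptime_intros assms assms[THEN ptime_comp])

lemma vseteq_iff: "vseteq x y \<longleftrightarrow> set (dec_list x) = set (dec_list y)"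
  by (auto simp: vseteq_def vex_def vmem_def)

lemma graph_eq_iff: "Map.graph a = Map.graph b \<longleftrightarrow> a = b"
proof
  assume eq: "Map.graph a = Map.graph b"
  have "a u = Some y \<longleftrightarrow> b u = Some y" for u y
    using eq unfolding graph_def set_eq_iff by auto
  then show "a = b" by (metis ext not_None_eq)
qed simp

lemma vseteq_label:
  assumes "encodes_label L l" "encodes_label M m"
  shows "vseteq (vfst l) (vfst m) \<and> vseteq (vsnd l) (vsnd m) \<longleftrightarrow> L = M"
  using assms
  by (auto simp: encodes_label_iff vseteq_iff inj_image_eq_iff[OF inj_enc_located]
      inj_image_eq_iff[OF inj_enc_binding] graph_eq_iff prod_eq_iff)

definition vleaf :: "val \<Rightarrow> val \<Rightarrow> val" where
  "vleaf x L = vfst (vfilter (\<lambda>i. vseteq (vfst (vlabel x i (vsnd (vsub x i)))) (vfst L)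
     \<and> vseteq (vsnd (vlabel x i (vsnd (vsub x i)))) (vsnd L)) (vpaths x))"

lemma ptime_vleaf:
  assumes "ptime f" "ptime g"
  shows "ptime (\<lambda>e. vleaf (f e) (g e))"
  unfolding vleaf_def
  by (intro ptime_intros ptest_vseteq ptime_vlabel ptime_vsub ptime_vpaths assms assms[THEN ptime_comp])

lemma vleaf_eq:
  assumes "encodes_qcbf \<psi> x" "qcbf_instance \<psi>" "encodes_label L l" "trace_label \<psi> L" "leaf_node \<psi> L"
  shows "vleaf x l = enc_index (leaf_index \<psi> L)"
proof -
  let ?Q = "\<lambda>i. \<exists>\<alpha>. sub_at \<psi> i = Some (Clause \<alpha>) \<and> label \<psi> (i, \<alpha>) = L"
  let ?P = "\<lambda>i. vseteq (vfst (vlabel x i (vsnd (vsub x i)))) (vfst l)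
     \<and> vseteq (vsnd (vlabel x i (vsnd (vsub x i)))) (vsnd l)"
  have wf: "wf_qcbf \<psi>" "free \<psi> = {}" using assms(2) by (auto simp: qcbf_instance_def)
  have "?P (enc_index i) \<longleftrightarrow> ?Q i" if i: "i \<in> set (clause_paths \<psi>)" for i
  proof -
    obtain \<alpha> where \<alpha>: "sub_at \<psi> i = Some (Clause \<alpha>)" using clause_paths_sound[OF i] by blast
    then obtain w where w: "vsub x (enc_index i) = Cell Atom w" "encodes_clause \<alpha> w"
      using encodes_qcbf_vsub[OF assms(1) \<alpha>] by auto
    have "encodes_label (label \<psi> (i, \<alpha>)) (vlabel x (enc_index i) w)"
      using encodes_label_vlabel[OF assms(1) wf(2) clause_judgement[OF wf(1) \<alpha>] w(2)] .
    from vseteq_label[OF this assms(3)] show ?thesis using \<alpha> w(1) by simp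
  qed
  then have "vfilter ?P (vpaths x) = enc_list (map enc_index (filter ?Q (clause_paths \<psi>)))"
    unfolding vpaths_eq[OF assms(1)] by (rule vfilter_map)
  moreover have "filter ?Q (clause_paths \<psi>) \<noteq> []"
    using leaf_node_label[OF assms(4,5)] clause_paths_complete by (fastforce simp: filter_empty_conv)
  ultimately show ?thesis
    unfolding vleaf_def leaf_index_def by (cases "filter ?Q (clause_paths \<psi>)") auto
qed

text \<open>Appending the codes of the children's sets gives their union with repetitions, which
  \<open>vloc\<close> tolerates.\<close>

definition vindex :: "val \<Rightarrow> val \<Rightarrow> val \<Rightarrow> val" where
  "vindex x L cs =
     (if cs = Atom then vleaf x L
      else if vsnd cs = Atom then vfst (vfst (vfilter (\<lambda>l. \<not> vmem l (vfst L)) (vfst (vfst (vfst cs)))))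
      else vloc (vappend (vfst (vfst (vfst cs))) (vfst (vfst (vfst (vsnd cs))))))"

text \<open>Leaves and unary nodes share a case: the list of results is already the list of
  premises, empty for a leaf.\<close>

definition vproof_step :: "val \<Rightarrow> val \<Rightarrow> val \<Rightarrow> val \<Rightarrow> val" where
  "vproof_step x L cs rs =
     (let i = vindex x L cs; \<alpha> = vclause_of (vsnd L); L0 = vfst (vfst cs); L1 = vfst (vfst (vsnd cs)) in
      vwrap (vups i (vloc (vfst L))) \<alpha> (Cell (Cell i \<alpha>)
        (if vsnd cs = Atom then rs
         else Cell (vwrap (vdowns (vloc (vfst L0)) i) (vclause_of (vsnd L0)) (vfst rs))
           (Cell (vwrap (vdowns (vloc (vfst L1)) i) (vclause_of (vsnd L1)) (vfst (vsnd rs))) Atom))))"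

definition vproof :: "val \<Rightarrow> val" where
  "vproof z = vtree (vproof_step (vfst z)) (vsnd z)"

lemma ptime_vindex:
  assumes "ptime f" "ptime g" "ptime h"
  shows "ptime (\<lambda>e. vindex (f e) (g e) (h e))"
  unfolding vindex_def
  by (intro ptime_intros ptime_vleaf ptime_vloc assms assms[THEN ptime_comp])

lemma vproof_step_size:
  "\<exists>p. polyfun p \<and> (\<forall>e L cs rs. vsize (vproof_step (vfst e) L cs rs)
     \<le> vsize rs + p (vsize e + vsize L + vsize cs))"
proof -
  let ?x = "\<lambda>z. vfst (vfst z)" and ?L = "\<lambda>z. vfst (vsnd z)" and ?cs = "\<lambda>z. vsnd (vsnd z)"
  let ?i = "\<lambda>z. vindex (?x z) (?L z) (?cs z)"
  let ?La = "\<lambda>z. vfst (vfst (?cs z))" and ?Lb = "\<lambda>z. vfst (vfst (vsnd (?cs z)))"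
  \<comment> \<open>Everything that the step computes apart from the children's results, packed into
    one value so that a single polynomial bounds all pieces.\<close>
  let ?parts = "\<lambda>z. Cell (Cell (?i z) (vclause_of (vsnd (?L z)))) (Cell (vups (?i z) (vloc (vfst (?L z))))
    (Cell (Cell (vdowns (vloc (vfst (?La z))) (?i z)) (vclause_of (vsnd (?La z))))
      (Cell (vdowns (vloc (vfst (?Lb z))) (?i z)) (vclause_of (vsnd (?Lb z))))))"
  have "ptime ?parts"
    by (intro ptime_intros ptime_vindex ptime_vclause_of ptime_vups ptime_vdowns ptime_vloc)
  then obtain p where p: "polyfun p" "\<And>z. vsize (?parts z) \<le> p (vsize z)"
    by (rule ptime_size) blast
  \<comment> \<open>The argument \<open>2 + n\<close> is the size of the packed input. Each of the
    three paths contributes one product, the first summand pays for the judgement at the chosen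
    index, and 5 collects joining cells and the off-by-one in \<open>r\<close> below.\<close>
  let ?q = "\<lambda>n. p (2 + n) + 5 + 3 * (p (2 + n) * (p (2 + n) + 4))"
  show ?thesis
  proof (intro exI conjI allI)
    show "polyfun ?q" by (intro polyfun.intros polyfun_comp[OF p(1)])
    fix e L cs rs
    let ?n = "vsize e + vsize L + vsize cs"
    let ?P = "p (2 + ?n)"
    define i where "i = vindex (vfst e) L cs"
    define \<alpha> where "\<alpha> = vclause_of (vsnd L)"
    define u where "u = vups i (vloc (vfst L))"
    define da where "da = vdowns (vloc (vfst (vfst (vfst cs)))) i"
    define db where "db = vdowns (vloc (vfst (vfst (vfst (vsnd cs))))) i"
    define aa where "aa = vclause_of (vsnd (vfst (vfst cs)))"
    define ab where "ab = vclause_of (vsnd (vfst (vfst (vsnd cs))))"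
    have "vsize (?parts (Cell e (Cell L cs))) \<le> ?P" using p(2)[of "Cell e (Cell L cs)"] by (simp add: add.assoc)
    then have sz: "vsize i + vsize \<alpha> + 1 \<le> ?P" "vsize u \<le> ?P" "vsize da \<le> ?P" "vsize db \<le> ?P"
      "vsize aa \<le> ?P" "vsize ab \<le> ?P" "vsize \<alpha> \<le> ?P"
      by (simp_all add: i_def[symmetric] \<alpha>_def[symmetric] u_def[symmetric] da_def[symmetric]
        db_def[symmetric] aa_def[symmetric] ab_def[symmetric])
    have prod: "vsize u * (vsize \<alpha> + 4) \<le> ?P * (?P + 4)" "vsize da * (vsize aa + 4) \<le> ?P * (?P + 4)"
      "vsize db * (vsize ab + 4) \<le> ?P * (?P + 4)"
      using sz by (intro mult_le_mono; simp)+
    \<comment> \<open>The extra 1 is for \<open>rs = Atom\<close>, where both projections return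
      \<open>Atom\<close>.\<close>
    have r: "vsize (vfst rs) + vsize (vfst (vsnd rs)) \<le> vsize rs + 1"
      using vsize_vfst_le[of "vsnd rs"] by (cases rs) auto
    let ?sub = "if vsnd cs = Atom then rs
      else Cell (vwrap da aa (vfst rs)) (Cell (vwrap db ab (vfst (vsnd rs))) Atom)"
    have "vsize ?sub \<le> vsize rs + 4 + 2 * (?P * (?P + 4))"
      using vsize_vwrap[of da aa "vfst rs"] vsize_vwrap[of db ab "vfst (vsnd rs)"] prod r by auto
    moreover have eq: "vproof_step (vfst e) L cs rs = vwrap u \<alpha> (Cell (Cell i \<alpha>) ?sub)"
      by (simp add: vproof_step_def Let_def i_def \<alpha>_def u_def da_def db_def aa_def ab_def)
    ultimately show "vsize (vproof_step (vfst e) L cs rs) \<le> vsize rs + ?q ?n"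
      using vsize_vwrap[of u \<alpha> "Cell (Cell i \<alpha>) ?sub"] prod(1) sz(1)
      unfolding eq vsize.simps by linarith
  qed
qed

lemma ptime_vproof: "ptime vproof"
proof -
  obtain p where p: "polyfun p" "\<And>e L cs rs. vsize (vproof_step (vfst e) L cs rs)
     \<le> vsize rs + p (vsize e + vsize L + vsize cs)"
    using vproof_step_size by blast
  have "ptime (\<lambda>z. vtree (vproof_step (vfst z)) (vsnd z))"
  proof (rule ptime_vtree[OF _ p])
    show "ptime (\<lambda>z. vproof_step (vfst (vfst z)) (vfst (vsnd z)) (vfst (vsnd (vsnd z)))
        (vsnd (vsnd (vsnd z))))"
      unfolding vproof_step_def Let_def
      by (intro ptime_intros ptime_vindex ptime_vclause_of ptime_vups ptime_vdowns ptime_vloc ptime_vwrap)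
  qed (intro ptime_intros)
  then show ?thesis by (simp add: vproof_def[abs_def])
qed

lemma encodes_label_vloc:
  assumes "encodes_label L l" "trace_label \<psi> L"
  shows "vloc (vfst l) = enc_index (loc (fst L))"
  using assms by (intro vloc_eq[of _ \<psi>]) (auto simp: encodes_label_iff trace_label_def split: prod.splits)

lemma encodes_label_clause:
  assumes "encodes_label L l"
  shows "encodes_clause (clause_of (snd L)) (vclause_of (vsnd l))"
  using assms by (intro encodes_vclause_of) (auto simp: encodes_label_iff encodes_assignment_iff)

lemma encodes_proof_of:
  assumes "encodes_qcbf \<psi> x" "qcbf_instance \<psi>"
  shows "is_trace \<psi> T \<Longrightarrow> encodes_trace T v \<Longrightarrow>
     encodes_proof_tree (proof_of \<psi> T) (vtree (vproof_step x) v)"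
proof (induction T arbitrary: v)
  case (Node L ts)
  obtain l vs where v: "v = Cell l (enc_list vs)" and l: "encodes_label L l"
    and vs: "list_all2 encodes_trace ts vs"
    using Node.prems(2) unfolding encodes_trace_def by (rule encodes_treeE)
  let ?rs = "map (proof_of \<psi>) ts" and ?ws = "map (vtree (vproof_step x)) vs"
  have rs: "list_all2 encodes_proof_tree ?rs ?ws"
    using vs Node.IH Node.prems(1)
    by (auto simp: list_all2_map1 list_all2_map2 elim!: list.rel_mono_strong)
  have tl: "trace_label \<psi> L" and tn: "trace_node \<psi> L (map root ts)" using Node.prems by auto
  let ?\<alpha> = "clause_of (snd L)" and ?w = "vclause_of (vsnd l)"
  have w: "encodes_clause ?\<alpha> ?w" using encodes_label_clause[OF l] .
  have t: "vloc (vfst l) = enc_index (loc (fst L))" using encodes_label_vloc[OF l tl] .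
  have child: "encodes_label (root u) (vfst y)" "trace_label \<psi> (root u)"
    if "u \<in> set ts" "encodes_trace u y" for u y
  proof -
    show "encodes_label (root u) (vfst y)"
      using that(2) unfolding encodes_trace_def by (rule encodes_tree_root)
    have "is_trace \<psi> u" using that(1) Node.prems(1) by simp
    then show "trace_label \<psi> (root u)" by (metis is_trace.simps tree.collapse)
  qed
  have node: "encodes_proof_tree (wrap (ups i (loc (fst L))) ?\<alpha> (Node (i, ?\<alpha>) qs))
      (vwrap (vups (enc_index i) (vloc (vfst l))) ?w (Cell (Cell (enc_index i) ?w) (enc_list us)))"
    if "list_all2 encodes_proof_tree qs us" for i qs us
  proof -
    have "encodes_proof_tree (Node (i, ?\<alpha>) qs) (Cell (Cell (enc_index i) ?w) (enc_list us))"
      using that w unfolding encodes_proof_tree_def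
      by (intro encodes_tree.intros) (auto simp: encodes_judgement_iff)
    then show ?thesis unfolding t vups_eq using w by (intro encodes_wrap)
  qed
  consider "ts = []" "vs = []" | u y where "ts = [u]" "vs = [y]" "encodes_trace u y"
    | u y u' y' where "ts = [u, u']" "vs = [y, y']" "encodes_trace u y" "encodes_trace u' y'"
    using tn vs by (cases "(\<psi>, L, map root ts)" rule: trace_node.cases)
      (auto simp: map_eq_Cons_conv list_all2_Cons1)
  then show ?case
  proof cases
    case 1
    have "vindex x l (enc_list vs) = enc_index (leaf_index \<psi> L)"
      using vleaf_eq[OF assms l tl] tn 1 by (simp add: vindex_def)
    then show ?thesis
      using node[of "[]" "[]" "leaf_index \<psi> L"] 1 unfolding v vtree_node
      by (simp add: vproof_step_def proof_step_def Let_def)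
  next
    case (2 u y)
    obtain i z b where i: "follows_set \<psi> i (fst L)" "fst (root u) = fst L \<union> {(i, z)}"
      using tn 2 by (auto simp: unary_node_def split: prod.splits)
    have "(i, z) \<notin> fst L" using i(1) by (auto simp: follows_set_def follows_def)
    then have diff: "fst (root u) - fst L = {(i, z)}" using i(2) by auto
    have yl: "encodes_label (root u) (vfst y)" using child(1)[of u y] 2 by simp
    let ?f = "vfilter (\<lambda>m. \<not> vmem m (vfst l)) (vfst (vfst y))"
    have "set (dec_list ?f) = enc_located ` fst (root u) - enc_located ` fst L"
      using yl l by (auto simp: encodes_label_iff vfilter_def vmem_def)
    also have "\<dots> = {enc_located (i, z)}"
      by (simp add: diff image_set_diff[OF inj_enc_located, symmetric])
    \<comment> \<open>All entries of the filtered list are equal, so its first one is the new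
      located variable whatever the order of the code.\<close>
    finally have "vfst ?f = enc_located (i, z)" by (cases ?f) auto
    then have "vindex x l (enc_list vs) = enc_index i"
      using 2 by (simp add: vindex_def enc_located_def)
    moreover have "(THE m. m \<in> fst (root u) - fst L) = (i, z)" unfolding diff by simp
    ultimately show ?thesis
      using node[OF rs, of i] 2 unfolding v vtree_node
      by (simp add: vproof_step_def[of x l "Cell y Atom"] proof_step_def Let_def)
  next
    case (3 u y u' y')
    have yl: "encodes_label (root u) (vfst y)" "trace_label \<psi> (root u)"
      "encodes_label (root u') (vfst y')" "trace_label \<psi> (root u')"
      using child[of u y] child[of u' y'] 3 by auto
    obtain l0 where l0: "fst (root u) \<union> fst (root u') = insert l0 (fst L)"
      "coherent \<psi> (insert l0 (fst L))" "located_var \<psi> l0"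
      using tn 3 by (fastforce simp: binary_node_def split: prod.splits)
    let ?S = "fst (root u) \<union> fst (root u')"
    have loc: "\<And>m. m \<in> ?S \<Longrightarrow> located_var \<psi> m" "coherent \<psi> ?S"
      using l0 tl by (auto simp: trace_label_def split: prod.splits)
    have "vloc (vappend (vfst (vfst y)) (vfst (vfst y'))) = enc_index (loc ?S)"
      using yl(1,3) by (intro vloc_eq[OF loc]) (auto simp: encodes_label_iff vappend_def)
    then have i: "vindex x l (enc_list vs) = enc_index (loc ?S)"
      using 3 by (simp add: vindex_def)
    let ?q = "\<lambda>u. wrap (downs (loc (fst (root u))) (loc ?S)) (clause_of (snd (root u))) (proof_of \<psi> u)"
    let ?qv = "\<lambda>y. vwrap (vdowns (vloc (vfst (vfst y))) (enc_index (loc ?S))) (vclause_of (vsnd (vfst y)))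
       (vtree (vproof_step x) y)"
    have q: "encodes_proof_tree (?q u) (?qv y)" "encodes_proof_tree (?q u') (?qv y')"
      using rs 3 encodes_label_clause[OF yl(1)] encodes_label_clause[OF yl(3)]
      unfolding encodes_label_vloc[OF yl(1,2)] encodes_label_vloc[OF yl(3,4)] vdowns_eq
      by (auto intro!: encodes_wrap)
    then show ?thesis
      using node[of "[?q u, ?q u']" "[?qv y, ?qv y']" "loc ?S"] 3 i unfolding v vtree_node
      by (simp add: vproof_step_def[of x l "Cell y (Cell y' Atom)"] proof_step_def Let_def)
  qed
qed

theorem theorem4p5:
  "(\<forall>\<psi> n. qcbf_instance \<psi> \<longrightarrow> n \<ge> 1 \<longrightarrow>
      ((\<exists>P. tree_like_empty_clause_proof \<psi> P \<and> num_nonflow \<psi> P = n) \<longleftrightarrow>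
       (\<exists>T. is_trace \<psi> T \<and> root T = ({}, Map.empty) \<and> num_nodes T = n)))
   \<and> poly_time_translation encodes_proof_tree encodes_trace
       (\<lambda>\<psi> P. tree_like_empty_clause_proof \<psi> P)
       (\<lambda>\<psi> P T. is_trace \<psi> T \<and> root T = ({}, Map.empty) \<and> num_nodes T = num_nonflow \<psi> P)
   \<and> poly_time_translation encodes_trace encodes_proof_tree
       (\<lambda>\<psi> T. is_trace \<psi> T \<and> root T = ({}, Map.empty))
       (\<lambda>\<psi> T P. tree_like_empty_clause_proof \<psi> P \<and> num_nonflow \<psi> P = num_nodes T)"
proof (intro conjI)
  have to_trace: "is_trace \<psi> (trace_of \<psi> P) \<and> root (trace_of \<psi> P) = ({}, Map.empty)
      \<and> num_nodes (trace_of \<psi> P) = num_nonflow \<psi> P"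
    if "qcbf_instance \<psi>" "tree_like_empty_clause_proof \<psi> P" for \<psi> P
    using that trace_of_correct[of \<psi> P]
    by (auto simp: tree_like_empty_clause_proof_iff qcbf_instance_def label_def asg_def)
  have to_proof: "tree_like_empty_clause_proof \<psi> (proof_of \<psi> T)
      \<and> num_nonflow \<psi> (proof_of \<psi> T) = num_nodes T"
    if "qcbf_instance \<psi>" "is_trace \<psi> T" "root T = ({}, Map.empty)" for \<psi> T
  proof -
    \<comment> \<open>The root label thus yields the empty clause; since \<open>loc {} = []\<close>,
      its proof ends at the root of the formula.\<close>
    have "clause_of Map.empty = {}" using cvars_clause_of[of Map.empty] by (auto simp: cvars_def)
    then show ?thesis
      using that proof_of_correct[of \<psi> T] by (simp add: tree_like_empty_clause_proof_iff)
  qed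
  show "\<forall>\<psi> n. qcbf_instance \<psi> \<longrightarrow> n \<ge> 1 \<longrightarrow>
      ((\<exists>P. tree_like_empty_clause_proof \<psi> P \<and> num_nonflow \<psi> P = n) \<longleftrightarrow>
       (\<exists>T. is_trace \<psi> T \<and> root T = ({}, Map.empty) \<and> num_nodes T = n))"
    using to_trace to_proof by metis
  show "poly_time_translation encodes_proof_tree encodes_trace
       (\<lambda>\<psi> P. tree_like_empty_clause_proof \<psi> P)
       (\<lambda>\<psi> P T. is_trace \<psi> T \<and> root T = ({}, Map.empty) \<and> num_nodes T = num_nonflow \<psi> P)"
    unfolding poly_time_translation_def
  proof (intro exI[of _ vtrace] conjI allI impI ptime_poly_time_on ptime_vtrace)
    fix \<psi> P v
    assume "qcbf_instance \<psi> \<and> tree_like_empty_clause_proof \<psi> P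
      \<and> encodes_prod encodes_qcbf encodes_proof_tree (\<psi>, P) v"
    then have *: "qcbf_instance \<psi>" "tree_like_empty_clause_proof \<psi> P"
      "encodes_qcbf \<psi> (vfst v)" "encodes_proof_tree P (vsnd v)"
      by (auto simp: encodes_prod_def)
    then have "encodes_trace (trace_of \<psi> P) (vtrace v)"
      unfolding vtrace_def
      by (intro encodes_trace_of) (auto simp: qcbf_instance_def tree_like_empty_clause_proof_iff)
    then show "\<exists>T. (is_trace \<psi> T \<and> root T = ({}, Map.empty) \<and> num_nodes T = num_nonflow \<psi> P)
        \<and> encodes_trace T (vtrace v)"
      using to_trace[OF *(1,2)] by blast
  qed
  show "poly_time_translation encodes_trace encodes_proof_tree
       (\<lambda>\<psi> T. is_trace \<psi> T \<and> root T = ({}, Map.empty))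
       (\<lambda>\<psi> T P. tree_like_empty_clause_proof \<psi> P \<and> num_nonflow \<psi> P = num_nodes T)"
    unfolding poly_time_translation_def
  proof (intro exI[of _ vproof] conjI allI impI ptime_poly_time_on ptime_vproof)
    fix \<psi> T v
    assume "qcbf_instance \<psi> \<and> (is_trace \<psi> T \<and> root T = ({}, Map.empty))
      \<and> encodes_prod encodes_qcbf encodes_trace (\<psi>, T) v"
    then have *: "qcbf_instance \<psi>" "is_trace \<psi> T" "root T = ({}, Map.empty)"
      "encodes_qcbf \<psi> (vfst v)" "encodes_trace T (vsnd v)"
      by (auto simp: encodes_prod_def)
    then have "encodes_proof_tree (proof_of \<psi> T) (vproof v)"
      unfolding vproof_def by (intro encodes_proof_of)
    then show "\<exists>P. (tree_like_empty_clause_proof \<psi> P \<and> num_nonflow \<psi> P = num_nodes T)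
        \<and> encodes_proof_tree P (vproof v)"
      using to_proof[OF *(1-3)] by blast
  qed
qed

end
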